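(* Let $S_t=S_0e^{X_t}$, where $(X_t)$ is a real Lévy process with triplet $(\sigma^2,b,\nu)$ satisfying the standing assumptions in the context, and let $[X]_t=\sigma^2t+\sum_{s\le t}(\Delta X_s)^2$ be its quadratic variation, which is a subordinator with Lévy density $q(y)=\frac{\nu(\sqrt y)}{2\sqrt y}+\frac{\nu(-\sqrt y)}{2\sqrt y}$, $y>0$. Let $K>0$. Then, as $t\to0$, $$\begin{aligned}\frac1t\,\mathbb{E}([X]_t-K)_+&=\int_0^\infty(y-K)_+\,q(y)\,dy+O(t)\\&=\int_{-\infty}^{\infty}(x^2-K)_+\,\nu(x)\,dx+O(t)\\&=\frac1t\,\mathbb{E}(X_t^2-K)_++O(t)\\&=\frac1t\,\mathbb{E}\Big[\Big(\ln\frac{S_t}{S_0}\Big)^2-K\Big]_+ +O(t).\end{aligned}$$ Thus, as $t\to0$, an out-of-the-money variance call option paying $([X]_t-K)_+$ at time $t$ is worth the same as a European-style contract paying $((\ln\frac{S_t}{S_0})^2-K)_+$ at time $t$, irrespective of $\nu$, and the diffusion component of $X$ does not show up at leading order for small $t$.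
   Context: Triplet convention: $\mathbb{E}e^{iuX_t}=\exp\{t(ibu-\tfrac12\sigma^2u^2+\int(e^{iux}-1-iux1_{|x|\le1})\nu(dx))\}$. $z_+=\max(z,0)$, and $\Delta X_s$ is the jump of $X$ at time $s$. Standing assumptions: $\int_{|x|>1}e^x\nu(dx)<\infty$; the martingale condition $b+\tfrac12\sigma^2+\int_{-\infty}^\infty(e^x-1-x1_{|x|\le1})\nu(dx)=0$; $\nu(dx)$ has a positive density $\nu(x)$, $C^1$ on $\mathbb{R}\setminus\{0\}$, with $\sup_{|x|>\varepsilon}\nu(x)<\infty$ for every $\varepsilon>0$. Interest rate and dividend yield are zero, and expectations are under the risk-neutral measure. *)

theory Defs
  imports "HOL-Probability.Probability" "HOL-Library.Landau_Symbols"
begin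

text \<open>Processes are indexed by \<open>real\<close>; only the times \<open>t \<ge> 0\<close> are relevant.\<close>

definition cadlag :: "(real \<Rightarrow> real) \<Rightarrow> bool" where
  "cadlag f \<longleftrightarrow> (\<forall>t\<ge>0. (f \<longlongrightarrow> f t) (at_right t)) \<and> (\<forall>t>0. \<exists>l. (f \<longlongrightarrow> l) (at_left t))"

definition jump :: "(real \<Rightarrow> real) \<Rightarrow> real \<Rightarrow> real" where
  "jump f t = f t - Lim (at_left t) f"

definition levy_process :: "'a measure \<Rightarrow> (real \<Rightarrow> 'a \<Rightarrow> real) \<Rightarrow> bool" where
  "levy_process M X \<longleftrightarrow>
     prob_space M \<and>
     (\<forall>t\<ge>0. X t \<in> borel_measurable M) \<and>
     (AE \<omega> in M. X 0 \<omega> = 0) \<and>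
     (\<forall>(n::nat) (\<tau> :: nat \<Rightarrow> real). 0 \<le> \<tau> 0 \<and> mono \<tau> \<longrightarrow>
        prob_space.indep_vars M (\<lambda>_. borel) (\<lambda>i \<omega>. X (\<tau> (Suc i)) \<omega> - X (\<tau> i) \<omega>) {..<n}) \<and>
     (\<forall>s\<ge>0. \<forall>t\<ge>0. distr M borel (\<lambda>\<omega>. X (s + t) \<omega> - X s \<omega>) = distr M borel (X t)) \<and>
     (AE \<omega> in M. cadlag (\<lambda>t. X t \<omega>))"

definition levy_measure :: "real measure \<Rightarrow> bool" where
  "levy_measure N \<longleftrightarrow>
     sets N = sets borel \<and> emeasure N {0} = 0 \<and> (\<integral>\<^sup>+x. ennreal (min 1 (x\<^sup>2)) \<partial>N) < \<infinity>"

text \<open>\<open>v\<close> is the Gaussian variance, that is, \<open>\<sigma>\<^sup>2\<close> in the triplet.\<close>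

definition levy_exponent :: "real \<Rightarrow> real \<Rightarrow> real measure \<Rightarrow> real \<Rightarrow> complex" where
  "levy_exponent v b N u =
     \<i> * of_real (b * u) - of_real (v * u\<^sup>2 / 2) +
     (CLINT x|N. exp (\<i> * of_real (u * x)) - 1 - \<i> * of_real (u * x * indicator {-1..1} x))"

definition has_levy_triplet ::
  "'a measure \<Rightarrow> (real \<Rightarrow> 'a \<Rightarrow> real) \<Rightarrow> real \<Rightarrow> real \<Rightarrow> real measure \<Rightarrow> bool" where
  "has_levy_triplet M X v b N \<longleftrightarrow>
     v \<ge> 0 \<and> levy_measure N \<and>
     (\<forall>t\<ge>0. \<forall>u. char (distr M borel (X t)) u = exp (of_real t * levy_exponent v b N u))"

definition subordinator :: "'a measure \<Rightarrow> (real \<Rightarrow> 'a \<Rightarrow> real) \<Rightarrow> bool" where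
  "subordinator M Y \<longleftrightarrow> levy_process M Y \<and> (AE \<omega> in M. mono_on {0..} (\<lambda>t. Y t \<omega>))"

definition has_levy_density :: "'a measure \<Rightarrow> (real \<Rightarrow> 'a \<Rightarrow> real) \<Rightarrow> (real \<Rightarrow> real) \<Rightarrow> bool" where
  "has_levy_density M Y q \<longleftrightarrow>
     (\<exists>v b. has_levy_triplet M Y v b (density lborel (\<lambda>y. ennreal (q y))))"

definition indistinguishable ::
  "'a measure \<Rightarrow> (real \<Rightarrow> 'a \<Rightarrow> real) \<Rightarrow> (real \<Rightarrow> 'a \<Rightarrow> real) \<Rightarrow> bool" where
  "indistinguishable M X Y \<longleftrightarrow> (AE \<omega> in M. \<forall>t\<ge>0. X t \<omega> = Y t \<omega>)"

text \<open>The squared jumps of a Levy process are almost surely summable over bounded time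
  intervals. On the exceptional null set the infinite sum is \<open>0\<close> by convention, so path
  properties of \<open>quad_var\<close> can only be expected almost surely.\<close>

definition quad_var :: "real \<Rightarrow> (real \<Rightarrow> 'a \<Rightarrow> real) \<Rightarrow> real \<Rightarrow> 'a \<Rightarrow> real" where
  "quad_var \<sigma> X t \<omega> = \<sigma>\<^sup>2 * t + (\<Sum>\<^sub>\<infinity>s\<in>{0<..t}. (jump (\<lambda>r. X r \<omega>) s)\<^sup>2)"

definition qv_density :: "(real \<Rightarrow> real) \<Rightarrow> real \<Rightarrow> real" where
  "qv_density \<nu> y =
     (if y > 0 then \<nu> (sqrt y) / (2 * sqrt y) + \<nu> (- sqrt y) / (2 * sqrt y) else 0)"

text \<open>Hypotheses on the triplet \<open>(\<sigma>\<^sup>2, b, \<nu>(x) dx)\<close>. The value \<open>\<nu> 0\<close> is irrelevant.\<close>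

definition standing_assumptions :: "real \<Rightarrow> real \<Rightarrow> (real \<Rightarrow> real) \<Rightarrow> bool" where
  "standing_assumptions \<sigma> b \<nu> \<longleftrightarrow>
     (let N = density lborel (\<lambda>x. ennreal (\<nu> x)) in
       set_integrable N {x. \<bar>x\<bar> > 1} exp \<and>
       b + \<sigma>\<^sup>2 / 2 + (LINT x|N. exp x - 1 - x * indicator {-1..1} x) = 0) \<and>
     (\<forall>x. x \<noteq> 0 \<longrightarrow> \<nu> x > 0) \<and>
     \<nu> C1_differentiable_on (- {0}) \<and>
     (\<forall>\<epsilon>>0. bdd_above (\<nu> ` {x. \<bar>x\<bar> > \<epsilon>}))"

text \<open>\<open>f(t) = g(t) + O(t)\<close> as \<open>t\<close> decreases to \<open>0\<close>, for functions that may take the value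
  \<open>\<infinity>\<close>: the integrability of \<open>e\<^sup>x\<close> over \<open>\<bar>x\<bar> > 1\<close> does not control \<open>x\<^sup>2\<close> on the negative
  half-line, so expectations of payoffs quadratic in \<open>X\<close> may be infinite. For finite values
  the relation is the usual one, by the lemma below.\<close>

definition eq_up_to_O_t :: "(real \<Rightarrow> ennreal) \<Rightarrow> (real \<Rightarrow> ennreal) \<Rightarrow> bool" where
  "eq_up_to_O_t f g \<longleftrightarrow>
     (\<exists>C::real. \<forall>\<^sub>F t in at_right 0. f t \<le> g t + ennreal (C * t) \<and> g t \<le> f t + ennreal (C * t))"

lemma eq_up_to_O_t_iff_bigo:
  assumes "\<And>t. f t \<ge> 0" "\<And>t. g t \<ge> 0"
  shows "eq_up_to_O_t (\<lambda>t. ennreal (f t)) (\<lambda>t. ennreal (g t)) \<longleftrightarrow>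
         (\<lambda>t. f t - g t) \<in> O[at_right 0](\<lambda>t. t)"
proof
  assume "eq_up_to_O_t (\<lambda>t. ennreal (f t)) (\<lambda>t. ennreal (g t))"
  then obtain C where C: "\<forall>\<^sub>F t in at_right 0. ennreal (f t) \<le> ennreal (g t) + ennreal (C * t)
      \<and> ennreal (g t) \<le> ennreal (f t) + ennreal (C * t)"
    unfolding eq_up_to_O_t_def by blast
  have "\<forall>\<^sub>F t in at_right 0. norm (f t - g t) \<le> \<bar>C\<bar> * norm t"
    using C eventually_at_right_less[of "0::real"]
  proof eventually_elim
    case (elim t)
    have "ennreal (C * t) \<le> ennreal (\<bar>C\<bar> * t)"
      using elim by (intro ennreal_leI mult_right_mono) auto
    then have "ennreal (f t) \<le> ennreal (g t) + ennreal (\<bar>C\<bar> * t)"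
        "ennreal (g t) \<le> ennreal (f t) + ennreal (\<bar>C\<bar> * t)"
      using elim by (meson add_left_mono order_trans)+
    moreover have "0 \<le> g t + \<bar>C\<bar> * t" "0 \<le> f t + \<bar>C\<bar> * t"
      using elim assms by simp_all
    ultimately have "f t \<le> g t + \<bar>C\<bar> * t" "g t \<le> f t + \<bar>C\<bar> * t"
      using elim assms by (simp_all flip: ennreal_plus add: ennreal_le_iff)
    then show ?case
      using elim by (simp add: abs_le_iff)
  qed
  then show "(\<lambda>t. f t - g t) \<in> O[at_right 0](\<lambda>t. t)"
    by (rule bigoI)
next
  assume "(\<lambda>t. f t - g t) \<in> O[at_right 0](\<lambda>t. t)"
  then obtain C where C: "C > 0" "\<forall>\<^sub>F t in at_right 0. norm (f t - g t) \<le> C * norm t"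
    by (elim landau_o.bigE) auto
  have "\<forall>\<^sub>F t in at_right 0. ennreal (f t) \<le> ennreal (g t) + ennreal (C * t)
      \<and> ennreal (g t) \<le> ennreal (f t) + ennreal (C * t)"
    using C(2) eventually_at_right_less[of "0::real"]
  proof eventually_elim
    case (elim t)
    then have "f t \<le> g t + C * t" "g t \<le> f t + C * t" "C * t \<ge> 0"
      using C(1) by (auto simp: abs_le_iff)
    then show ?case
      using assms by (simp flip: ennreal_plus add: ennreal_leI)
  qed
  then show "eq_up_to_O_t (\<lambda>t. ennreal (f t)) (\<lambda>t. ennreal (g t))"
    unfolding eq_up_to_O_t_def by blast
qed

end

theory Submission
  imports Defs
begin

text \<open>
  Fix a level \<open>\<epsilon>\<close> well below the point where the payoff \<open>g\<close> becomes positive. The law of \<open>X\<^sub>t\<close> is the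
  convolution of a law \<open>Z\<^sub>t\<close> carrying the Gaussian part and the jumps up to \<open>\<epsilon>\<close> with a compound Poisson law
  carrying the larger jumps. Expand \<open>E g(X\<^sub>t)\<close> in the number of large jumps. Without a large jump, reaching the
  region where \<open>g > 0\<close> costs \<open>O(t\<^sup>2)\<close>, by exponential moments of \<open>Z\<^sub>t\<close>; two or more large jumps cost \<open>O(t\<^sup>2)\<close> as
  well. One large jump contributes \<open>t E G(Z\<^sub>t)\<close> up to a factor \<open>exp (- t rate)\<close>, where \<open>G z\<close> is the integral of
  \<open>g (z + x)\<close> over the large jumps \<open>x\<close>; the bounded density smooths the kinks of \<open>g\<close>, so \<open>G\<close> has a first-order
  expansion at \<open>0\<close> with quadratic remainder, and \<open>E Z\<^sub>t\<close>, \<open>E Z\<^sub>t\<^sup>2\<close> are \<open>O(t)\<close>. If the integral of \<open>g\<close> against the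
  Levy measure is infinite, the one-jump term already is.

  The same argument applies to the quadratic variation once it is known to be a Levy process whose Levy measure
  is the image of \<open>\<nu>\<close> under squaring. For continuous \<open>f\<close> vanishing near \<open>0\<close>, the sums of \<open>f\<close> over the increments
  of a cadlag path along finer and finer grids converge to the sum of \<open>f\<close> over its jumps, while the characteristic
  function of the increment sums is a power of an expectation at a small time, whose limit is given by the
  convergence of \<open>E F(X\<^sub>t) / t\<close> to the integral of \<open>F\<close> against \<open>\<nu>\<close>. Letting \<open>f\<close> increase to the square gives the law of
  the sum of the squared jumps.
\<close>

text \<open>The expansion takes place at the level of laws: characteristic functions and their
  uniqueness identify the law of X at time t, so the paths never have to be decomposed into
  independent small and large jumps. Two difficulties shape the proof. The hypotheses put no moment
  condition on large negative jumps, so a quadratic payoff may have infinite expectation. Hence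
  integrals take values in \<open>ennreal\<close>, and each payoff \<open>g\<close> comes with a
  weight \<open>W\<close> that is submultiplicative up to a factor 2, dominates \<open>g\<close> and
  is dominated by \<open>1 + g\<close>, up to constants; integrability of \<open>W\<close> over the
  large jumps separates the finite from the infinite case. Secondly, the payoffs have kinks, while
  an error O(t) requires a quadratic remainder in the displacement z. A kink spoils the first-order
  formula only for jumps in an interval of length O(|z|), by an amount O(|z|), and a bounded density
  gives that interval mass O(|z|). On the side of paths, the sum of the squared jumps ranges over
  uncountably many times; its measurability, law and independence are all inherited from increment
  sums on grids.\<close>

section \<open>Convolution powers and compound Poisson laws\<close>

lemma real_distribution_convolution:
  assumes "real_distribution P" "real_distribution Q"
  shows "real_distribution (P \<star> Q)"
proof -
  interpret P: real_distribution P by fact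
  interpret Q: real_distribution Q by fact
  interpret PQ: pair_prob_space P Q ..
  show ?thesis
    unfolding convolution_def
    by (intro PQ.real_distribution_distr) measurable
qed

lemma char_convolution:
  assumes "real_distribution P" "real_distribution Q"
  shows "char (P \<star> Q) u = char P u * char Q u"
proof -
  interpret P: real_distribution P by fact
  interpret Q: real_distribution Q by fact
  interpret PQ: pair_prob_space P Q ..
  have "char (P \<star> Q) u = (CLINT z|(P \<Otimes>\<^sub>M Q). iexp (u * (fst z + snd z)))"
    unfolding char_def convolution_def by (subst integral_distr) (auto simp: case_prod_beta)
  also have "\<dots> = (CLINT x|P. CLINT y|Q. iexp (u * (x + y)))"
    by (subst PQ.integral_fst'[symmetric]) (auto intro!: PQ.integrable_const_bound[of _ 1])
  also have "\<dots> = (CLINT x|P. iexp (u * x) * (CLINT y|Q. iexp (u * y)))"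
    by (simp add: distrib_left exp_add)
  also have "\<dots> = char P u * char Q u"
    by (simp add: char_def)
  finally show ?thesis .
qed

primrec conv_pow :: "real measure \<Rightarrow> nat \<Rightarrow> real measure" where
  "conv_pow P 0 = return borel 0"
| "conv_pow P (Suc n) = (P \<star> conv_pow P n)"

lemma sets_conv_pow[simp, measurable_cong]: "sets (conv_pow P n) = sets borel"
  by (cases n) auto

lemma real_distribution_return: "real_distribution (return borel x)"
  by (auto simp: real_distribution_def real_distribution_axioms_def intro!: prob_space_return)

lemma real_distribution_conv_pow:
  "real_distribution P \<Longrightarrow> real_distribution (conv_pow P n)"
  by (induction n) (auto intro: real_distribution_convolution real_distribution_return)

lemma char_conv_pow:
  assumes "real_distribution P"
  shows "char (conv_pow P n) u = char P u ^ n"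
proof (induction n)
  case 0
  show ?case by (simp add: char_def integral_return)
next
  case (Suc n)
  then show ?case
    by (simp add: char_convolution assms real_distribution_conv_pow)
qed

lemma nn_integral_convolution_real:
  assumes "real_distribution P" "real_distribution Q" "f \<in> borel_measurable borel"
  shows "(\<integral>\<^sup>+x. f x \<partial>(P \<star> Q)) = (\<integral>\<^sup>+x. \<integral>\<^sup>+y. f (x + y) \<partial>Q \<partial>P)"
proof -
  interpret P: real_distribution P by fact
  interpret Q: real_distribution Q by fact
  show ?thesis
    by (rule nn_integral_convolution) (use assms(3) in \<open>auto intro: P.finite_measure_axioms Q.finite_measure_axioms\<close>)
qed

lemma nn_integral_conv_pow_exp:
  assumes "real_distribution P"
  shows "(\<integral>\<^sup>+x. ennreal (exp (\<kappa> * x)) \<partial>conv_pow P n) = (\<integral>\<^sup>+x. ennreal (exp (\<kappa> * x)) \<partial>P) ^ n"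
proof (induction n)
  case 0
  show ?case by (simp add: nn_integral_return)
next
  case (Suc n)
  interpret P: real_distribution P by fact
  have "(\<integral>\<^sup>+x. ennreal (exp (\<kappa> * x)) \<partial>conv_pow P (Suc n))
      = (\<integral>\<^sup>+x. \<integral>\<^sup>+y. ennreal (exp (\<kappa> * x)) * ennreal (exp (\<kappa> * y)) \<partial>conv_pow P n \<partial>P)"
    by (simp add: nn_integral_convolution_real assms real_distribution_conv_pow distrib_left exp_add ennreal_mult)
  also have "\<dots> = (\<integral>\<^sup>+x. ennreal (exp (\<kappa> * x)) \<partial>P) * (\<integral>\<^sup>+x. ennreal (exp (\<kappa> * x)) \<partial>conv_pow P n)"
    by (subst nn_integral_cmult) (simp_all add: nn_integral_multc)
  finally show ?case by (simp add: Suc)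
qed

text \<open>Each summand can be split off the weight at the price of a factor 2, so the expected
  weight grows only geometrically in the number of jumps and remains summable against Poisson
  probabilities. The shift \<open>z\<close> is arbitrary because the induction moves the first
  summand into it.\<close>

lemma nn_integral_conv_pow_submult:
  assumes P: "real_distribution P"
    and [measurable]: "W \<in> borel_measurable borel"
    and W: "\<And>x y. W (x + y) \<le> (2::ennreal) * W x * W y"
  shows "(\<integral>\<^sup>+x. W (z + x) \<partial>conv_pow P n) \<le> W z * (2 * (\<integral>\<^sup>+x. W x \<partial>P)) ^ n"
proof (induction n arbitrary: z)
  case 0
  show ?case by (simp add: nn_integral_return)
next
  case (Suc n)
  interpret P: real_distribution P by fact
  have "(\<integral>\<^sup>+x. W (z + x) \<partial>conv_pow P (Suc n)) = (\<integral>\<^sup>+x. \<integral>\<^sup>+y. W ((z + x) + y) \<partial>conv_pow P n \<partial>P)"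
    by (simp add: nn_integral_convolution_real assms real_distribution_conv_pow add.assoc)
  also have "\<dots> \<le> (\<integral>\<^sup>+x. W (z + x) * (2 * (\<integral>\<^sup>+x. W x \<partial>P)) ^ n \<partial>P)"
    by (intro nn_integral_mono Suc)
  also have "\<dots> \<le> (\<integral>\<^sup>+x. (2 * W z * W x) * (2 * (\<integral>\<^sup>+x. W x \<partial>P)) ^ n \<partial>P)"
    by (intro nn_integral_mono mult_right_mono W) auto
  also have "\<dots> = W z * (2 * (\<integral>\<^sup>+x. W x \<partial>P)) ^ Suc n"
    by (simp add: nn_integral_cmult nn_integral_multc mult_ac)
  finally show ?case .
qed

text \<open>A mixture over the number of jumps, so that integrals turn into series indexed by that
  number.\<close>

definition compound_poisson :: "real \<Rightarrow> real measure \<Rightarrow> real measure" where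
  "compound_poisson r P = measure_pmf (poisson_pmf r) \<bind> conv_pow P"

context
  fixes r :: real and P :: "real measure"
  assumes r: "r > 0" and P: "real_distribution P"
begin

interpretation P: real_distribution P by (rule P)

lemma conv_pow_measurable: "conv_pow P \<in> measurable (measure_pmf (poisson_pmf r)) (subprob_algebra borel)"
proof -
  have "subprob_space (conv_pow P n)" for n
    using real_distribution_conv_pow[OF P, of n] prob_space_imp_subprob_space
    by (auto simp: real_distribution_def)
  then show ?thesis
    by (auto simp: space_subprob_algebra)
qed

lemma sets_compound_poisson[simp]: "sets (compound_poisson r P) = sets borel"
  unfolding compound_poisson_def
  by (rule sets_bind) (auto)

lemma real_distribution_compound_poisson: "real_distribution (compound_poisson r P)"
proof -
  have "prob_space (compound_poisson r P)"
    unfolding compound_poisson_def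
    by (rule prob_space.prob_space_bind[OF prob_space_measure_pmf _ conv_pow_measurable])
       (use real_distribution_conv_pow[OF P] in \<open>auto simp: real_distribution_def\<close>)
  then show ?thesis
    by (simp add: real_distribution_def real_distribution_axioms_def)
qed

lemma nn_integral_compound_poisson:
  assumes "f \<in> borel_measurable borel"
  shows "(\<integral>\<^sup>+x. f x \<partial>compound_poisson r P) =
    (\<Sum>n. ennreal (r ^ n / fact n * exp (- r)) * (\<integral>\<^sup>+x. f x \<partial>conv_pow P n))"
  unfolding compound_poisson_def
  by (subst nn_integral_bind[OF assms conv_pow_measurable])
     (simp add: nn_integral_measure_pmf nn_integral_count_space_nat r)

lemma suminf_poisson_power:
  assumes "0 \<le> (m::real)"
  shows "(\<Sum>n. ennreal (r ^ n / fact n * exp (- r)) * ennreal m ^ n) = ennreal (exp (r * m - r))"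
proof -
  have "(\<lambda>n. (r * m) ^ n /\<^sub>R fact n) sums exp (r * m)"
    by (rule exp_converges)
  then have "(\<lambda>n. (r * m) ^ n /\<^sub>R fact n * exp (- r)) sums (exp (r * m) * exp (-r))"
    by (rule sums_mult2)
  then have "(\<lambda>n. r ^ n / fact n * exp (- r) * m ^ n) sums exp (r * m - r)"
    by (simp add: exp_diff exp_minus field_simps power_mult_distrib)
  then have "(\<Sum>n. ennreal (r ^ n / fact n * exp (- r) * m ^ n)) = ennreal (exp (r * m - r))"
    using assms r by (intro suminf_ennreal_eq) auto
  moreover have "ennreal (r ^ n / fact n * exp (- r) * m ^ n) = ennreal (r ^ n / fact n * exp (- r)) * ennreal m ^ n" for n
    using assms r by (simp add: ennreal_power flip: ennreal_mult)
  ultimately show ?thesis by simp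
qed

lemma nn_integral_compound_poisson_exp:
  assumes "(\<integral>\<^sup>+x. ennreal (exp (\<kappa> * x)) \<partial>P) = ennreal m" "0 \<le> m"
  shows "(\<integral>\<^sup>+x. ennreal (exp (\<kappa> * x)) \<partial>compound_poisson r P) = ennreal (exp (r * m - r))"
  using suminf_poisson_power[OF assms(2)]
  by (subst nn_integral_compound_poisson) (simp_all add: nn_integral_conv_pow_exp[OF P] assms(1))

text \<open>The series for nonnegative integrands is applied to \<open>f + B\<close>. Subtracting
  the constant \<open>B\<close>, whose own series is the exponential one, recovers the signed
  integrand.\<close>

lemma integral_compound_poisson:
  fixes f :: "real \<Rightarrow> real"
  assumes [measurable]: "f \<in> borel_measurable borel" and bound: "\<And>x. \<bar>f x\<bar> \<le> B"
  shows "(\<lambda>n. (r ^ n / fact n * exp (- r)) * (LINT x|conv_pow P n. f x)) sums (LINT x|compound_poisson r P. f x)"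
proof -
  define p where "p n = r ^ n / fact n * exp (- r)" for n
  have p0: "p n \<ge> 0" for n using r by (simp add: p_def)
  have B: "B \<ge> 0" using bound[of 0] by simp
  have nn: "f x + B \<ge> 0" for x using bound[of x] by (simp add: abs_le_iff)
  have D: "(\<integral>\<^sup>+x. ennreal (f x + B) \<partial>Q) = ennreal ((LINT x|Q. f x) + B)
        \<and> 0 \<le> (LINT x|Q. f x) + B" if "real_distribution Q" for Q
  proof -
    interpret Q: real_distribution Q by fact
    have i: "integrable Q f"
      by (rule Q.integrable_const_bound[of _ B]) (use bound in auto)
    have "(\<integral>\<^sup>+x. ennreal (f x + B) \<partial>Q) = ennreal (LINT x|Q. f x + B)"
      using nn i by (intro nn_integral_eq_integral) auto
    moreover have "(LINT x|Q. f x + B) = (LINT x|Q. f x) + B"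
      using i Q.prob_space by (subst Bochner_Integration.integral_add) auto
    moreover have "(LINT x|Q. f x + B) \<ge> 0" using nn by simp
    ultimately show ?thesis by simp
  qed
  let ?I = "\<lambda>n. LINT x|conv_pow P n. f x"
  have "ennreal ((LINT x|compound_poisson r P. f x) + B) = (\<Sum>n. ennreal (p n) * ennreal (?I n + B))"
    using D[OF real_distribution_compound_poisson] D[OF real_distribution_conv_pow[OF P]]
      nn_integral_compound_poisson[of "\<lambda>x. ennreal (f x + B)"]
    by (simp add: p_def[symmetric] del: times_divide_eq_left)
  also have "\<dots> = (\<Sum>n. ennreal (p n * (?I n + B)))"
    using p0 D[OF real_distribution_conv_pow[OF P]] by (simp add: ennreal_mult)
  finally have eq: "(\<Sum>n. ennreal (p n * (?I n + B))) = ennreal ((LINT x|compound_poisson r P. f x) + B)" ..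
  have nn2: "0 \<le> p n * (?I n + B)" for n
    using p0 D[OF real_distribution_conv_pow[OF P]] by simp
  have "(\<lambda>n. p n * (?I n + B)) sums ((LINT x|compound_poisson r P. f x) + B)"
  proof -
    have s: "summable (\<lambda>n. p n * (?I n + B))"
      by (rule summable_suminf_not_top) (use eq nn2 in auto)
    have "ennreal (\<Sum>n. p n * (?I n + B)) = ennreal ((LINT x|compound_poisson r P. f x) + B)"
      using eq suminf_ennreal2[OF nn2 s] by simp
    then have "(\<Sum>n. p n * (?I n + B)) = ((LINT x|compound_poisson r P. f x) + B)"
      using D[OF real_distribution_compound_poisson] suminf_nonneg[OF s nn2] by (simp add: ennreal_inj)
    then show ?thesis using s by (simp add: sums_iff)
  qed
  moreover have "(\<lambda>n. p n * B) sums B"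
  proof -
    have "(\<lambda>n. r ^ n /\<^sub>R fact n * (exp (- r) * B)) sums (exp r * (exp (-r) * B))"
      by (rule sums_mult2[OF exp_converges])
    then show ?thesis by (simp add: exp_minus field_simps p_def)
  qed
  ultimately have "(\<lambda>n. p n * (?I n + B) - p n * B) sums ((LINT x|compound_poisson r P. f x) + B - B)"
    by (rule sums_diff)
  then have "(\<lambda>n. p n * ?I n) sums (LINT x|compound_poisson r P. f x)" by (simp add: algebra_simps)
  then show ?thesis by (simp only: p_def)
qed

lemma char_compound_poisson:
  "char (compound_poisson r P) u = exp (of_real r * (char P u - 1))"
proof -
  let ?p = "\<lambda>n. r ^ n / fact n * exp (- r)"
  have Re: "Re (char Q u) = (LINT x|Q. cos (u * x))" and Im: "Im (char Q u) = (LINT x|Q. sin (u * x))"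
    if "real_distribution Q" for Q
  proof -
    interpret Q: real_distribution Q by fact
    have i: "integrable Q (\<lambda>x. iexp (u * x))"
      by (rule Q.integrable_const_bound[of _ 1]) auto
    show "Re (char Q u) = (LINT x|Q. cos (u * x))" "Im (char Q u) = (LINT x|Q. sin (u * x))"
      unfolding char_def using i by (simp_all flip: integral_Re integral_Im add: Re_exp Im_exp)
  qed
  \<comment> \<open>The series is available for bounded real integrands, here cosine and
    sine.\<close>
  have "(\<lambda>n. ?p n * Re (char (conv_pow P n) u)) sums Re (char (compound_poisson r P) u)"
    "(\<lambda>n. ?p n * Im (char (conv_pow P n) u)) sums Im (char (compound_poisson r P) u)"
    unfolding Re[OF real_distribution_compound_poisson] Im[OF real_distribution_compound_poisson]
      Re[OF real_distribution_conv_pow[OF P]] Im[OF real_distribution_conv_pow[OF P]]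
    by (rule integral_compound_poisson[of _ 1]; simp)+
  then have "(\<lambda>n. of_real (?p n) * char (conv_pow P n) u) sums char (compound_poisson r P) u"
    by (subst sums_complex_iff) (simp only: Re_complex_of_real Im_complex_of_real times_complex.sel; simp)
  moreover have "(\<lambda>n. of_real (?p n) * char (conv_pow P n) u) sums exp (of_real r * (char P u - 1))"
  proof -
    have "(\<lambda>n. (of_real r * char P u) ^ n /\<^sub>R fact n * exp (- of_real r)) sums (exp (of_real r * char P u) * exp (- of_real r))"
      by (rule sums_mult2[OF exp_converges])
    then show ?thesis
      by (simp add: char_conv_pow[OF P] algebra_simps exp_diff exp_minus power_mult_distrib
          scaleR_conv_of_real divide_inverse exp_of_real)
  qed
  ultimately show ?thesis by (rule sums_unique2)
qed

end

section \<open>Gaussian laws and compound Poisson laws of truncated Levy measures\<close>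

text \<open>An image of the standard normal law rather than a density: this includes
  \<open>s = 0\<close>, a point mass, which occurs when there is no diffusion component.\<close>

definition gaussian :: "real \<Rightarrow> real \<Rightarrow> real measure" where
  "gaussian m s = distr std_normal_distribution borel (\<lambda>x. m + s * x)"

lemma real_distribution_gaussian: "real_distribution (gaussian m s)"
proof -
  interpret G: real_distribution std_normal_distribution by (rule real_dist_normal_dist)
  show ?thesis unfolding gaussian_def by (rule G.real_distribution_distr) simp
qed

lemma sets_gaussian[simp, measurable_cong]: "sets (gaussian m s) = sets borel"
  by (simp add: gaussian_def)

lemma char_gaussian: "char (gaussian m s) u = exp (\<i> * of_real (m * u) - of_real ((s * u)\<^sup>2 / 2))"
proof -
  have "char (gaussian m s) u = (CLINT x|std_normal_distribution. iexp (u * (m + s * x)))"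
    unfolding char_def gaussian_def by (subst integral_distr) auto
  also have "\<dots> = (CLINT x|std_normal_distribution. iexp (u * m) * iexp (s * u * x))"
    by (simp add: distrib_left exp_add mult_ac)
  also have "\<dots> = iexp (u * m) * char std_normal_distribution (s * u)"
    unfolding char_def by (rule integral_mult_right_zero)
  also have "\<dots> = exp (\<i> * of_real (m * u)) * exp (of_real (- ((s * u)\<^sup>2 / 2)))"
    by (simp only: char_std_normal_distribution exp_of_real mult.commute[of u m] minus_divide_left)
  also have "\<dots> = exp (\<i> * of_real (m * u) - of_real ((s * u)\<^sup>2 / 2))"
    by (subst exp_add[symmetric]) simp
  finally show ?thesis .
qed

lemma nn_integral_gaussian_exp:
  "(\<integral>\<^sup>+x. ennreal (exp (\<kappa> * x)) \<partial>gaussian m s) = ennreal (exp (\<kappa> * m + (\<kappa> * s)\<^sup>2 / 2))"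
proof -
  \<comment> \<open>Completing the square: the exponential factor tilts the standard normal density
    into the one with mean \<open>\<kappa> * s\<close>.\<close>
  have *: "std_normal_density x * exp (\<kappa> * (m + s * x))
      = exp (\<kappa> * m + (\<kappa> * s)\<^sup>2 / 2) * normal_density (\<kappa> * s) 1 x" for x
    by (simp add: std_normal_density_def normal_density_def power2_eq_square algebra_simps diff_divide_distrib add_divide_distrib flip: exp_add)
  have "(\<integral>\<^sup>+x. ennreal (exp (\<kappa> * x)) \<partial>gaussian m s)
      = (\<integral>\<^sup>+x. ennreal (std_normal_density x * exp (\<kappa> * (m + s * x))) \<partial>lborel)"
    unfolding gaussian_def by (subst nn_integral_distr) (auto simp: nn_integral_density ennreal_mult)
  also have "\<dots> = ennreal (exp (\<kappa> * m + (\<kappa> * s)\<^sup>2 / 2)) * (\<integral>\<^sup>+x. ennreal (normal_density (\<kappa> * s) 1 x) \<partial>lborel)"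
    unfolding * by (simp add: ennreal_mult nn_integral_cmult)
  also have "(\<integral>\<^sup>+x. ennreal (normal_density (\<kappa> * s) 1 x) \<partial>lborel) = 1"
    by (subst nn_integral_eq_integral) auto
  finally show ?thesis by simp
qed

lemma exp_remainder_bound: "\<bar>exp y - 1 - y\<bar> \<le> (y\<^sup>2 / 2) * exp \<bar>y::real\<bar>"
proof -
  obtain z where z: "\<bar>z\<bar> \<le> \<bar>y\<bar>" "exp y = (\<Sum>m<2. y ^ m / fact m) + exp z / fact 2 * y ^ 2"
    using Maclaurin_exp_le[of y 2] by blast
  have "\<bar>exp y - 1 - y\<bar> = exp z * (y\<^sup>2 / 2)"
    using z(2) by (simp add: numeral_2_eq_2 abs_mult)
  also have "\<dots> \<le> exp \<bar>y\<bar> * (y\<^sup>2 / 2)"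
    using z(1) by (intro mult_right_mono) auto
  finally show ?thesis by (simp add: mult.commute)
qed

text \<open>Weak convergence controls bounded continuous functions only, so the exponential is
  capped at the level \<open>k\<close>. The bound survives the weak limit for each \<open>k\<close>,
  and Fatou's lemma removes the cap.\<close>

lemma weak_conv_exp_moment_le:
  assumes M: "\<And>n. real_distribution (\<mu> n)" "real_distribution L" "weak_conv_m \<mu> L"
    and bd: "\<And>n. (\<integral>\<^sup>+x. ennreal (exp (\<kappa> * x)) \<partial>\<mu> n) \<le> ennreal B" and B: "B \<ge> 0"
  shows "(\<integral>\<^sup>+x. ennreal (exp (\<kappa> * x)) \<partial>L) \<le> ennreal B"
proof -
  interpret L: real_distribution L by fact
  have le: "(\<integral>\<^sup>+x. ennreal (min (exp (\<kappa> * x)) (real k)) \<partial>L) \<le> ennreal B" for k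
  proof -
    have conv: "(\<lambda>n. integral\<^sup>L (\<mu> n) (\<lambda>x. min (exp (\<kappa> * x)) (real k))) \<longlonglongrightarrow> integral\<^sup>L L (\<lambda>x. min (exp (\<kappa> * x)) (real k))"
      by (rule weak_conv_imp_integral_bdd_continuous_conv[OF M, of _ "real k"])
         (auto intro!: continuous_min continuous_intros)
    have "integral\<^sup>L (\<mu> n) (\<lambda>x. min (exp (\<kappa> * x)) (real k)) \<le> B" for n
    proof -
      interpret Mn: real_distribution "\<mu> n" by (rule M)
      have i: "integrable (\<mu> n) (\<lambda>x. min (exp (\<kappa> * x)) (real k))"
        by (rule Mn.integrable_const_bound[of _ "real k"]) (auto simp: min_def)
      have "ennreal (integral\<^sup>L (\<mu> n) (\<lambda>x. min (exp (\<kappa> * x)) (real k))) = (\<integral>\<^sup>+x. ennreal (min (exp (\<kappa> * x)) (real k)) \<partial>\<mu> n)"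
        by (rule nn_integral_eq_integral[OF i, symmetric]) auto
      also have "\<dots> \<le> (\<integral>\<^sup>+x. ennreal (exp (\<kappa> * x)) \<partial>\<mu> n)"
        by (intro nn_integral_mono ennreal_leI) auto
      finally have "ennreal (integral\<^sup>L (\<mu> n) (\<lambda>x. min (exp (\<kappa> * x)) (real k))) \<le> ennreal B"
        using bd[of n] by (rule order_trans)
      then show ?thesis using B by (simp add: ennreal_le_iff)
    qed
    then have "integral\<^sup>L L (\<lambda>x. min (exp (\<kappa> * x)) (real k)) \<le> B"
      by (intro LIMSEQ_le_const2[OF conv]) auto
    moreover have "(\<integral>\<^sup>+x. ennreal (min (exp (\<kappa> * x)) (real k)) \<partial>L) = ennreal (integral\<^sup>L L (\<lambda>x. min (exp (\<kappa> * x)) (real k)))"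
      by (rule nn_integral_eq_integral)
         (auto intro!: L.integrable_const_bound[of _ "real k"] simp: min_def)
    ultimately show ?thesis by (simp add: ennreal_leI)
  qed
  have lim: "(\<lambda>k. ennreal (min (exp (\<kappa> * x)) (real k))) \<longlonglongrightarrow> ennreal (exp (\<kappa> * x))" for x
  proof (rule tendsto_eventually)
    show "\<forall>\<^sub>F k in sequentially. ennreal (min (exp (\<kappa> * x)) (real k)) = ennreal (exp (\<kappa> * x))"
      using eventually_ge_at_top[of "nat \<lceil>exp (\<kappa> * x)\<rceil>"]
      by eventually_elim (simp add: min_absorb1 nat_le_iff ceiling_le_iff of_nat_ceiling)
  qed
  have "(\<integral>\<^sup>+x. ennreal (exp (\<kappa> * x)) \<partial>L) = (\<integral>\<^sup>+x. liminf (\<lambda>k. ennreal (min (exp (\<kappa> * x)) (real k))) \<partial>L)"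
    by (intro nn_integral_cong lim_imp_Liminf[symmetric] lim) simp
  also have "\<dots> \<le> liminf (\<lambda>k. \<integral>\<^sup>+x. ennreal (min (exp (\<kappa> * x)) (real k)) \<partial>L)"
    by (rule nn_integral_liminf) simp
  also have "\<dots> \<le> ennreal B"
    using le by (intro Liminf_le) (auto intro: always_eventually)
  finally show ?thesis .
qed

section \<open>Levy measures and laws of the jumps in a set away from zero\<close>

locale levy_data =
  fixes v b :: real and N :: "real measure"
  assumes v: "v \<ge> 0" and levy_N: "levy_measure N"
begin

lemma sets_N[measurable_cong, simp]: "sets N = sets borel"
  using levy_N by (simp add: levy_measure_def)

lemma space_N[simp]: "space N = UNIV"
  using sets_eq_imp_space_eq[OF sets_N] by simp

lemma integrable_min: "integrable N (\<lambda>x. min 1 (x\<^sup>2))"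
  using levy_N by (intro integrableI_nonneg) (auto simp: levy_measure_def)

text \<open>Markov's inequality for the function \<open>min 1 (x\<^sup>2)\<close>, which is at least
  \<open>min 1 (\<delta>\<^sup>2)\<close> on \<open>A\<close>.\<close>

lemma emeasure_big:
  assumes A: "A \<in> sets borel" "A \<subseteq> {x. \<bar>x\<bar> > \<delta>}" and \<delta>: "\<delta> > 0"
  shows "emeasure N A < \<infinity>"
proof -
  have *: "indicator A x \<le> ennreal (1 / min 1 (\<delta>\<^sup>2)) * ennreal (min 1 (x\<^sup>2))" for x
  proof (cases "x \<in> A")
    case True
    then have "\<delta>\<^sup>2 \<le> x\<^sup>2" using A \<delta> by (auto simp: abs_le_square_iff[symmetric])
    then have "min 1 (\<delta>\<^sup>2) \<le> min 1 (x\<^sup>2)" by auto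
    then have "1 \<le> 1 / min 1 (\<delta>\<^sup>2) * min 1 (x\<^sup>2)" using \<delta> by (simp add: field_simps)
    then have "ennreal 1 \<le> ennreal (1 / min 1 (\<delta>\<^sup>2) * min 1 (x\<^sup>2))" by (rule ennreal_leI)
    then show ?thesis using True \<delta> by (simp add: ennreal_mult'[symmetric])
  qed auto
  have "emeasure N A = (\<integral>\<^sup>+x. indicator A x \<partial>N)"
    using A by simp
  also have "\<dots> \<le> (\<integral>\<^sup>+x. ennreal (1 / min 1 (\<delta>\<^sup>2)) * ennreal (min 1 (x\<^sup>2)) \<partial>N)"
    by (intro nn_integral_mono *)
  also have "\<dots> = ennreal (1 / min 1 (\<delta>\<^sup>2)) * (\<integral>\<^sup>+x. ennreal (min 1 (x\<^sup>2)) \<partial>N)"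
    by (rule nn_integral_cmult) auto
  also have "\<dots> < \<infinity>"
    using levy_N by (auto simp: levy_measure_def ennreal_mult_less_top)
  finally show ?thesis .
qed

lemma integrable_bigI:
  fixes f :: "real \<Rightarrow> 'b::{banach, second_countable_topology}"
  assumes [measurable]: "f \<in> borel_measurable borel" and "\<delta> > 0" "\<And>x. \<bar>x\<bar> \<le> \<delta> \<Longrightarrow> f x = 0" "\<And>x. norm (f x) \<le> B"
  shows "integrable N f"
proof (rule Bochner_Integration.integrable_bound)
  show "integrable N (\<lambda>x. B * indicator {x. \<bar>x\<bar> > \<delta>} x)"
    using emeasure_big[of "{x. \<bar>x\<bar> > \<delta>}" \<delta>] assms by simp
  have "B \<ge> 0" using assms(4)[of 0] by (rule order_trans[OF norm_ge_zero])
  then show "AE x in N. norm (f x) \<le> norm (B * indicator {x. \<delta> < \<bar>x\<bar>} x)"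
    using assms by (auto simp: indicator_def not_less)
qed measurable

text \<open>The law at time \<open>t\<close> of the sum of the jumps that fall into
  \<open>A\<close>. The degenerate cases are separated because the compound Poisson facts require a
  positive intensity, and conditioning on a null set gives no probability law.\<close>

definition jump_law :: "real set \<Rightarrow> real \<Rightarrow> real measure" where
  "jump_law A t = (if t = 0 \<or> measure N A = 0 then return borel 0
     else compound_poisson (t * measure N A) (uniform_measure N A))"

context
  fixes A :: "real set" and \<delta> :: real
  assumes A[measurable]: "A \<in> sets borel" and A_big: "A \<subseteq> {x. \<bar>x\<bar> > \<delta>}" "\<delta> > 0"
begin

lemma emeasure_A: "emeasure N A < \<infinity>"
  using emeasure_big A A_big by blast

lemma integrable_on_A:
  fixes f :: "real \<Rightarrow> 'b::{banach, second_countable_topology}"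
  assumes [measurable]: "f \<in> borel_measurable borel" and "\<And>x. x \<in> A \<Longrightarrow> norm (f x) \<le> B"
  shows "integrable N (\<lambda>x. indicator A x *\<^sub>R f x)"
  by (rule integrable_bigI[OF _ A_big(2), of _ "\<bar>B\<bar>"], measurable) (use A_big assms(2) in \<open>force simp: indicator_def\<close>)+

lemma uniform_measure_density:
  assumes "measure N A > 0"
  shows "uniform_measure N A = density N (\<lambda>x. ennreal (indicator A x / measure N A))"
  unfolding uniform_measure_def
  using assms emeasure_A emeasure_eq_ennreal_measure[of N A]
  by (intro density_cong) (auto simp: indicator_def divide_ennreal[symmetric])

lemma real_distribution_uniform_measure:
  assumes "measure N A > 0"
  shows "real_distribution (uniform_measure N A)"
  using assms emeasure_A
  by (auto simp: real_distribution_def real_distribution_axioms_def measure_def intro!: prob_space_uniform_measure)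

lemma integral_uniform_measure':
  fixes f :: "real \<Rightarrow> 'b::{banach, second_countable_topology}"
  assumes "measure N A > 0" "f \<in> borel_measurable borel"
  shows "integral\<^sup>L (uniform_measure N A) f = (LINT x|N. indicator A x *\<^sub>R f x) /\<^sub>R measure N A"
proof -
  have "integral\<^sup>L (density N (\<lambda>x. ennreal (indicator A x / measure N A))) f
      = (LINT x|N. (indicator A x / measure N A) *\<^sub>R f x)"
    using assms by (intro integral_density) auto
  also have "\<dots> = (LINT x|N. inverse (measure N A) *\<^sub>R (indicator A x *\<^sub>R f x))"
    by (simp add: divide_inverse_commute)
  also have "\<dots> = (LINT x|N. indicator A x *\<^sub>R f x) /\<^sub>R measure N A"
    by (rule integral_scaleR_right)
  finally show ?thesis by (simp only: uniform_measure_density[OF assms(1)])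
qed

lemma real_distribution_jump_law:
  assumes "t \<ge> 0"
  shows "real_distribution (jump_law A t)"
  using assms real_distribution_uniform_measure
  by (auto simp: jump_law_def less_le intro!: real_distribution_return real_distribution_compound_poisson)

lemma char_jump_law:
  assumes "t \<ge> 0"
  shows "char (jump_law A t) u = exp (of_real t * (CLINT x|N. indicator A x *\<^sub>R (iexp (u * x) - 1)))"
proof (cases "t = 0 \<or> measure N A = 0")
  case True
  have "(CLINT x|N. indicator A x *\<^sub>R (iexp (u * x) - 1)) = 0" if "measure N A = 0"
  proof -
    have "AE x in N. x \<notin> A"
      using that emeasure_A by (intro AE_not_in) (auto simp: null_sets_def emeasure_eq_ennreal_measure)
    then have "AE x in N. indicator A x *\<^sub>R (iexp (u * x) - 1) = 0"
      by eventually_elim auto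
    then show ?thesis by (rule integral_eq_zero_AE)
  qed
  then show ?thesis using True by (auto simp: jump_law_def char_def integral_return)
next
  case False
  then have pos: "measure N A > 0" "t > 0" using assms by (auto simp: less_le)
  have i1: "integrable N (\<lambda>x. indicator A x *\<^sub>R iexp (u * x))"
    by (rule integrable_on_A[of _ 1]) auto
  have i2: "integrable N (\<lambda>x. indicator A x *\<^sub>R (1::complex))"
    by (rule integrable_on_A[of _ 1]) auto
  have one: "(CLINT x|N. indicator A x *\<^sub>R 1) = of_real (measure N A)"
    by (simp add: scaleR_conv_of_real)
  have "of_real (measure N A) * (char (uniform_measure N A) u - 1) = (CLINT x|N. indicator A x *\<^sub>R iexp (u * x)) - of_real (measure N A)"
    unfolding char_def using pos by (subst integral_uniform_measure') (auto simp: scaleR_conv_of_real field_simps)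
  also have "\<dots> = (CLINT x|N. indicator A x *\<^sub>R (iexp (u * x) - 1))"
    using i1 i2 one by (simp add: scaleR_diff_right)
  finally show ?thesis
    using False pos real_distribution_uniform_measure[OF pos(1)]
    by (simp add: jump_law_def char_compound_poisson mult.assoc)
qed

lemma nn_integral_jump_law_exp:
  assumes "t \<ge> 0" and A_bd: "\<And>x. x \<in> A \<Longrightarrow> \<bar>x\<bar> \<le> \<epsilon>"
  shows "(\<integral>\<^sup>+x. ennreal (exp (\<kappa> * x)) \<partial>jump_law A t) = ennreal (exp (t * (LINT x|N. indicator A x * (exp (\<kappa> * x) - 1))))"
proof (cases "t = 0 \<or> measure N A = 0")
  case True
  have "(LINT x|N. indicator A x * (exp (\<kappa> * x) - 1)) = 0" if "measure N A = 0"
  proof -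
    have "AE x in N. x \<notin> A"
      using that emeasure_A by (intro AE_not_in) (auto simp: null_sets_def emeasure_eq_ennreal_measure)
    then have "AE x in N. indicator A x * (exp (\<kappa> * x) - 1) = 0"
      by eventually_elim auto
    then show ?thesis by (rule integral_eq_zero_AE)
  qed
  then show ?thesis using True by (auto simp: jump_law_def nn_integral_return)
next
  case False
  then have pos: "measure N A > 0" "t > 0" using assms by (auto simp: less_le)
  interpret U: real_distribution "uniform_measure N A" by (rule real_distribution_uniform_measure[OF pos(1)])
  have bd: "\<kappa> * x \<le> \<bar>\<kappa>\<bar> * \<epsilon>" if "x \<in> A" for x
  proof -
    have "\<kappa> * x \<le> \<bar>\<kappa>\<bar> * \<bar>x\<bar>" by (simp flip: abs_mult)
    also have "\<dots> \<le> \<bar>\<kappa>\<bar> * \<epsilon>" by (intro mult_left_mono A_bd that) auto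
    finally show ?thesis .
  qed
  have i1: "integrable N (\<lambda>x. indicator A x *\<^sub>R exp (\<kappa> * x))"
    by (rule integrable_on_A[of _ "exp (\<bar>\<kappa>\<bar> * \<epsilon>)"]) (use bd in auto)
  have i2: "integrable N (\<lambda>x. indicator A x *\<^sub>R (1::real))"
    by (rule integrable_on_A[of _ 1]) auto
  let ?m = "integral\<^sup>L (uniform_measure N A) (\<lambda>x. exp (\<kappa> * x))"
  have AE: "AE x in uniform_measure N A. x \<in> A"
    by (rule AE_uniform_measureI) auto
  have "integrable (uniform_measure N A) (\<lambda>x. exp (\<kappa> * x))"
    by (rule U.integrable_const_bound[of _ "exp (\<bar>\<kappa>\<bar> * \<epsilon>)"]) (use AE bd in \<open>auto elim!: eventually_mono\<close>)
  then have "(\<integral>\<^sup>+x. ennreal (exp (\<kappa> * x)) \<partial>uniform_measure N A) = ennreal ?m"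
    by (intro nn_integral_eq_integral) auto
  then have "(\<integral>\<^sup>+x. ennreal (exp (\<kappa> * x)) \<partial>jump_law A t) = ennreal (exp (t * measure N A * ?m - t * measure N A))"
    using False pos real_distribution_uniform_measure[OF pos(1)]
    by (simp add: jump_law_def nn_integral_compound_poisson_exp)
  also have "t * measure N A * ?m - t * measure N A = t * (LINT x|N. indicator A x * (exp (\<kappa> * x) - 1))"
  proof -
    have "measure N A * ?m = (LINT x|N. indicator A x *\<^sub>R exp (\<kappa> * x))"
      using pos by (subst integral_uniform_measure') auto
    moreover have "(LINT x|N. indicator A x * (exp (\<kappa> * x) - 1)) = (LINT x|N. indicator A x *\<^sub>R exp (\<kappa> * x)) - measure N A"
      using i1 i2 by (simp add: right_diff_distrib)
    ultimately show ?thesis by (simp only: right_diff_distrib mult.assoc)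
  qed
  finally show ?thesis .
qed

end

lemma sets_jump_law[simp, measurable_cong]: "sets (jump_law A t) = sets borel"
proof -
  have "sets (compound_poisson r P) = sets borel" for r P
    unfolding compound_poisson_def by (rule sets_bind) auto
  then show ?thesis by (simp add: jump_law_def)
qed

end

section \<open>Existence of the small-jump law\<close>

lemma iexp_remainder_1: "cmod (iexp y - 1) \<le> \<bar>y\<bar>"
  using iexp_approx1[of y 0] by simp

lemma iexp_remainder_2: "cmod (iexp y - 1 - \<i> * of_real y) \<le> y\<^sup>2 / 2"
  using iexp_approx1[of y 1] by (simp add: numeral_2_eq_2 algebra_simps)

context levy_data
begin

text \<open>The triplet compensates all jumps up to 1, the law with jumps up to
  \<open>\<epsilon>\<close> only its own; the compensator of the band in between is taken into the
  drift.\<close>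

definition drift :: "real \<Rightarrow> real" where
  "drift \<epsilon> = b - (LINT x|N. indicator {x. \<epsilon> < \<bar>x\<bar> \<and> \<bar>x\<bar> \<le> 1} x * x)"

definition small_exponent :: "real \<Rightarrow> real \<Rightarrow> complex" where
  "small_exponent \<epsilon> u = \<i> * of_real (drift \<epsilon> * u) - of_real (v * u\<^sup>2 / 2) +
     (CLINT x|N. indicator {x. \<bar>x\<bar> \<le> \<epsilon>} x *\<^sub>R (iexp (u * x) - 1 - \<i> * of_real (u * x)))"

lemma integrable_square_small:
  assumes "\<epsilon> \<le> 1"
  shows "integrable N (\<lambda>x. indicator {x. \<bar>x\<bar> \<le> \<epsilon>} x * x\<^sup>2)"
  by (rule Bochner_Integration.integrable_bound[OF integrable_min])
     (use assms in \<open>auto simp: indicator_def min_def abs_square_le_1\<close>)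

lemma integrable_small_exponent:
  assumes "\<epsilon> \<le> 1"
  shows "integrable N (\<lambda>x. indicator {x. \<bar>x\<bar> \<le> \<epsilon>} x *\<^sub>R (iexp (u * x) - 1 - \<i> * of_real (u * x)))"
proof (rule Bochner_Integration.integrable_bound[OF integrable_mult_right[OF integrable_square_small[OF assms]]])
  show "AE x in N. cmod (indicator {x. \<bar>x\<bar> \<le> \<epsilon>} x *\<^sub>R (iexp (u * x) - 1 - \<i> * of_real (u * x)))
       \<le> norm (u\<^sup>2 / 2 * (indicator {x. \<bar>x\<bar> \<le> \<epsilon>} x * x\<^sup>2))"
  proof (rule AE_I2)
    fix x
    show "cmod (indicator {x. \<bar>x\<bar> \<le> \<epsilon>} x *\<^sub>R (iexp (u * x) - 1 - \<i> * of_real (u * x)))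
       \<le> norm (u\<^sup>2 / 2 * (indicator {x. \<bar>x\<bar> \<le> \<epsilon>} x * x\<^sup>2))"
      using iexp_remainder_2[of "u * x"] by (cases "\<bar>x\<bar> \<le> \<epsilon>") (auto simp: power_mult_distrib)
  qed
qed measurable

lemma integrable_band:
  assumes "0 < \<delta>"
  shows "integrable N (\<lambda>x. indicator {x. \<delta> < \<bar>x\<bar> \<and> \<bar>x\<bar> \<le> \<epsilon>} x * x)"
  by (rule integrable_bigI[OF _ assms, of _ "\<bar>\<epsilon>\<bar>"]) (auto simp: indicator_def)

lemma integrable_big_exponent:
  assumes "0 < \<epsilon>" and A: "A \<in> sets borel" "A \<subseteq> {x. \<epsilon> < \<bar>x\<bar>}"
  shows "integrable N (\<lambda>x. indicator A x *\<^sub>R (iexp (u * x) - 1))"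
proof (rule integrable_bigI[OF _ assms(1), of _ 2])
  show "(\<lambda>x. indicat_real A x *\<^sub>R (iexp (u * x) - 1)) \<in> borel_measurable borel"
    using A by measurable
  show "norm (indicat_real A x *\<^sub>R (iexp (u * x) - 1)) \<le> 2" for x
    using norm_triangle_ineq4[of "iexp (u * x)" 1] by (auto simp: indicator_def)
qed (use A in \<open>auto simp: indicator_def\<close>)

text \<open>Once the band compensator sits in the drift, the jumps beyond \<open>\<epsilon>\<close>
  appear without compensation, which is the exponent of a compound Poisson law.\<close>

lemma levy_exponent_split:
  assumes \<epsilon>: "0 < \<epsilon>" "\<epsilon> \<le> 1"
  shows "levy_exponent v b N u = small_exponent \<epsilon> u + (CLINT x|N. indicator {x. \<epsilon> < \<bar>x\<bar>} x *\<^sub>R (iexp (u * x) - 1))"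
proof -
  define f where "f x = indicator {x. \<bar>x\<bar> \<le> \<epsilon>} x *\<^sub>R (iexp (u * x) - 1 - \<i> * of_real (u * x))" for x
  define g where "g x = indicator {x. \<epsilon> < \<bar>x\<bar>} x *\<^sub>R (iexp (u * x) - 1)" for x
  define h where "h x = indicator {x. \<epsilon> < \<bar>x\<bar> \<and> \<bar>x\<bar> \<le> 1} x * x" for x :: real
  have i: "integrable N f" "integrable N g" "integrable N h"
    using integrable_small_exponent[OF \<epsilon>(2)] integrable_big_exponent[OF \<epsilon>(1), of "{x. \<epsilon> < \<bar>x\<bar>}"] integrable_band[OF \<epsilon>(1)]
    unfolding f_def[abs_def] g_def[abs_def] h_def[abs_def] by auto
  have "(CLINT x|N. exp (\<i> * of_real (u * x)) - 1 - \<i> * of_real (u * x * indicator {-1..1} x))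
     = (CLINT x|N. f x + g x - \<i> * of_real u * of_real (h x))"
    by (rule Bochner_Integration.integral_cong)
       (use \<epsilon> in \<open>auto simp: f_def g_def h_def indicator_def abs_le_iff\<close>)
  also have "\<dots> = integral\<^sup>L N f + integral\<^sup>L N g - \<i> * of_real u * of_real (integral\<^sup>L N h)"
    using i by simp
  finally show ?thesis
    unfolding levy_exponent_def small_exponent_def drift_def f_def g_def h_def
    by (simp add: algebra_simps)
qed

text \<open>The law is obtained as a weak limit. Jumps below a level \<open>\<delta> n\<close>
  tending to 0 are discarded, which leaves a Gaussian law convolved with a compound Poisson law. The
  exponential moments of these laws are bounded independently of \<open>n\<close>; orders 1 and -1
  give tightness, and every admissible order passes to the limit. The constant \<open>A\<close> is
  chosen before \<open>t\<close>, so the bound can be used with an order \<kappa> that depends on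
  \<open>t\<close>.\<close>

lemma small_law_exists:
  assumes \<epsilon>: "0 < \<epsilon>" "\<epsilon> \<le> 1"
  obtains A where "A \<ge> 0"
    "\<And>t. t \<ge> 0 \<Longrightarrow> \<exists>\<mu>. real_distribution \<mu> \<and> (\<forall>u. char \<mu> u = exp (of_real t * small_exponent \<epsilon> u)) \<and>
       (\<forall>\<kappa>. \<bar>\<kappa>\<bar> \<ge> 1 \<longrightarrow> (\<integral>\<^sup>+x. ennreal (exp (\<kappa> * x)) \<partial>\<mu>) \<le> ennreal (exp (t * (A * \<kappa>\<^sup>2 * exp (\<bar>\<kappa>\<bar> * \<epsilon>)))))"
proof -
  define \<delta> where "\<delta> n = \<epsilon> / real (n + 2)" for n
  have \<delta>: "\<delta> n > 0" for n using \<epsilon> by (simp add: \<delta>_def)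
  have \<delta>_lim: "\<delta> \<longlonglongrightarrow> 0"
    unfolding \<delta>_def by real_asymp
  define B where "B n = {x::real. \<delta> n < \<bar>x\<bar> \<and> \<bar>x\<bar> \<le> \<epsilon>}" for n
  have [measurable]: "B n \<in> sets borel" for n unfolding B_def by measurable
  have B_sub: "B n \<subseteq> {x. \<bar>x\<bar> > \<delta> n}" for n by (auto simp: B_def)
  have B_small: "\<bar>x\<bar> \<le> \<epsilon>" if "x \<in> B n" for x n using that by (auto simp: B_def)
  \<comment> \<open>The Gaussian mean subtracts the compensator of the jumps retained in
    \<open>B n\<close>, since the jump law itself is not compensated.\<close>
  define m where "m n = drift \<epsilon> - (LINT x|N. indicator (B n) x * x)" for n
  define V where "V = (LINT x|N. indicator {x. \<bar>x\<bar> \<le> \<epsilon>} x * x\<^sup>2)"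
  \<comment> \<open>One summand each for drift, Gaussian part and compensated jumps. The drift is
    linear in \<kappa>; it fits under \<kappa>^2 because |\<kappa>| is at least 1.\<close>
  define A where "A = \<bar>drift \<epsilon>\<bar> + v / 2 + V / 2"
  have V0: "V \<ge> 0" unfolding V_def by (intro integral_nonneg_AE) auto
  then have A0: "A \<ge> 0" using v by (simp add: A_def)
  show ?thesis
  proof (rule that[OF A0])
    fix t :: real assume t: "t \<ge> 0"
    define \<mu> where "\<mu> n = (gaussian (m n * t) (sqrt (v * t)) \<star> jump_law (B n) t)" for n
    have rdj: "real_distribution (jump_law (B n) t)" for n
      by (rule real_distribution_jump_law[OF _ B_sub \<delta> t]) auto
    have rd: "real_distribution (\<mu> n)" for n
      unfolding \<mu>_def by (intro real_distribution_convolution real_distribution_gaussian rdj)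
    have iB: "integrable N (\<lambda>x. indicator (B n) x * x)" for n
      using integrable_band[OF \<delta>, of n \<epsilon>] by (simp add: B_def)
    have char: "char (\<mu> n) u = exp (of_real t * (\<i> * of_real (drift \<epsilon> * u) - of_real (v * u\<^sup>2 / 2)
        + (CLINT x|N. indicator (B n) x *\<^sub>R (iexp (u * x) - 1 - \<i> * of_real (u * x)))))" for n u
    proof -
      have iE: "integrable N (\<lambda>x. indicator (B n) x *\<^sub>R (iexp (u * x) - 1))"
        by (rule integrable_big_exponent[OF \<delta>[of n]]) (use B_sub in auto)
      have "(CLINT x|N. indicator (B n) x *\<^sub>R (iexp (u * x) - 1 - \<i> * of_real (u * x)))
         = (CLINT x|N. indicator (B n) x *\<^sub>R (iexp (u * x) - 1) - \<i> * of_real u * of_real (indicator (B n) x * x))"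
        by (rule Bochner_Integration.integral_cong) (auto simp: indicator_def)
      also have "\<dots> = (CLINT x|N. indicator (B n) x *\<^sub>R (iexp (u * x) - 1)) - \<i> * of_real u * of_real (LINT x|N. indicator (B n) x * x)"
        using iE iB[of n] by (subst Bochner_Integration.integral_diff)
          (simp_all only: integral_mult_right_zero integral_of_real[symmetric] integrable_mult_right integrable_of_real)
      finally have *: "(CLINT x|N. indicator (B n) x *\<^sub>R (iexp (u * x) - 1)) =
          (CLINT x|N. indicator (B n) x *\<^sub>R (iexp (u * x) - 1 - \<i> * of_real (u * x))) + \<i> * of_real u * of_real (LINT x|N. indicator (B n) x * x)"
        by simp
      have sq: "(sqrt (v * t) * u)\<^sup>2 = v * t * u\<^sup>2" using v t by (simp add: power_mult_distrib)
      define E1 where "E1 = (CLINT x|N. indicator (B n) x *\<^sub>R (iexp (u * x) - 1))"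
      define E2 where "E2 = (CLINT x|N. indicator (B n) x *\<^sub>R (iexp (u * x) - 1 - \<i> * of_real (u * x)))"
      have E: "E1 = E2 + \<i> * of_real u * of_real (LINT x|N. indicator (B n) x * x)"
        unfolding E1_def E2_def by (rule *)
      have "char (jump_law (B n) t) u = exp (of_real t * E1)"
        unfolding E1_def by (rule char_jump_law[OF _ B_sub \<delta> t]) simp
      then show ?thesis
        unfolding \<mu>_def char_convolution[OF real_distribution_gaussian rdj] char_gaussian
          E m_def sq E2_def[symmetric]
        by (simp add: exp_add[symmetric] algebra_simps del: exp_of_real)
    qed
    have char_lim: "(\<lambda>n. char (\<mu> n) u) \<longlonglongrightarrow> exp (of_real t * small_exponent \<epsilon> u)" for u
    proof -
      have "(\<lambda>n. CLINT x|N. indicator (B n) x *\<^sub>R (iexp (u * x) - 1 - \<i> * of_real (u * x)))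
         \<longlonglongrightarrow> (CLINT x|N. indicator {x. \<bar>x\<bar> \<le> \<epsilon>} x *\<^sub>R (iexp (u * x) - 1 - \<i> * of_real (u * x)))"
      proof (rule integral_dominated_convergence[where w="\<lambda>x. cmod (indicator {x. \<bar>x\<bar> \<le> \<epsilon>} x *\<^sub>R (iexp (u * x) - 1 - \<i> * of_real (u * x)))"])
        show "integrable N (\<lambda>x. cmod (indicator {x. \<bar>x\<bar> \<le> \<epsilon>} x *\<^sub>R (iexp (u * x) - 1 - \<i> * of_real (u * x))))"
          by (intro integrable_norm integrable_small_exponent \<epsilon>)
        show "AE x in N. (\<lambda>n. indicator (B n) x *\<^sub>R (iexp (u * x) - 1 - \<i> * of_real (u * x)))
            \<longlonglongrightarrow> indicator {x. \<bar>x\<bar> \<le> \<epsilon>} x *\<^sub>R (iexp (u * x) - 1 - \<i> * of_real (u * x))"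
        proof (rule AE_I2)
          fix x
          show "(\<lambda>n. indicator (B n) x *\<^sub>R (iexp (u * x) - 1 - \<i> * of_real (u * x)))
            \<longlonglongrightarrow> indicator {x. \<bar>x\<bar> \<le> \<epsilon>} x *\<^sub>R (iexp (u * x) - 1 - \<i> * of_real (u * x))"
          \<comment> \<open>The bands exhaust the punctured interval, and at 0 the integrand
            vanishes.\<close>
          proof (cases "x = 0")
            case False
            then have "\<forall>\<^sub>F n in sequentially. \<delta> n < \<bar>x\<bar>"
              using \<delta>_lim by (intro order_tendstoD) auto
            then have "\<forall>\<^sub>F n in sequentially. indicator {x. \<bar>x\<bar> \<le> \<epsilon>} x *\<^sub>R (iexp (u * x) - 1 - \<i> * of_real (u * x)) =
               indicator (B n) x *\<^sub>R (iexp (u * x) - 1 - \<i> * of_real (u * x))"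
              by eventually_elim (auto simp: B_def indicator_def)
            then show ?thesis by (intro tendsto_eventually) (auto elim!: eventually_mono)
          qed simp
        qed
        show "AE x in N. cmod (indicator (B n) x *\<^sub>R (iexp (u * x) - 1 - \<i> * of_real (u * x)))
           \<le> cmod (indicator {x. \<bar>x\<bar> \<le> \<epsilon>} x *\<^sub>R (iexp (u * x) - 1 - \<i> * of_real (u * x)))" for n
          by (rule AE_I2) (auto simp: indicator_def B_def)
      qed measurable
      then show ?thesis unfolding char small_exponent_def by (intro tendsto_intros)
    qed
    have mgf: "(\<integral>\<^sup>+x. ennreal (exp (\<kappa> * x)) \<partial>\<mu> n) \<le> ennreal (exp (t * (A * \<kappa>\<^sup>2 * exp (\<bar>\<kappa>\<bar> * \<epsilon>))))"
      if \<kappa>: "\<bar>\<kappa>\<bar> \<ge> 1" for \<kappa> n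
    proof -
      have pt: "\<bar>indicator (B n) x * (exp (\<kappa> * x) - 1 - \<kappa> * x)\<bar> \<le> \<kappa>\<^sup>2 / 2 * exp (\<bar>\<kappa>\<bar> * \<epsilon>) * (indicator {x. \<bar>x\<bar> \<le> \<epsilon>} x * x\<^sup>2)" for x
      proof (cases "x \<in> B n")
        case True
        have "\<bar>exp (\<kappa> * x) - 1 - \<kappa> * x\<bar> \<le> (\<kappa> * x)\<^sup>2 / 2 * exp \<bar>\<kappa> * x\<bar>" by (rule exp_remainder_bound)
        also have "\<dots> \<le> (\<kappa> * x)\<^sup>2 / 2 * exp (\<bar>\<kappa>\<bar> * \<epsilon>)"
          using B_small[OF True] by (intro mult_left_mono) (auto simp: abs_mult intro!: mult_left_mono)
        finally show ?thesis using True B_small[OF True] by (simp add: power_mult_distrib mult_ac)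
      qed (auto simp: indicator_def)
      have iR: "integrable N (\<lambda>x. indicator (B n) x * (exp (\<kappa> * x) - 1 - \<kappa> * x))"
        by (rule Bochner_Integration.integrable_bound[OF integrable_mult_right[OF integrable_square_small[OF \<epsilon>(2)], of "\<kappa>\<^sup>2 / 2 * exp (\<bar>\<kappa>\<bar> * \<epsilon>)"]])
           (use pt in \<open>auto intro!: AE_I2 intro: order_trans[OF pt abs_ge_self]\<close>)
      have "(LINT x|N. indicator (B n) x * (exp (\<kappa> * x) - 1)) =
          (LINT x|N. indicator (B n) x * (exp (\<kappa> * x) - 1 - \<kappa> * x) + \<kappa> * (indicator (B n) x * x))"
        by (rule Bochner_Integration.integral_cong) (auto simp: algebra_simps)
      also have "\<dots> = (LINT x|N. indicator (B n) x * (exp (\<kappa> * x) - 1 - \<kappa> * x)) + \<kappa> * (LINT x|N. indicator (B n) x * x)"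
        using iR iB by simp
      finally have eq: "(LINT x|N. indicator (B n) x * (exp (\<kappa> * x) - 1)) = \<dots>" .
      have R: "(LINT x|N. indicator (B n) x * (exp (\<kappa> * x) - 1 - \<kappa> * x)) \<le> \<kappa>\<^sup>2 / 2 * exp (\<bar>\<kappa>\<bar> * \<epsilon>) * V"
      proof -
        have "(LINT x|N. indicator (B n) x * (exp (\<kappa> * x) - 1 - \<kappa> * x))
            \<le> (LINT x|N. \<kappa>\<^sup>2 / 2 * exp (\<bar>\<kappa>\<bar> * \<epsilon>) * (indicator {x. \<bar>x\<bar> \<le> \<epsilon>} x * x\<^sup>2))"
          by (intro integral_mono iR integrable_mult_right integrable_square_small \<epsilon>) (rule order_trans[OF abs_ge_self pt])
        then show ?thesis by (simp add: V_def)
      qed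
      have k1: "\<bar>\<kappa>\<bar> \<le> \<kappa>\<^sup>2" using \<kappa> self_le_power[of "\<bar>\<kappa>\<bar>" 2] by simp
      have e1: "1 \<le> exp (\<bar>\<kappa>\<bar> * \<epsilon>)" using \<epsilon> by simp
      have d: "\<kappa> * drift \<epsilon> \<le> \<bar>drift \<epsilon>\<bar> * \<kappa>\<^sup>2 * exp (\<bar>\<kappa>\<bar> * \<epsilon>)"
      proof -
        have "\<kappa> * drift \<epsilon> \<le> \<bar>drift \<epsilon>\<bar> * \<bar>\<kappa>\<bar>" by (simp flip: abs_mult add: mult.commute)
        also have "\<dots> \<le> \<bar>drift \<epsilon>\<bar> * \<kappa>\<^sup>2" by (intro mult_left_mono k1) auto
        also have "\<dots> \<le> \<bar>drift \<epsilon>\<bar> * \<kappa>\<^sup>2 * exp (\<bar>\<kappa>\<bar> * \<epsilon>)" using mult_left_mono[OF e1, of "\<bar>drift \<epsilon>\<bar> * \<kappa>\<^sup>2"] by simp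
        finally show ?thesis .
      qed
      have g: "\<kappa>\<^sup>2 * v / 2 \<le> v / 2 * \<kappa>\<^sup>2 * exp (\<bar>\<kappa>\<bar> * \<epsilon>)"
        using mult_left_mono[OF e1, of "v / 2 * \<kappa>\<^sup>2"] v by (simp add: mult.commute)
      have jl: "(\<integral>\<^sup>+x. ennreal (exp (\<kappa> * x)) \<partial>jump_law (B n) t) = ennreal (exp (t * (LINT x|N. indicator (B n) x * (exp (\<kappa> * x) - 1))))"
        by (rule nn_integral_jump_law_exp[OF _ B_sub \<delta> t]) (auto intro: B_small)
      have "(\<integral>\<^sup>+x. ennreal (exp (\<kappa> * x)) \<partial>\<mu> n) =
         (\<integral>\<^sup>+x. \<integral>\<^sup>+y. ennreal (exp (\<kappa> * x)) * ennreal (exp (\<kappa> * y)) \<partial>jump_law (B n) t \<partial>gaussian (m n * t) (sqrt (v * t)))"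
        unfolding \<mu>_def
        by (simp add: nn_integral_convolution_real real_distribution_gaussian rdj distrib_left exp_add ennreal_mult)
      also have "\<dots> = ennreal (exp (\<kappa> * (m n * t) + (\<kappa> * sqrt (v * t))\<^sup>2 / 2)) * ennreal (exp (t * (LINT x|N. indicator (B n) x * (exp (\<kappa> * x) - 1))))"
        using jl
        by (subst nn_integral_cmult) (auto simp: nn_integral_multc nn_integral_gaussian_exp)
      also have "\<dots> = ennreal (exp (t * (\<kappa> * drift \<epsilon> + \<kappa>\<^sup>2 * v / 2 + (LINT x|N. indicator (B n) x * (exp (\<kappa> * x) - 1 - \<kappa> * x)))))"
        unfolding eq m_def using v t
        by (simp add: ennreal_mult[symmetric] exp_add[symmetric] power_mult_distrib algebra_simps)
      also have "\<dots> \<le> ennreal (exp (t * (A * \<kappa>\<^sup>2 * exp (\<bar>\<kappa>\<bar> * \<epsilon>))))"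
      proof (intro ennreal_leI exp_le_cancel_iff[THEN iffD2] mult_left_mono t)
        show "\<kappa> * drift \<epsilon> + \<kappa>\<^sup>2 * v / 2 + (LINT x|N. indicator (B n) x * (exp (\<kappa> * x) - 1 - \<kappa> * x)) \<le> A * \<kappa>\<^sup>2 * exp (\<bar>\<kappa>\<bar> * \<epsilon>)"
          using d g R by (simp add: A_def algebra_simps)
      qed
      finally show ?thesis .
    qed
    have "tight \<mu>"
      unfolding tight_def
    proof (intro conjI allI rd impI)
      fix e :: real assume e: "0 < e"
      \<comment> \<open>\<open>C\<close> bounds the exponential moments of orders 1 and -1. The
        radius \<open>R\<close> makes the resulting Markov bound \<open>2 * C * exp (- R)\<close> at
        most \<open>e / 2\<close>.\<close>
      define C where "C = exp (t * (A * exp \<epsilon>))"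
      define R where "R = \<bar>ln (4 * C / e)\<bar> + 1"
      have C: "C > 0" by (simp add: C_def)
      have R0: "R > 0" by (simp add: R_def)
      have RC: "exp (- R) * (2 * C) < e"
      proof -
        have "exp (- R) \<le> exp (- ln (4 * C / e))" by (simp add: R_def)
        also have "\<dots> = e / (4 * C)" using C e by (simp add: exp_minus)
        finally have "exp (- R) * (2 * C) \<le> e / (4 * C) * (2 * C)" using C by (intro mult_right_mono) auto
        also have "\<dots> < e" using C e by simp
        finally show ?thesis .
      qed
      have "1 - e < measure (\<mu> n) {-R<..R}" for n
      proof -
        interpret Mn: real_distribution "\<mu> n" by (rule rd)
        have "emeasure (\<mu> n) (UNIV - {-R<..R}) = (\<integral>\<^sup>+x. indicator (UNIV - {-R<..R}) x \<partial>\<mu> n)"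
          by simp
        also have "\<dots> \<le> (\<integral>\<^sup>+x. ennreal (exp (- R)) * (ennreal (exp (1 * x)) + ennreal (exp ((-1) * x))) \<partial>\<mu> n)"
        proof (intro nn_integral_mono)
          fix x
          show "indicator (UNIV - {-R<..R}) x \<le> ennreal (exp (- R)) * (ennreal (exp (1 * x)) + ennreal (exp ((-1) * x)))"
          proof (cases "x \<in> {-R<..R}")
            case False
            then have "1 \<le> exp (-R) * exp x \<or> 1 \<le> exp (-R) * exp (-x)"
              by (auto simp flip: exp_add)
            then have "1 \<le> exp (-R) * (exp x + exp (-x))"
              by (auto simp: distrib_left intro: add_increasing add_increasing2)
            then show ?thesis using False
              by (simp flip: ennreal_plus ennreal_mult'' ennreal_1 add: ennreal_leI)
          qed simp
        qed
        also have "\<dots> = ennreal (exp (- R)) * ((\<integral>\<^sup>+x. ennreal (exp (1 * x)) \<partial>\<mu> n) + (\<integral>\<^sup>+x. ennreal (exp ((-1) * x)) \<partial>\<mu> n))"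
          by (simp add: nn_integral_cmult nn_integral_add)
        also have "\<dots> \<le> ennreal (exp (- R)) * (ennreal C + ennreal C)"
          using mgf[of 1 n] mgf[of "-1" n] by (intro mult_left_mono add_mono) (auto simp: C_def)
        also have "\<dots> = ennreal (exp (- R) * (2 * C))"
          using C by (simp flip: ennreal_plus ennreal_mult'')
        finally have "Mn.prob (UNIV - {-R<..R}) \<le> exp (- R) * (2 * C)"
          using C by (simp add: Mn.emeasure_eq_measure)
        moreover have "Mn.prob (UNIV - {-R<..R}) = 1 - Mn.prob {-R<..R}"
          using Mn.prob_compl[of "{-R<..R}"] by simp
        ultimately show ?thesis using RC by simp
      qed
      then show "\<exists>a b. a < b \<and> (\<forall>n. 1 - e < measure (\<mu> n) {a<..b})"
        using R0 by (intro exI[of _ "-R"] exI[of _ R]) auto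
    qed
    then obtain r L where r: "strict_mono (r::nat\<Rightarrow>nat)" and L: "real_distribution L" "weak_conv_m (\<mu> \<circ> id \<circ> r) L"
      using tight_imp_convergent_subsubsequence[of \<mu> id] by (auto simp: strict_mono_id)
    have wc: "weak_conv_m (\<lambda>n. \<mu> (r n)) L" using L(2) by (simp add: comp_def)
    have "char L u = exp (of_real t * small_exponent \<epsilon> u)" for u
      using levy_continuity1[OF rd L(1) wc, of u] LIMSEQ_subseq_LIMSEQ[OF char_lim[of u] r]
      by (intro LIMSEQ_unique) (auto simp: comp_def)
    moreover have "(\<integral>\<^sup>+x. ennreal (exp (\<kappa> * x)) \<partial>L) \<le> ennreal (exp (t * (A * \<kappa>\<^sup>2 * exp (\<bar>\<kappa>\<bar> * \<epsilon>))))" if "\<bar>\<kappa>\<bar> \<ge> 1" for \<kappa>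
      by (rule weak_conv_exp_moment_le[OF rd L(1) wc]) (use mgf[OF that] in auto)
    ultimately show "\<exists>\<mu>. real_distribution \<mu> \<and> (\<forall>u. char \<mu> u = exp (of_real t * small_exponent \<epsilon> u)) \<and>
       (\<forall>\<kappa>. \<bar>\<kappa>\<bar> \<ge> 1 \<longrightarrow> (\<integral>\<^sup>+x. ennreal (exp (\<kappa> * x)) \<partial>\<mu>) \<le> ennreal (exp (t * (A * \<kappa>\<^sup>2 * exp (\<bar>\<kappa>\<bar> * \<epsilon>)))))"
      using L(1) by blast
  qed
qed

end

section \<open>Splitting off the large jumps\<close>

lemma exp_quad_lower: "1 + z + z\<^sup>2 / 2 + z ^ 3 / 6 \<le> exp (z::real)"
proof -
  obtain w where "exp z = (\<Sum>m<4. z ^ m / fact m) + exp w / fact 4 * z ^ 4"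
    using Maclaurin_exp_le[of z 4] by blast
  moreover have "(\<Sum>m<4. z ^ m / fact m) = 1 + z + z\<^sup>2 / 2 + z ^ 3 / 6"
    by (simp add: eval_nat_numeral)
  moreover have "0 \<le> exp w / fact 4 * z ^ 4" by simp
  ultimately show ?thesis by linarith
qed

text \<open>Adding the cubic lower bounds at \<open>z\<close> and \<open>- z\<close> cancels the odd
  terms. The subtracted 2 matters: integrated against a law whose exponential moments are 1 + O(t),
  the right-hand side is O(t).\<close>

lemma square_le_exp: "(z::real)\<^sup>2 \<le> exp z + exp (- z) - 2"
  using exp_quad_lower[of z] exp_quad_lower[of "-z"] by simp

lemma one_plus_square_le_exp: "1 + (z::real)\<^sup>2 \<le> 2 * exp \<bar>z\<bar>"
proof -
  have "0 \<le> \<bar>z\<bar> ^ 3" by simp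
  then have "1 + \<bar>z\<bar> + \<bar>z\<bar>\<^sup>2 / 2 \<le> exp \<bar>z\<bar>"
    using exp_quad_lower[of "\<bar>z\<bar>"] by linarith
  moreover have "\<bar>z\<bar>\<^sup>2 = z\<^sup>2" by simp
  ultimately show ?thesis using abs_ge_zero[of z] by linarith
qed

lemma exp_minus_one_le: "0 \<le> y \<Longrightarrow> y \<le> B \<Longrightarrow> exp y - 1 \<le> y * exp (B::real)"
proof -
  assume y: "0 \<le> y" "y \<le> B"
  have "exp y - 1 = exp y * (1 - exp (- y))" by (simp add: algebra_simps exp_minus)
  also have "\<dots> \<le> exp y * y" using exp_ge_add_one_self[of "-y"] by (intro mult_left_mono) auto
  also have "\<dots> \<le> exp B * y" using y by (intro mult_right_mono) auto
  finally show ?thesis by (simp add: mult.commute)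
qed

text \<open>The elementary bounds \<open>z \<le> exp z - 1\<close>,
  \<open>- z \<le> exp (- z) - 1\<close> and \<open>square_le_exp\<close> all have right-hand sides
  whose expectation is of order \<open>d\<close>. With \<open>d\<close> proportional to t this gives
  first and second moments O(t).\<close>

lemma moments_of_exp_moments:
  assumes Z: "real_distribution Z" and d: "d \<ge> 0"
    and e1: "(\<integral>\<^sup>+z. ennreal (exp z) \<partial>Z) \<le> ennreal (1 + d)"
    and e2: "(\<integral>\<^sup>+z. ennreal (exp (- z)) \<partial>Z) \<le> ennreal (1 + d)"
  shows "integrable Z (\<lambda>z. z)" "\<bar>LINT z|Z. z\<bar> \<le> d" "integrable Z (\<lambda>z. z\<^sup>2)" "(LINT z|Z. z\<^sup>2) \<le> 2 * d"
    "(LINT z|Z. exp \<bar>z\<bar>) \<le> 2 + 2 * d" "integrable Z (\<lambda>z. exp \<bar>z\<bar>)"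
proof -
  interpret Z: real_distribution Z by fact
  have i1: "integrable Z exp" and i2: "integrable Z (\<lambda>z. exp (- z))"
    by (rule integrableI_nonneg; use e1 e2 in \<open>auto intro: le_less_trans\<close>)+
  have l1: "(LINT z|Z. exp z) \<le> 1 + d"
    using e1 d nn_integral_eq_integral[OF i1] by (simp add: ennreal_le_iff del: ennreal_plus)
  have l2: "(LINT z|Z. exp (- z)) \<le> 1 + d"
    using e2 d nn_integral_eq_integral[OF i2] by (simp add: ennreal_le_iff del: ennreal_plus)
  show i3: "integrable Z (\<lambda>z. z\<^sup>2)"
    by (rule Bochner_Integration.integrable_bound[of _ "\<lambda>z. exp z + exp (- z)"])
       (use i1 i2 square_le_exp in \<open>auto intro!: AE_I2 simp: algebra_simps intro: order_trans[OF square_le_exp]\<close>)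
  show i4: "integrable Z (\<lambda>z. z)"
    by (rule Z.square_integrable_imp_integrable) (use i3 in auto)
  have "(LINT z|Z. z\<^sup>2) \<le> (LINT z|Z. exp z + exp (- z) - 2)"
    by (intro integral_mono i3) (use i1 i2 square_le_exp in auto)
  also have "\<dots> = (LINT z|Z. exp z) + (LINT z|Z. exp (- z)) - 2"
    using i1 i2 Z.prob_space by simp
  finally show "(LINT z|Z. z\<^sup>2) \<le> 2 * d" using l1 l2 by simp
  have "(LINT z|Z. z) \<le> (LINT z|Z. exp z - 1)"
    by (intro integral_mono i4) (use i1 exp_ge_add_one_self in \<open>auto simp: algebra_simps\<close>)
  moreover have "(LINT z|Z. - z) \<le> (LINT z|Z. exp (- z) - 1)"
    by (intro integral_mono) (use i2 i4 exp_ge_add_one_self[of "- _"] in \<open>auto simp: algebra_simps\<close>)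
  ultimately show "\<bar>LINT z|Z. z\<bar> \<le> d"
    using l1 l2 i1 i2 Z.prob_space by (auto simp: abs_le_iff)
  have le: "exp \<bar>z\<bar> \<le> exp z + exp (- z)" for z :: real by (auto simp: abs_if)
  show i5: "integrable Z (\<lambda>z. exp \<bar>z\<bar>)"
    by (rule Bochner_Integration.integrable_bound[of _ "\<lambda>z. exp z + exp (- z)"])
       (use i1 i2 le in auto)
  have "(LINT z|Z. exp \<bar>z\<bar>) \<le> (LINT z|Z. exp z + exp (- z))"
    by (intro integral_mono i5) (use i1 i2 le in auto)
  then show "(LINT z|Z. exp \<bar>z\<bar>) \<le> 2 + 2 * d" using l1 l2 i1 i2 by simp
qed

text \<open>A law whose jumps are at most \<open>\<epsilon>\<close> puts mass \<open>O(t\<^sup>2)\<close> beyond \<open>4 \<epsilon>\<close>: take the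
  exponential moment of order \<open>\<kappa> = ln (1/t) / (2 \<epsilon>)\<close>, for which \<open>exp (- 4 \<epsilon> \<kappa>) = t\<^sup>2\<close> and
  \<open>t \<kappa>\<^sup>2 exp (\<kappa> \<epsilon>)\<close> stays bounded.\<close>

lemma small_jumps_tail:
  assumes Z: "real_distribution Z" and \<epsilon>: "0 < \<epsilon>" "\<epsilon> \<le> 1" and a: "4 * \<epsilon> \<le> a" and A: "A \<ge> 0"
    and t: "0 < t" "t \<le> exp (- 4)"
    and mgf: "\<And>\<kappa>. \<bar>\<kappa>\<bar> \<ge> 1 \<Longrightarrow> (\<integral>\<^sup>+x. ennreal (exp (\<kappa> * x)) \<partial>Z) \<le> ennreal (exp (t * (A * \<kappa>\<^sup>2 * exp (\<bar>\<kappa>\<bar> * \<epsilon>))))"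
  shows "(\<integral>\<^sup>+x. ennreal (exp \<bar>x\<bar>) * indicator {x. \<bar>x\<bar> > a} x \<partial>Z) \<le> ennreal (2 * exp a * exp (4 * A / \<epsilon>\<^sup>2) * t\<^sup>2)"
proof -
  interpret Z: real_distribution Z by fact
  define \<kappa> where "\<kappa> = ln (1 / t) / (2 * \<epsilon>)"
  have l4: "ln (1 / t) \<ge> 4"
  proof -
    have "ln t \<le> ln (exp (- 4))" using t by (subst ln_le_cancel_iff) auto
    then show ?thesis using t by (simp add: ln_div)
  qed
  \<comment> \<open>The threshold \<open>exp (- 4)\<close> on \<open>t\<close> serves here: the
    moment bound applies at \<kappa> and -\<kappa>, and beyond \<open>a\<close> the factor
    \<open>exp \<bar>x\<bar>\<close> grows more slowly than
    \<open>exp (\<kappa> * \<bar>x\<bar>)\<close>.\<close>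
  have \<kappa>1: "\<kappa> \<ge> 2"
  proof -
    have "2 * (2 * \<epsilon>) \<le> ln (1 / t)" using l4 \<epsilon> by linarith
    then show ?thesis using \<epsilon> by (simp add: \<kappa>_def field_simps)
  qed
  have e1: "exp (\<kappa> * \<epsilon>) = 1 / sqrt t"
  proof -
    have "\<kappa> * \<epsilon> = ln (1 / sqrt t)" using \<epsilon> t by (simp add: \<kappa>_def ln_div ln_sqrt)
    then show ?thesis using t by simp
  qed
  have e2: "exp (- (\<kappa> * a)) \<le> t\<^sup>2"
  proof -
    have "\<kappa> * a \<ge> \<kappa> * (4 * \<epsilon>)" using a \<kappa>1 by (intro mult_left_mono) auto
    also have "\<kappa> * (4 * \<epsilon>) = - ln (t\<^sup>2)" using \<epsilon> t by (simp add: \<kappa>_def ln_div ln_realpow)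
    finally have "exp (- (\<kappa> * a)) \<le> exp (ln (t\<^sup>2))" by simp
    then show ?thesis using t by simp
  qed
  have e3: "t * (A * \<kappa>\<^sup>2 * exp (\<bar>\<kappa>\<bar> * \<epsilon>)) \<le> 4 * A / \<epsilon>\<^sup>2"
  proof -
    \<comment> \<open>With s the fourth root of t, ln (1/t) = 4 ln (1/s) is at most 4/s. Hence
      \<kappa>^2 is O(s^-2), the exponential equals s^-2, and the factor t = s^4 cancels
      both.\<close>
    define s where "s = sqrt (sqrt t)"
    have s0: "s > 0" "s * s = sqrt t" using t by (auto simp: s_def)
    have "s ^ 4 = (s * s) * (s * s)" by (simp add: power4_eq_xxxx)
    then have s: "s > 0" "t = s ^ 4" "sqrt t = s\<^sup>2" using s0 t by (auto simp: power2_eq_square)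
    have "ln (1 / t) = 4 * ln (1 / s)" using s by (simp add: ln_div ln_realpow)
    also have "\<dots> \<le> 4 * (1 / s)"
      using ln_bound[of "1 / s"] s by simp
    finally have "(ln (1 / t))\<^sup>2 \<le> (4 * (1 / s))\<^sup>2" using l4 by (intro power_mono) auto
    then have L: "(ln (1 / t))\<^sup>2 \<le> 16 / s\<^sup>2" by (simp add: power_divide power2_eq_square)
    have k: "exp (\<bar>\<kappa>\<bar> * \<epsilon>) = 1 / s\<^sup>2" "\<kappa>\<^sup>2 = (ln (1 / t))\<^sup>2 / (4 * \<epsilon>\<^sup>2)"
    proof -
      have "\<bar>\<kappa>\<bar> = \<kappa>" using \<kappa>1 by simp
      then show "exp (\<bar>\<kappa>\<bar> * \<epsilon>) = 1 / s\<^sup>2" using e1 s(3) by simp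
    qed (simp add: \<kappa>_def power_divide power_mult_distrib)
    have "t * (A * \<kappa>\<^sup>2 * exp (\<bar>\<kappa>\<bar> * \<epsilon>)) = s ^ 4 * (A * ((ln (1 / t))\<^sup>2 / (4 * \<epsilon>\<^sup>2)) * (1 / s\<^sup>2))"
      unfolding k using s(2) by simp
    also have "\<dots> = A * s\<^sup>2 / (4 * \<epsilon>\<^sup>2) * (ln (1 / t))\<^sup>2"
      using s(1) \<epsilon> by (simp add: field_simps power4_eq_xxxx power2_eq_square)
    also have "\<dots> \<le> A * s\<^sup>2 / (4 * \<epsilon>\<^sup>2) * (16 / s\<^sup>2)" using A by (intro mult_left_mono L) auto
    also have "\<dots> = 4 * A / \<epsilon>\<^sup>2" using s \<epsilon> by (simp add: field_simps)
    finally show ?thesis .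
  qed
  have pt: "ennreal (exp \<bar>x\<bar>) * indicator {x. \<bar>x\<bar> > a} x
      \<le> ennreal (exp a * t\<^sup>2) * (ennreal (exp (\<kappa> * x)) + ennreal (exp ((- \<kappa>) * x)))" for x
  proof (cases "\<bar>x\<bar> > a")
    case True
    have "\<bar>x\<bar> \<le> a - \<kappa> * a + \<kappa> * \<bar>x\<bar>"
    proof -
      have "0 \<le> (\<kappa> - 1) * (\<bar>x\<bar> - a)" using True \<kappa>1 by simp
      then show ?thesis by (simp add: algebra_simps)
    qed
    then have "exp \<bar>x\<bar> \<le> exp a * exp (- (\<kappa> * a)) * exp (\<kappa> * \<bar>x\<bar>)" by (simp flip: exp_add)
    also have "\<dots> \<le> exp a * t\<^sup>2 * exp (\<kappa> * \<bar>x\<bar>)" by (intro mult_right_mono mult_left_mono e2) auto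
    also have "\<dots> \<le> exp a * t\<^sup>2 * (exp (\<kappa> * x) + exp ((- \<kappa>) * x))"
      by (intro mult_left_mono) (auto simp: abs_if)
    finally show ?thesis using True
      by (simp flip: ennreal_plus ennreal_mult'' add: ennreal_leI)
  qed auto
  have "(\<integral>\<^sup>+x. ennreal (exp \<bar>x\<bar>) * indicator {x. \<bar>x\<bar> > a} x \<partial>Z)
     \<le> (\<integral>\<^sup>+x. ennreal (exp a * t\<^sup>2) * (ennreal (exp (\<kappa> * x)) + ennreal (exp ((- \<kappa>) * x))) \<partial>Z)"
    by (intro nn_integral_mono pt)
  also have "\<dots> = ennreal (exp a * t\<^sup>2) * ((\<integral>\<^sup>+x. ennreal (exp (\<kappa> * x)) \<partial>Z) + (\<integral>\<^sup>+x. ennreal (exp ((- \<kappa>) * x)) \<partial>Z))"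
    by (simp add: nn_integral_cmult nn_integral_add)
  also have "\<dots> \<le> ennreal (exp a * t\<^sup>2) * (ennreal (exp (4 * A / \<epsilon>\<^sup>2)) + ennreal (exp (4 * A / \<epsilon>\<^sup>2)))"
    using mgf[of \<kappa>] mgf[of "- \<kappa>"] \<kappa>1 e3
    by (intro mult_left_mono add_mono) (auto elim!: order_trans intro!: ennreal_leI)
  also have "\<dots> = ennreal (2 * exp a * exp (4 * A / \<epsilon>\<^sup>2) * t\<^sup>2)"
    by (simp flip: ennreal_plus ennreal_mult'' add: mult_ac)
  finally show ?thesis .
qed

section \<open>Expansion in the number of large jumps\<close>

lemma suminf_ennreal_split2:
  fixes f :: "nat \<Rightarrow> ennreal"
  shows "(\<Sum>n. f n) = f 0 + f 1 + (\<Sum>n. f (n + 2))"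
  using suminf_offset[of f 2] by (simp add: numeral_2_eq_2 lessThan_Suc add.commute)

text \<open>The positive mass beyond \<open>\<epsilon>\<close> makes the conditional law of a single
  large jump well defined.\<close>

locale levy_split = levy_data +
  fixes \<epsilon> :: real
  assumes \<epsilon>: "0 < \<epsilon>" "\<epsilon> \<le> 1" and mass: "measure N {x. \<bar>x\<bar> > \<epsilon>} > 0"
begin

abbreviation (input) "big \<equiv> {x::real. \<bar>x\<bar> > \<epsilon>}"

definition "rate = measure N big"
definition "jump_size = uniform_measure N big"

lemma rate_pos: "rate > 0" using mass by (simp add: rate_def)

lemma emeasure_big_eq: "emeasure N big = ennreal rate"
  unfolding rate_def
  using emeasure_big[of "{x. \<bar>x\<bar> > \<epsilon>}" \<epsilon>] \<epsilon> by (intro emeasure_eq_ennreal_measure) auto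

lemma real_distribution_jump_size: "real_distribution jump_size"
  unfolding jump_size_def by (rule real_distribution_uniform_measure[of _ \<epsilon>]) (use \<epsilon> mass in auto)

sublocale jump_size: real_distribution jump_size by (rule real_distribution_jump_size)

lemma nn_integral_jump_size:
  assumes [measurable]: "f \<in> borel_measurable borel"
  shows "ennreal rate * (\<integral>\<^sup>+x. f x \<partial>jump_size) = (\<integral>\<^sup>+x. f x * indicator big x \<partial>N)"
proof -
  have "(\<integral>\<^sup>+x. f x \<partial>jump_size) = (\<integral>\<^sup>+x. f x * indicator big x \<partial>N) / ennreal rate"
    unfolding jump_size_def emeasure_big_eq[symmetric] by (rule nn_integral_uniform_measure) auto
  then show ?thesis
    using rate_pos mult_divide_eq_ennreal[of "ennreal rate" "\<integral>\<^sup>+x. f x * indicator big x \<partial>N"]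
    by (simp add: ennreal_times_divide mult.commute[of "ennreal rate"])
qed

text \<open>The exponents add up by \<open>levy_exponent_split\<close>, so both laws have the same
  characteristic function. Only the law at one fixed time is decomposed.\<close>

lemma law_split:
  assumes t: "t > 0" and \<mu>: "real_distribution \<mu>" "\<And>u. char \<mu> u = exp (of_real t * levy_exponent v b N u)"
    and Z: "real_distribution Z" "\<And>u. char Z u = exp (of_real t * small_exponent \<epsilon> u)"
  shows "\<mu> = (Z \<star> compound_poisson (t * rate) jump_size)"
proof (rule Levy_uniqueness[OF \<mu>(1)])
  have j: "compound_poisson (t * rate) jump_size = jump_law big t"
    using t mass by (simp add: jump_law_def rate_def jump_size_def)
  have rj: "real_distribution (jump_law big t)"
    by (rule real_distribution_jump_law[of _ \<epsilon>]) (use \<epsilon> t in auto)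
  show "real_distribution (Z \<star> compound_poisson (t * rate) jump_size)"
    unfolding j by (rule real_distribution_convolution[OF Z(1) rj])
  have cj: "char (jump_law big t) u = exp (of_real t * (CLINT x|N. indicator big x *\<^sub>R (iexp (u * x) - 1)))" for u
    by (rule char_jump_law[of _ \<epsilon>]) (use \<epsilon> t in auto)
  show "char \<mu> = char (Z \<star> compound_poisson (t * rate) jump_size)"
    unfolding j by (rule ext) (simp only: char_convolution[OF Z(1) rj] cj Z(2) \<mu>(2) levy_exponent_split[OF \<epsilon>] distrib_left exp_add)
qed

lemma nn_integral_law_split:
  assumes t: "t > 0" and \<mu>: "real_distribution \<mu>" "\<And>u. char \<mu> u = exp (of_real t * levy_exponent v b N u)"
    and Z: "real_distribution Z" "\<And>u. char Z u = exp (of_real t * small_exponent \<epsilon> u)"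
    and [measurable]: "g \<in> borel_measurable borel"
  shows "(\<integral>\<^sup>+x. g x \<partial>\<mu>) =
    (\<Sum>n. ennreal ((t * rate) ^ n / fact n * exp (- (t * rate))) * (\<integral>\<^sup>+z. \<integral>\<^sup>+x. g (z + x) \<partial>conv_pow jump_size n \<partial>Z))"
proof -
  interpret Z: real_distribution Z by (rule Z)
  have r: "t * rate > 0" using t rate_pos by simp
  have m: "(\<lambda>z. \<integral>\<^sup>+x. g (z + x) \<partial>conv_pow jump_size n) \<in> borel_measurable Z" for n
  proof -
    interpret C: real_distribution "conv_pow jump_size n" by (rule real_distribution_conv_pow[OF real_distribution_jump_size])
    show ?thesis by measurable
  qed
  have "(\<integral>\<^sup>+x. g x \<partial>\<mu>) = (\<integral>\<^sup>+z. \<integral>\<^sup>+x. g (z + x) \<partial>compound_poisson (t * rate) jump_size \<partial>Z)"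
    unfolding law_split[OF t \<mu> Z]
    by (rule nn_integral_convolution_real[OF Z(1) real_distribution_compound_poisson[OF r real_distribution_jump_size]]) measurable
  also have "\<dots> = (\<integral>\<^sup>+z. (\<Sum>n. ennreal ((t * rate) ^ n / fact n * exp (- (t * rate))) * (\<integral>\<^sup>+x. g (z + x) \<partial>conv_pow jump_size n)) \<partial>Z)"
    by (intro nn_integral_cong nn_integral_compound_poisson[OF r real_distribution_jump_size]) measurable
  also have "\<dots> = (\<Sum>n. \<integral>\<^sup>+z. ennreal ((t * rate) ^ n / fact n * exp (- (t * rate))) * (\<integral>\<^sup>+x. g (z + x) \<partial>conv_pow jump_size n) \<partial>Z)"
    using m by (intro nn_integral_suminf) auto
  also have "\<dots> = (\<Sum>n. ennreal ((t * rate) ^ n / fact n * exp (- (t * rate))) * (\<integral>\<^sup>+z. \<integral>\<^sup>+x. g (z + x) \<partial>conv_pow jump_size n \<partial>Z))"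
    using m by (intro suminf_cong nn_integral_cmult) auto
  finally show ?thesis .
qed

lemma nn_integral_conv_pow_1:
  assumes [measurable]: "f \<in> borel_measurable borel"
  shows "(\<integral>\<^sup>+x. f x \<partial>conv_pow jump_size (Suc 0)) = (\<integral>\<^sup>+x. f x \<partial>jump_size)"
  by (simp add: nn_integral_convolution_real real_distribution_jump_size real_distribution_return nn_integral_return)

end

context levy_split
begin

text \<open>The function G of the overview, not normalised by \<open>rate\<close>. It is
  extended-valued because its being infinite is one of the two cases of the final argument.\<close>

definition one_jump :: "(real \<Rightarrow> real) \<Rightarrow> real \<Rightarrow> ennreal" where
  "one_jump g z = (\<integral>\<^sup>+x. ennreal (g (z + x)) * indicator big x \<partial>N)"

lemma one_jump_eq:
  assumes [measurable]: "g \<in> borel_measurable borel"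
  shows "one_jump g z = ennreal rate * (\<integral>\<^sup>+x. ennreal (g (z + x)) \<partial>jump_size)"
  unfolding one_jump_def by (rule nn_integral_jump_size[symmetric]) measurable

lemma borel_measurable_one_jump[measurable]:
  assumes [measurable]: "g \<in> borel_measurable borel"
  shows "one_jump g \<in> borel_measurable borel"
proof -
  have "one_jump g = (\<lambda>z. ennreal rate * (\<integral>\<^sup>+x. ennreal (g (z + x)) \<partial>jump_size))"
    by (rule ext) (rule one_jump_eq[OF assms])
  then show ?thesis by simp
qed

text \<open>The lower bound keeps only the one-jump term of a series of nonnegative terms and asks
  no integrability of \<open>W\<close>. The upper bound has to sum all terms: domination of
  \<open>g\<close> by a submultiplicative weight makes the terms with two or more jumps an
  exponential series with a factor t^2 in front, provided \<open>W\<close> is integrable over the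
  large jumps. The exponential bound on \<open>W\<close> makes its expectation under the small-jump
  law finite.\<close>

lemma expansion:
  assumes \<mu>: "\<And>t. t > 0 \<Longrightarrow> real_distribution (\<mu> t)"
      "\<And>t u. t > 0 \<Longrightarrow> char (\<mu> t) u = exp (of_real t * levy_exponent v b N u)"
    and g[measurable]: "g \<in> borel_measurable borel" and g0: "\<And>x. \<bar>x\<bar> \<le> a \<Longrightarrow> g x = 0" and a: "4 * \<epsilon> \<le> a"
    and W[measurable]: "W \<in> borel_measurable borel" and W0: "\<And>x. W x \<ge> 0" and Wexp: "\<And>x. W x \<le> 2 * exp \<bar>x\<bar>"
    and Wsub: "\<And>x y. W (x + y) \<le> 2 * W x * W y"
    and gW: "\<And>x. g x \<le> c * W x" and c: "c \<ge> 0"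
  obtains C t0 Z where "C \<ge> 0" "t0 > 0"
    "\<And>t. 0 < t \<Longrightarrow> t \<le> t0 \<Longrightarrow> real_distribution (Z t)"
    "\<And>t. 0 < t \<Longrightarrow> t \<le> t0 \<Longrightarrow> integrable (Z t) (\<lambda>z. z) \<and> \<bar>LINT z|Z t. z\<bar> \<le> C * t"
    "\<And>t. 0 < t \<Longrightarrow> t \<le> t0 \<Longrightarrow> integrable (Z t) (\<lambda>z. z\<^sup>2) \<and> (LINT z|Z t. z\<^sup>2) \<le> C * t"
    "\<And>t. 0 < t \<Longrightarrow> t \<le> t0 \<Longrightarrow> ennreal (exp (- (t * rate))) * (\<integral>\<^sup>+z. one_jump g z \<partial>Z t) \<le> ennreal (1 / t) * (\<integral>\<^sup>+x. ennreal (g x) \<partial>\<mu> t)"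
    "\<And>t. 0 < t \<Longrightarrow> t \<le> t0 \<Longrightarrow> (\<integral>\<^sup>+x. ennreal (W x) * indicator big x \<partial>N) < \<infinity> \<Longrightarrow>
       ennreal (1 / t) * (\<integral>\<^sup>+x. ennreal (g x) \<partial>\<mu> t) \<le> (\<integral>\<^sup>+z. one_jump g z \<partial>Z t) + ennreal (C * t)"
proof -
  obtain A where A: "A \<ge> 0" and ex: "\<And>t. t \<ge> 0 \<Longrightarrow> \<exists>\<mu>. real_distribution \<mu> \<and> (\<forall>u. char \<mu> u = exp (of_real t * small_exponent \<epsilon> u)) \<and>
       (\<forall>\<kappa>. \<bar>\<kappa>\<bar> \<ge> 1 \<longrightarrow> (\<integral>\<^sup>+x. ennreal (exp (\<kappa> * x)) \<partial>\<mu>) \<le> ennreal (exp (t * (A * \<kappa>\<^sup>2 * exp (\<bar>\<kappa>\<bar> * \<epsilon>)))))"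
    using small_law_exists[OF \<epsilon>] by blast
  then obtain Z where Z: "\<And>t. t > 0 \<Longrightarrow> real_distribution (Z t)"
      "\<And>t u. t > 0 \<Longrightarrow> char (Z t) u = exp (of_real t * small_exponent \<epsilon> u)"
    and mgf: "\<And>t \<kappa>. t > 0 \<Longrightarrow> \<bar>\<kappa>\<bar> \<ge> 1 \<Longrightarrow> (\<integral>\<^sup>+x. ennreal (exp (\<kappa> * x)) \<partial>Z t) \<le> ennreal (exp (t * (A * \<kappa>\<^sup>2 * exp (\<bar>\<kappa>\<bar> * \<epsilon>))))"
    by (metis less_imp_le)
  define t0 :: real where "t0 = exp (- 4)"
  \<comment> \<open>\<open>D\<close> linearises the exponential moments of orders 1 and -1 to
    \<open>1 + t * D\<close> for t up to 1. \<open>K0\<close> is the constant of the tail estimate.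
    In \<open>K2\<close>, summing over two or more jumps, each jump contributes
    \<open>2 * m\<close>, and \<open>4 + 4 * D\<close> is twice the bound \<open>2 + 2 * D\<close>
    for the expectation of \<open>exp \<bar>z\<bar>\<close>.\<close>
  define D where "D = A * exp \<epsilon> * exp (A * exp \<epsilon>)"
  define K0 where "K0 = 2 * exp a * exp (4 * A / \<epsilon>\<^sup>2)"
  define m where "m = enn2real (\<integral>\<^sup>+x. ennreal (W x) \<partial>jump_size)"
  define y where "y = rate * (2 * m)"
  define K2 where "K2 = c * (4 + 4 * D) * y\<^sup>2 * exp y"
  have D: "D \<ge> 0" using A by (simp add: D_def)
  have K0: "K0 \<ge> 0" by (simp add: K0_def)
  have m: "m \<ge> 0" by (simp add: m_def)
  have y: "y \<ge> 0" using m rate_pos by (simp add: y_def)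
  have K2: "K2 \<ge> 0" using c D by (simp add: K2_def)
  have t0: "t0 > 0" "t0 \<le> 1" by (auto simp: t0_def)
  define C where "C = 2 * D + 2 * c * K0 + K2"
  have C: "C \<ge> 0" "2 * D \<le> C" "D \<le> C" "2 * c * K0 + K2 \<le> C" using D K0 K2 c by (auto simp: C_def)
  have mom: "integrable (Z t) (\<lambda>z. z)" "\<bar>LINT z|Z t. z\<bar> \<le> t * D" "integrable (Z t) (\<lambda>z. z\<^sup>2)" "(LINT z|Z t. z\<^sup>2) \<le> 2 * (t * D)"
      "(LINT z|Z t. exp \<bar>z\<bar>) \<le> 2 + 2 * (t * D)" "integrable (Z t) (\<lambda>z. exp \<bar>z\<bar>)" if t: "0 < t" "t \<le> t0" for t
  proof -
    have "exp (t * (A * exp \<epsilon>)) - 1 \<le> (t * (A * exp \<epsilon>)) * exp (A * exp \<epsilon>)"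
      using t t0 A by (intro exp_minus_one_le) (auto intro: mult_left_le_one_le)
    then have "exp (t * (A * exp \<epsilon>)) \<le> 1 + t * D" by (simp add: D_def)
    then have le: "ennreal (exp (t * (A * exp \<epsilon>))) \<le> ennreal (1 + t * D)" by (rule ennreal_leI)
    have "(\<integral>\<^sup>+z. ennreal (exp z) \<partial>Z t) \<le> ennreal (1 + t * D)" "(\<integral>\<^sup>+z. ennreal (exp (- z)) \<partial>Z t) \<le> ennreal (1 + t * D)"
      using mgf[OF t(1), of 1] mgf[OF t(1), of "-1"] le by (auto intro: order_trans)
    from moments_of_exp_moments[OF Z(1)[OF t(1)] _ this] D t
    show "integrable (Z t) (\<lambda>z. z)" "\<bar>LINT z|Z t. z\<bar> \<le> t * D" "integrable (Z t) (\<lambda>z. z\<^sup>2)" "(LINT z|Z t. z\<^sup>2) \<le> 2 * (t * D)"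
      "(LINT z|Z t. exp \<bar>z\<bar>) \<le> 2 + 2 * (t * D)" "integrable (Z t) (\<lambda>z. exp \<bar>z\<bar>)"
      by auto
  qed
  define p where "p t n = (t * rate) ^ n / fact n * exp (- (t * rate))" for t n
  have p0: "p t n \<ge> 0" if "t > 0" for t n using that rate_pos by (simp add: p_def)
  define I where "I t n = (\<integral>\<^sup>+z. \<integral>\<^sup>+x. ennreal (g (z + x)) \<partial>conv_pow jump_size n \<partial>Z t)" for t n
  have split: "(\<integral>\<^sup>+x. ennreal (g x) \<partial>\<mu> t) = (\<Sum>n. ennreal (p t n) * I t n)" if t: "0 < t" for t
    unfolding I_def p_def by (rule nn_integral_law_split[OF t \<mu>(1)[OF t] \<mu>(2)[OF t] Z(1)[OF t] Z(2)[OF t]]) measurable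
  have I1: "ennreal (p t 1) * I t 1 = ennreal (t * exp (- (t * rate))) * (\<integral>\<^sup>+z. one_jump g z \<partial>Z t)" if t: "0 < t" for t
  proof -
    interpret Z: real_distribution "Z t" by (rule Z(1)[OF t])
    have "(\<integral>\<^sup>+z. one_jump g z \<partial>Z t) = ennreal rate * I t 1"
      unfolding one_jump_eq[OF g] I_def
      by (subst nn_integral_cmult) (simp_all add: nn_integral_conv_pow_1 del: conv_pow.simps)
    moreover have "ennreal (p t 1) = ennreal (t * exp (- (t * rate))) * ennreal rate"
      using t rate_pos by (simp add: p_def ennreal_mult[symmetric] mult_ac)
    ultimately show ?thesis by (simp add: mult.assoc)
  qed
  have inv: "ennreal (1 / t) * (ennreal t * x) = x" if "0 < t" for t x
    using that by (simp add: mult.assoc[symmetric] ennreal_mult[symmetric])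
  show ?thesis
  proof (rule that[OF C(1) t0(1)])
    fix t assume t: "0 < t" "t \<le> t0"
    then have t1: "t \<le> 1" using t0 by simp
    interpret Z: real_distribution "Z t" by (rule Z(1)[OF t(1)])
    show "real_distribution (Z t)" by (rule Z(1)[OF t(1)])
    have tC: "t * D \<le> C * t" "2 * (t * D) \<le> C * t"
      using mult_right_mono[OF C(3), of t] mult_right_mono[OF C(2), of t] t by (auto simp: mult_ac)
    then show "integrable (Z t) (\<lambda>z. z) \<and> \<bar>LINT z|Z t. z\<bar> \<le> C * t"
        "integrable (Z t) (\<lambda>z. z\<^sup>2) \<and> (LINT z|Z t. z\<^sup>2) \<le> C * t"
      using mom[OF t] by auto
    have "ennreal (p t 1) * I t 1 \<le> (\<integral>\<^sup>+x. ennreal (g x) \<partial>\<mu> t)"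
      unfolding split[OF t(1)] using sum_le_suminf[of "\<lambda>n. ennreal (p t n) * I t n" "{1}"] by simp
    then have "ennreal (1 / t) * (ennreal (p t 1) * I t 1) \<le> ennreal (1 / t) * (\<integral>\<^sup>+x. ennreal (g x) \<partial>\<mu> t)"
      by (rule mult_left_mono) simp
    moreover have "ennreal (1 / t) * (ennreal (p t 1) * I t 1) = ennreal (exp (- (t * rate))) * (\<integral>\<^sup>+z. one_jump g z \<partial>Z t)"
      unfolding I1[OF t(1)] using t inv[OF t(1)] by (simp add: ennreal_mult mult.assoc)
    ultimately show "ennreal (exp (- (t * rate))) * (\<integral>\<^sup>+z. one_jump g z \<partial>Z t) \<le> ennreal (1 / t) * (\<integral>\<^sup>+x. ennreal (g x) \<partial>\<mu> t)"
      by simp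
    assume fin: "(\<integral>\<^sup>+x. ennreal (W x) * indicator big x \<partial>N) < \<infinity>"
    have mW: "(\<integral>\<^sup>+x. ennreal (W x) \<partial>jump_size) = ennreal m"
    proof -
      have "ennreal rate * (\<integral>\<^sup>+x. ennreal (W x) \<partial>jump_size) < \<infinity>" using fin by (simp add: nn_integral_jump_size)
      then have "(\<integral>\<^sup>+x. ennreal (W x) \<partial>jump_size) < \<infinity>" using rate_pos by (auto simp: ennreal_mult_less_top)
      then show ?thesis by (simp add: m_def)
    qed
    \<comment> \<open>Without a large jump the payoff is nonzero only beyond \<open>a\<close>, where
      it is at most \<open>2 * c * exp \<bar>z\<bar>\<close>.\<close>
    have T0: "ennreal (p t 0) * I t 0 \<le> ennreal (2 * c * K0 * t\<^sup>2)"
    proof -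
      have "ennreal (p t 0) * I t 0 \<le> 1 * I t 0"
        using t rate_pos by (intro mult_right_mono) (auto simp: p_def)
      also have "1 * I t 0 = (\<integral>\<^sup>+z. ennreal (g z) \<partial>Z t)" by (simp add: I_def nn_integral_return)
      also have "\<dots> \<le> (\<integral>\<^sup>+z. ennreal (2 * c) * (ennreal (exp \<bar>z\<bar>) * indicator {x. \<bar>x\<bar> > a} z) \<partial>Z t)"
      proof (rule nn_integral_mono)
        fix z
        have "g z \<le> c * W z" by (rule gW)
        also have "\<dots> \<le> c * (2 * exp \<bar>z\<bar>)" by (intro mult_left_mono Wexp c)
        finally have "ennreal (g z) \<le> ennreal (2 * c * exp \<bar>z\<bar>)" by (intro ennreal_leI) simp
        then show "ennreal (g z) \<le> ennreal (2 * c) * (ennreal (exp \<bar>z\<bar>) * indicator {x. \<bar>x\<bar> > a} z)"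
          using g0[of z] c by (cases "\<bar>z\<bar> > a") (auto simp: ennreal_mult)
      qed
      also have "\<dots> = ennreal (2 * c) * (\<integral>\<^sup>+z. ennreal (exp \<bar>z\<bar>) * indicator {x. \<bar>x\<bar> > a} z \<partial>Z t)"
        by (rule nn_integral_cmult) simp
      also have "\<dots> \<le> ennreal (2 * c) * ennreal (K0 * t\<^sup>2)"
        unfolding K0_def using t \<epsilon> a A mgf[OF t(1)]
        by (intro mult_left_mono small_jumps_tail Z(1)) (auto simp: t0_def)
      also have "\<dots> = ennreal (2 * c * K0 * t\<^sup>2)" using c K0 by (simp add: ennreal_mult[symmetric] mult_ac)
      finally show ?thesis .
    qed
    have T1: "ennreal (p t 1) * I t 1 \<le> ennreal t * (\<integral>\<^sup>+z. one_jump g z \<partial>Z t)"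
      unfolding I1[OF t(1)] using t rate_pos by (intro mult_right_mono ennreal_leI) auto
    have In: "I t n \<le> ennreal (c * (4 + 4 * D) * (2 * m) ^ n)" for n
    proof -
      interpret Cn: real_distribution "conv_pow jump_size n" by (rule real_distribution_conv_pow[OF real_distribution_jump_size])
      have "I t n \<le> (\<integral>\<^sup>+z. ennreal c * (\<integral>\<^sup>+x. ennreal (W (z + x)) \<partial>conv_pow jump_size n) \<partial>Z t)"
        unfolding I_def
      proof (rule nn_integral_mono)
        fix z
        have "(\<integral>\<^sup>+x. ennreal (g (z + x)) \<partial>conv_pow jump_size n) \<le> (\<integral>\<^sup>+x. ennreal c * ennreal (W (z + x)) \<partial>conv_pow jump_size n)"
          using gW W0 c by (intro nn_integral_mono) (auto simp: ennreal_mult[symmetric] intro!: ennreal_leI)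
        then show "(\<integral>\<^sup>+x. ennreal (g (z + x)) \<partial>conv_pow jump_size n) \<le> ennreal c * (\<integral>\<^sup>+x. ennreal (W (z + x)) \<partial>conv_pow jump_size n)"
          by (simp add: nn_integral_cmult)
      qed
      also have "\<dots> \<le> (\<integral>\<^sup>+z. ennreal c * (ennreal (2 * exp \<bar>z\<bar>) * ennreal ((2 * m) ^ n)) \<partial>Z t)"
      proof (intro nn_integral_mono mult_left_mono)
        fix z
        have "(\<integral>\<^sup>+x. ennreal (W (z + x)) \<partial>conv_pow jump_size n) \<le> ennreal (W z) * (2 * (\<integral>\<^sup>+x. ennreal (W x) \<partial>jump_size)) ^ n"
          using Wsub W0 by (intro nn_integral_conv_pow_submult real_distribution_jump_size)
            (auto simp: ennreal_mult[symmetric] ennreal_numeral[symmetric] simp del: ennreal_numeral intro!: ennreal_leI)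
        also have "(2 * (\<integral>\<^sup>+x. ennreal (W x) \<partial>jump_size)) ^ n = ennreal ((2 * m) ^ n)"
          using m by (simp add: mW ennreal_power[symmetric] ennreal_mult)
        also have "ennreal (W z) * ennreal ((2 * m) ^ n) \<le> ennreal (2 * exp \<bar>z\<bar>) * ennreal ((2 * m) ^ n)"
          by (intro mult_right_mono ennreal_leI Wexp) auto
        finally show "(\<integral>\<^sup>+x. ennreal (W (z + x)) \<partial>conv_pow jump_size n) \<le> ennreal (2 * exp \<bar>z\<bar>) * ennreal ((2 * m) ^ n)" .
      qed simp
      also have "\<dots> = ennreal c * ennreal ((2 * m) ^ n) * ennreal 2 * (\<integral>\<^sup>+z. ennreal (exp \<bar>z\<bar>) \<partial>Z t)"
        by (subst nn_integral_cmult[symmetric]) (auto intro!: nn_integral_cong simp: ennreal_mult mult_ac)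
      also have "(\<integral>\<^sup>+z. ennreal (exp \<bar>z\<bar>) \<partial>Z t) = ennreal (LINT z|Z t. exp \<bar>z\<bar>)"
        by (intro nn_integral_eq_integral mom(6)[OF t]) auto
      also have "ennreal c * ennreal ((2 * m) ^ n) * ennreal 2 * ennreal (LINT z|Z t. exp \<bar>z\<bar>) \<le> ennreal c * ennreal ((2 * m) ^ n) * ennreal 2 * ennreal (2 + 2 * D)"
      proof (intro mult_left_mono ennreal_leI)
        have "t * D \<le> D" using t t1 D by (intro mult_left_le_one_le) auto
        then show "(LINT z|Z t. exp \<bar>z\<bar>) \<le> 2 + 2 * D" using mom(5)[OF t] by linarith
      qed simp
      also have "\<dots> = ennreal (c * (4 + 4 * D) * (2 * m) ^ n)"
      proof -
        have "c * (4 + 4 * D) * (2 * m) ^ n = c * (2 * m) ^ n * 2 * (2 + 2 * D)" by (simp add: algebra_simps)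
        then show ?thesis using c m D by (simp only: ennreal_mult mult_nonneg_nonneg zero_le_power zero_le_numeral add_nonneg_nonneg)
      qed
      finally show ?thesis .
    qed
    have T2: "(\<Sum>n. ennreal (p t (n + 2)) * I t (n + 2)) \<le> ennreal (K2 * t\<^sup>2)"
    proof -
      \<comment> \<open>Two factors t and two factors \<open>y\<close> are taken out of the Poisson
        weight; the remaining powers of t are at most 1, and replacing \<open>fact (n + 2)\<close>
        by \<open>fact n\<close> leaves the exponential series in \<open>y\<close>.\<close>
      define q where "q = c * (4 + 4 * D) * y\<^sup>2 * t\<^sup>2"
      have q: "q \<ge> 0" using c D by (simp add: q_def)
      have "ennreal (p t (n + 2)) * I t (n + 2) \<le> ennreal (q * (y ^ n /\<^sub>R fact n))" for n
      proof -
        have "ennreal (p t (n + 2)) * I t (n + 2) \<le> ennreal (p t (n + 2)) * ennreal (c * (4 + 4 * D) * (2 * m) ^ (n + 2))"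
          by (intro mult_left_mono In) auto
        also have "\<dots> = ennreal (p t (n + 2) * (c * (4 + 4 * D) * (2 * m) ^ (n + 2)))"
          using p0[OF t(1)] by (simp add: ennreal_mult')
        also have "\<dots> \<le> ennreal (q * (y ^ n /\<^sub>R fact n))"
        proof (rule ennreal_leI)
          have f: "fact n \<le> (fact (n + 2) :: real)" by (rule fact_mono) simp
          have e: "exp (- (t * rate)) \<le> 1" using t rate_pos by simp
          have "p t (n + 2) \<le> (t * rate) ^ (n + 2) / fact (n + 2) * 1"
            unfolding p_def using t rate_pos by (intro mult_left_mono e) auto
          also have "\<dots> \<le> (t * rate) ^ (n + 2) / fact n"
            using t rate_pos f by (auto intro!: divide_left_mono)
          also have "\<dots> = t ^ n * (t\<^sup>2 * rate ^ (n + 2) / fact n)" by (simp add: power_mult_distrib power_add power2_eq_square)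
          also have "\<dots> \<le> 1 * (t\<^sup>2 * rate ^ (n + 2) / fact n)"
            using t t1 rate_pos by (intro mult_right_mono power_le_one) auto
          finally have "p t (n + 2) * (c * (4 + 4 * D) * (2 * m) ^ (n + 2)) \<le> (t\<^sup>2 * rate ^ (n + 2) / fact n) * (c * (4 + 4 * D) * (2 * m) ^ (n + 2))"
            using c D m by (intro mult_right_mono) auto
          also have "\<dots> = q * (y ^ n /\<^sub>R fact n)"
            unfolding q_def y_def by (simp add: power_mult_distrib power_add power2_eq_square divide_inverse)
          finally show "p t (n + 2) * (c * (4 + 4 * D) * (2 * m) ^ (n + 2)) \<le> q * (y ^ n /\<^sub>R fact n)" .
        qed
        finally show ?thesis .
      qed
      then have "(\<Sum>n. ennreal (p t (n + 2)) * I t (n + 2)) \<le> (\<Sum>n. ennreal (q * (y ^ n /\<^sub>R fact n)))"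
        by (intro suminf_le) auto
      also have "\<dots> = ennreal (q * exp y)"
        using q y by (intro suminf_ennreal_eq sums_mult exp_converges) auto
      also have "q * exp y = K2 * t\<^sup>2" by (simp add: q_def K2_def)
      finally show ?thesis .
    qed
    have "(\<integral>\<^sup>+x. ennreal (g x) \<partial>\<mu> t) \<le> ennreal (2 * c * K0 * t\<^sup>2) + ennreal t * (\<integral>\<^sup>+z. one_jump g z \<partial>Z t) + ennreal (K2 * t\<^sup>2)"
      unfolding split[OF t(1)] suminf_ennreal_split2[of "\<lambda>n. ennreal (p t n) * I t n"] by (intro add_mono T0 T1 T2)
    also have "\<dots> = ennreal t * ((\<integral>\<^sup>+z. one_jump g z \<partial>Z t) + ennreal ((2 * c * K0 + K2) * t))"
    proof -
      have "ennreal t * ennreal ((2 * c * K0 + K2) * t) = ennreal (2 * c * K0 * t\<^sup>2 + K2 * t\<^sup>2)"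
        using t by (simp add: ennreal_mult'[symmetric] power2_eq_square algebra_simps)
      also have "\<dots> = ennreal (2 * c * K0 * t\<^sup>2) + ennreal (K2 * t\<^sup>2)"
        using c K0 K2 by (intro ennreal_plus) auto
      finally show ?thesis by (simp add: distrib_left add_ac)
    qed
    finally have "ennreal (1 / t) * (\<integral>\<^sup>+x. ennreal (g x) \<partial>\<mu> t) \<le> ennreal (1 / t) * (ennreal t * ((\<integral>\<^sup>+z. one_jump g z \<partial>Z t) + ennreal ((2 * c * K0 + K2) * t)))"
      by (rule mult_left_mono) simp
    also have "\<dots> = (\<integral>\<^sup>+z. one_jump g z \<partial>Z t) + ennreal ((2 * c * K0 + K2) * t)"
      by (rule inv[OF t(1)])
    also have "\<dots> \<le> (\<integral>\<^sup>+z. one_jump g z \<partial>Z t) + ennreal (C * t)"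
      using C t by (intro add_left_mono ennreal_leI mult_right_mono) auto
    finally show "ennreal (1 / t) * (\<integral>\<^sup>+x. ennreal (g x) \<partial>\<mu> t) \<le> (\<integral>\<^sup>+z. one_jump g z \<partial>Z t) + ennreal (C * t)" .
  qed
qed

end

section \<open>Small-time asymptotics of expectations\<close>

context levy_split
begin

lemma one_jump_vanishing:
  assumes g0: "\<And>x. \<bar>x\<bar> \<le> a \<Longrightarrow> g x = 0" and a: "4 * \<epsilon> \<le> a"
  shows "one_jump g 0 = (\<integral>\<^sup>+x. ennreal (g x) \<partial>N)"
  unfolding one_jump_def
proof (rule nn_integral_cong)
  fix x
  show "ennreal (g (0 + x)) * indicator big x = ennreal (g x)"
    using g0[of x] a \<epsilon> by (auto simp: indicator_def)
qed

text \<open>The proof distinguishes whether \<open>W\<close> is integrable over the large jumps. If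
  it is, \<open>one_jump g\<close> is finite everywhere and its quadratic expansion is integrated
  against the small-jump law. If not, the comparison of \<open>W\<close> with \<open>1 + g\<close>
  forces the integral of \<open>g\<close> against \<open>N\<close> to be infinite, and so is the
  scaled expectation for all small times; the relation then holds between infinite values.\<close>

lemma eq_up_to_O_t_jump_integral:
  assumes \<mu>: "\<And>t. t > 0 \<Longrightarrow> real_distribution (\<mu> t)"
      "\<And>t u. t > 0 \<Longrightarrow> char (\<mu> t) u = exp (of_real t * levy_exponent v b N u)"
    and g[measurable]: "g \<in> borel_measurable borel" and g0: "\<And>x. \<bar>x\<bar> \<le> a \<Longrightarrow> g x = 0" and a: "4 * \<epsilon> \<le> a"
    and W[measurable]: "W \<in> borel_measurable borel" and W0: "\<And>x. W x \<ge> 0" and Wexp: "\<And>x. W x \<le> 2 * exp \<bar>x\<bar>"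
    and Wsub: "\<And>x y. W (x + y) \<le> 2 * W x * W y"
    and gW: "\<And>x. g x \<le> c * W x" and c: "c \<ge> 0" and Wg: "\<And>x. W x \<le> c' * (1 + g x)" and gpos: "\<And>x. g x \<ge> 0"
    and smooth: "(\<integral>\<^sup>+x. ennreal (W x) * indicator big x \<partial>N) < \<infinity> \<Longrightarrow>
      \<exists>k C. \<forall>z. \<bar>enn2real (one_jump g z) - enn2real (one_jump g 0) - k * z\<bar> \<le> C * z\<^sup>2"
  shows "eq_up_to_O_t (\<lambda>t. ennreal (1 / t) * (\<integral>\<^sup>+x. ennreal (g x) \<partial>\<mu> t)) (\<lambda>t. \<integral>\<^sup>+x. ennreal (g x) \<partial>N)"
proof -
  obtain C t0 Z where C: "C \<ge> 0" and t0: "t0 > 0"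
    and Z: "\<And>t. 0 < t \<Longrightarrow> t \<le> t0 \<Longrightarrow> real_distribution (Z t)"
    and Z1: "\<And>t. 0 < t \<Longrightarrow> t \<le> t0 \<Longrightarrow> integrable (Z t) (\<lambda>z. z) \<and> \<bar>LINT z|Z t. z\<bar> \<le> C * t"
    and Z2: "\<And>t. 0 < t \<Longrightarrow> t \<le> t0 \<Longrightarrow> integrable (Z t) (\<lambda>z. z\<^sup>2) \<and> (LINT z|Z t. z\<^sup>2) \<le> C * t"
    and lower: "\<And>t. 0 < t \<Longrightarrow> t \<le> t0 \<Longrightarrow> ennreal (exp (- (t * rate))) * (\<integral>\<^sup>+z. one_jump g z \<partial>Z t) \<le> ennreal (1 / t) * (\<integral>\<^sup>+x. ennreal (g x) \<partial>\<mu> t)"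
    and upper: "\<And>t. 0 < t \<Longrightarrow> t \<le> t0 \<Longrightarrow> (\<integral>\<^sup>+x. ennreal (W x) * indicator big x \<partial>N) < \<infinity> \<Longrightarrow>
       ennreal (1 / t) * (\<integral>\<^sup>+x. ennreal (g x) \<partial>\<mu> t) \<le> (\<integral>\<^sup>+z. one_jump g z \<partial>Z t) + ennreal (C * t)"
    using expansion[OF \<mu> g g0 a W W0 Wexp Wsub gW c] by blast
  have H0: "one_jump g 0 = (\<integral>\<^sup>+x. ennreal (g x) \<partial>N)" by (rule one_jump_vanishing[OF g0 a])
  have c': "c' \<ge> 0" using W0[of 0] Wg[of 0] gpos[of 0] by (smt (verit) mult_less_0_iff)
  show ?thesis
  proof (cases "(\<integral>\<^sup>+x. ennreal (W x) * indicator big x \<partial>N) < \<infinity>")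
    case True
    obtain k C' where s: "\<And>z. \<bar>enn2real (one_jump g z) - enn2real (one_jump g 0) - k * z\<bar> \<le> C' * z\<^sup>2"
      using smooth[OF True] by blast
    define G where "G z = enn2real (one_jump g z)" for z
    have s: "\<bar>G z - G 0 - k * z\<bar> \<le> C' * z\<^sup>2" for z using s unfolding G_def by blast
    have G0: "G z \<ge> 0" for z by (simp add: G_def)
    have Gm[measurable]: "G \<in> borel_measurable borel" unfolding G_def[abs_def] by measurable
    have C': "C' \<ge> 0" using s[of 1] by (simp add: abs_le_iff)
    have fin: "one_jump g z = ennreal (G z)" for z
    proof -
      have "one_jump g z \<le> (\<integral>\<^sup>+x. ennreal (2 * c * W z) * (ennreal (W x) * indicator big x) \<partial>N)"
        unfolding one_jump_def
      proof (rule nn_integral_mono)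
        fix x
        have "g (z + x) \<le> c * (2 * W z * W x)"
          by (rule order_trans[OF gW mult_left_mono[OF Wsub c]])
        then have "ennreal (g (z + x)) \<le> ennreal (2 * c * W z) * ennreal (W x)"
          using W0 c by (simp add: ennreal_mult'[symmetric] ennreal_leI mult_ac)
        then show "ennreal (g (z + x)) * indicator big x \<le> ennreal (2 * c * W z) * (ennreal (W x) * indicator big x)"
          by (auto simp: indicator_def)
      qed
      also have "\<dots> = ennreal (2 * c * W z) * (\<integral>\<^sup>+x. ennreal (W x) * indicator big x \<partial>N)"
        by (rule nn_integral_cmult) measurable
      also have "\<dots> < \<infinity>" using True by (simp add: ennreal_mult_less_top)
      finally show ?thesis by (simp add: G_def)
    qed
    \<comment> \<open>The linear term of the expansion meets the first moment, the remainder the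
      second; both moments are at most \<open>C * t\<close>.\<close>
    define K where "K = \<bar>k\<bar> * C + C' * C"
    have K: "K \<ge> 0" using C C' by (simp add: K_def)
    have I: "\<exists>J. (\<integral>\<^sup>+z. one_jump g z \<partial>Z t) = ennreal J \<and> \<bar>J - G 0\<bar> \<le> K * t \<and> J \<ge> 0" if t: "0 < t" "t \<le> t0" for t
    proof -
      interpret Z: real_distribution "Z t" by (rule Z[OF t])
      note Z1 = Z1[OF t] and Z2 = Z2[OF t]
      have iR: "integrable (Z t) (\<lambda>z. G z - G 0 - k * z)"
        by (rule Bochner_Integration.integrable_bound[of _ "\<lambda>z. C' * z\<^sup>2"])
           (use Z2 s in \<open>auto intro!: AE_I2 intro: order_trans[OF _ abs_ge_self]\<close>)
      have "integrable (Z t) (\<lambda>z. (G z - G 0 - k * z) + (G 0 + k * z))"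
        using iR Z1 by (intro Bochner_Integration.integrable_add) auto
      then have iG: "integrable (Z t) G" by simp
      have "(LINT z|Z t. G z) - G 0 - k * (LINT z|Z t. z) = (LINT z|Z t. G z - G 0 - k * z)"
        using iG Z1 Z.prob_space by simp
      also have "\<bar>\<dots>\<bar> \<le> (LINT z|Z t. C' * z\<^sup>2)"
        by (rule order_trans[OF integral_abs_bound integral_mono])
           (use iR Z2 s in auto)
      also have "\<dots> = C' * (LINT z|Z t. z\<^sup>2)" by simp
      also have "\<dots> \<le> C' * (C * t)" using Z2 C' by (intro mult_left_mono) auto
      finally have 1: "\<bar>(LINT z|Z t. G z) - G 0 - k * (LINT z|Z t. z)\<bar> \<le> C' * (C * t)" .
      have "\<bar>k * (LINT z|Z t. z)\<bar> \<le> \<bar>k\<bar> * (C * t)"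
        using Z1 by (auto simp: abs_mult intro!: mult_left_mono)
      with 1 have "\<bar>(LINT z|Z t. G z) - G 0\<bar> \<le> K * t"
        unfolding K_def by (simp add: algebra_simps abs_le_iff)
      moreover have "(\<integral>\<^sup>+z. one_jump g z \<partial>Z t) = ennreal (LINT z|Z t. G z)"
        unfolding fin by (intro nn_integral_eq_integral iG) (auto simp: G0)
      moreover have "(LINT z|Z t. G z) \<ge> 0" using G0 by simp
      ultimately show ?thesis by blast
    qed
    \<comment> \<open>\<open>K\<close> and \<open>C\<close> serve the upper estimate; the last
      summand pays for \<open>1 - t * rate\<close> as a lower bound of
      \<open>exp (- (t * rate))\<close>.\<close>
    define L where "L = K + C + rate * (G 0 + K)"
    have rG: "rate * (G 0 + K) \<ge> 0" using rate_pos G0[of 0] K by simp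
    have ev: "\<forall>\<^sub>F t in at_right (0::real). 0 < t \<and> t \<le> min t0 1"
      using t0 by (auto simp: eventually_at_right_field intro!: exI[of _ "min t0 1"])
    show ?thesis
      unfolding eq_up_to_O_t_def
    proof (intro exI[of _ L], use ev in eventually_elim)
      fix t assume "0 < t \<and> t \<le> min t0 1"
      then have t: "0 < t" "t \<le> t0" "t \<le> 1" by auto
      obtain J where J: "(\<integral>\<^sup>+z. one_jump g z \<partial>Z t) = ennreal J" "\<bar>J - G 0\<bar> \<le> K * t" "J \<ge> 0"
        using I[OF t(1,2)] by blast
      have N0: "(\<integral>\<^sup>+x. ennreal (g x) \<partial>N) = ennreal (G 0)" using H0 fin by simp
      let ?E = "ennreal (1 / t) * (\<integral>\<^sup>+x. ennreal (g x) \<partial>\<mu> t)"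
      have "?E \<le> ennreal J + ennreal (C * t)" using upper[OF t(1,2) True] J by simp
      also have "\<dots> = ennreal (J + C * t)" using J C t by simp
      also have "\<dots> \<le> ennreal (G 0 + L * t)"
        using J(2) rG t unfolding L_def
        by (intro ennreal_leI) (smt (verit, best) distrib_right mult_nonneg_nonneg)
      also have "\<dots> = ennreal (G 0) + ennreal (L * t)"
        using G0[of 0] K C rG t by (intro ennreal_plus) (auto simp: L_def)
      finally have up: "?E \<le> ennreal (G 0) + ennreal (L * t)" .
      have JG: "J \<le> G 0 + K"
      proof -
        have "K * t \<le> K * 1" using K t by (intro mult_left_mono) auto
        then show ?thesis using J(2) by (simp add: abs_le_iff)
      qed
      have "G 0 \<le> exp (- (t * rate)) * J + L * t"
      proof -
        have "(1 - t * rate) * J \<le> exp (- (t * rate)) * J"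
          using exp_ge_add_one_self[of "- (t * rate)"] J(3) by (intro mult_right_mono) auto
        moreover have "t * rate * J \<le> t * rate * (G 0 + K)"
          using JG t rate_pos by (intro mult_left_mono) auto
        moreover have "C * t \<ge> 0" using C t by simp
        ultimately show ?thesis using J(2) unfolding L_def by (simp add: algebra_simps abs_le_iff)
      qed
      then have "ennreal (G 0) \<le> ennreal (exp (- (t * rate)) * J + L * t)" by (rule ennreal_leI)
      also have "\<dots> = ennreal (exp (- (t * rate))) * ennreal J + ennreal (L * t)"
        using J(3) K C rG t by (subst ennreal_plus) (auto simp: L_def ennreal_mult)
      also have "\<dots> \<le> ?E + ennreal (L * t)"
        using lower[OF t(1,2)] J(1) by (intro add_right_mono) simp
      finally show "?E \<le> (\<integral>\<^sup>+x. ennreal (g x) \<partial>N) + ennreal (L * t) \<and> (\<integral>\<^sup>+x. ennreal (g x) \<partial>N) \<le> ?E + ennreal (L * t)"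
        using up N0 by simp
    qed
  next
    case False
    have Wbig: "(\<integral>\<^sup>+x. ennreal (W x) * indicator big x \<partial>N) = \<infinity>"
      using False top.not_eq_extremum infinity_ennreal_def by metis
    \<comment> \<open>Submultiplicativity compares \<open>W x\<close> with \<open>W (z + x)\<close>,
      hence with \<open>1 + g (z + x)\<close>, uniformly for |z| at most 1. A finite value at one
      such \<open>z\<close> would thus make \<open>W\<close> integrable over the large
      jumps.\<close>
    have inf: "one_jump g z = \<infinity>" if z: "\<bar>z\<bar> \<le> 1" for z
    proof (rule ccontr)
      assume *: "one_jump g z \<noteq> \<infinity>"
      define k where "k = 2 * c' * (2 * exp 1)"
      have k: "k \<ge> 0" using c' by (simp add: k_def)
      have le: "W x \<le> k * (1 + g (z + x))" for x
      proof -
        have "W x \<le> 2 * W (z + x) * W (- z)" using Wsub[of "z + x" "- z"] by simp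
        also have "\<dots> \<le> 2 * (c' * (1 + g (z + x))) * (2 * exp 1)"
        proof (intro mult_mono Wg)
          show "W (- z) \<le> 2 * exp 1" using Wexp[of "- z"] z
            by (intro order_trans[OF Wexp]) auto
        qed (use W0 c' gpos in auto)
        finally show ?thesis by (simp add: k_def mult_ac)
      qed
      have "(\<integral>\<^sup>+x. ennreal (W x) * indicator big x \<partial>N) \<le> (\<integral>\<^sup>+x. ennreal k * (indicator big x + ennreal (g (z + x)) * indicator big x) \<partial>N)"
      proof (rule nn_integral_mono)
        fix x
        have "ennreal (W x) \<le> ennreal k * (1 + ennreal (g (z + x)))"
          using le[of x] gpos k by (simp add: ennreal_mult'[symmetric] ennreal_1[symmetric] ennreal_plus[symmetric] ennreal_leI del: ennreal_1 ennreal_plus)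
        then show "ennreal (W x) * indicator big x \<le> ennreal k * (indicator big x + ennreal (g (z + x)) * indicator big x)"
          by (auto simp: indicator_def)
      qed
      also have "\<dots> = ennreal k * (emeasure N big + one_jump g z)"
        unfolding one_jump_def by (simp add: nn_integral_cmult nn_integral_add)
      also have "\<dots> < \<infinity>" using * by (simp add: emeasure_big_eq ennreal_mult_less_top less_top)
      finally show False using Wbig by simp
    qed
    then have N: "(\<integral>\<^sup>+x. ennreal (g x) \<partial>N) = \<infinity>" using H0 by (metis abs_zero zero_le_one)
    have "\<forall>\<^sub>F t in at_right (0::real). 0 < t \<and> t \<le> t0 \<and> C * t < 1"
      using t0 C by (auto simp: eventually_at_right_field intro!: exI[of _ "min t0 (1 / (C + 1))"]) (smt (verit) mult.commute pos_less_divide_eq mult_left_mono distrib_left mult_less_cancel_left)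
    then have "\<forall>\<^sub>F t in at_right (0::real). ennreal (1 / t) * (\<integral>\<^sup>+x. ennreal (g x) \<partial>\<mu> t) = \<infinity>"
    proof eventually_elim
      case (elim t)
      interpret Z: real_distribution "Z t" by (rule Z) (use elim in auto)
      \<comment> \<open>Chebyshev's inequality: as \<open>C * t < 1\<close>, the interval from -1 to
        1, on which \<open>one_jump g\<close> is infinite, has positive probability.\<close>
      have "Z.prob {z. \<bar>z\<bar> > 1} \<le> (LINT z|Z t. z\<^sup>2)"
      proof -
        have "Z.prob {z. \<bar>z\<bar> > 1} = (LINT z|Z t. indicator {z. \<bar>z\<bar> > 1} z)" by simp
        also have "\<dots> \<le> (LINT z|Z t. z\<^sup>2)"
        proof (intro integral_mono)
          show "indicat_real {z. 1 < \<bar>z\<bar>} x \<le> x\<^sup>2" for x :: real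
            using one_le_power[of "\<bar>x\<bar>" 2] by (auto simp: indicator_def)
          show "integrable (Z t) (indicat_real {z. 1 < \<bar>z\<bar>})"
            by (rule Z.integrable_const_bound[of _ 1]) (auto simp: indicator_def)
        qed (use Z2[of t] elim in auto)
        finally show ?thesis .
      qed
      also have "\<dots> < 1" using Z2[of t] elim by auto
      finally have "Z.prob {z. \<bar>z\<bar> > 1} < 1" .
      moreover have "Z.prob {z. \<bar>z\<bar> > 1} = 1 - Z.prob {z. \<bar>z\<bar> \<le> 1}"
        using Z.prob_compl[of "{z. \<bar>z\<bar> \<le> 1}"] by (simp add: Compl_eq_Diff_UNIV[symmetric] Collect_neg_eq[symmetric] not_le)
      ultimately have pos: "Z.prob {z. \<bar>z\<bar> \<le> 1} > 0" by simp
      have "(\<integral>\<^sup>+z. \<infinity> * indicator {z. \<bar>z\<bar> \<le> 1} z \<partial>Z t) \<le> (\<integral>\<^sup>+z. one_jump g z \<partial>Z t)"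
        using inf by (intro nn_integral_mono) (auto simp: indicator_def)
      moreover have "(\<integral>\<^sup>+z. \<infinity> * indicator {z. \<bar>z\<bar> \<le> 1} z \<partial>Z t) = \<infinity>"
        using pos by (subst nn_integral_cmult) (auto simp: Z.emeasure_eq_measure ennreal_top_mult)
      ultimately have "(\<integral>\<^sup>+z. one_jump g z \<partial>Z t) = \<infinity>" by (simp add: top_unique)
      then have "ennreal (exp (- (t * rate))) * \<infinity> \<le> ennreal (1 / t) * (\<integral>\<^sup>+x. ennreal (g x) \<partial>\<mu> t)"
        using lower[of t] elim by simp
      then show ?case by (simp add: ennreal_mult_top top_unique)
    qed
    then show ?thesis unfolding eq_up_to_O_t_def N
      by (intro exI[of _ 0]) (auto elim!: eventually_mono)
  qed
qed

text \<open>A bounded integrand admits the constant weight 1, which is always integrable over the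
  large jumps. Continuity alone gives no rate, but continuity of \<open>one_jump g\<close> at 0
  together with a second moment O(t) of the small-jump law suffices for the limit.\<close>

lemma tendsto_jump_integral_nonneg:
  fixes g :: "real \<Rightarrow> real"
  assumes \<mu>: "\<And>t. t > 0 \<Longrightarrow> real_distribution (\<mu> t)"
      "\<And>t u. t > 0 \<Longrightarrow> char (\<mu> t) u = exp (of_real t * levy_exponent v b N u)"
    and cont: "continuous_on UNIV g" and g0: "\<And>x. \<bar>x\<bar> \<le> a \<Longrightarrow> g x = 0" and a: "4 * \<epsilon> \<le> a"
    and gpos: "\<And>x. g x \<ge> 0" and B: "\<And>x. g x \<le> B"
  shows "((\<lambda>t. (1 / t) * (LINT x|\<mu> t. g x)) \<longlongrightarrow> (LINT x|N. g x)) (at_right 0)"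
proof -
  have g[measurable]: "g \<in> borel_measurable borel" by (rule borel_measurable_continuous_onI[OF cont])
  have B0: "B \<ge> 0" using gpos[of 0] B[of 0] by simp
  obtain C t0 Z where C: "C \<ge> 0" and t0: "t0 > 0"
    and Z: "\<And>t. 0 < t \<Longrightarrow> t \<le> t0 \<Longrightarrow> real_distribution (Z t)"
    and Z2: "\<And>t. 0 < t \<Longrightarrow> t \<le> t0 \<Longrightarrow> integrable (Z t) (\<lambda>z. z\<^sup>2) \<and> (LINT z|Z t. z\<^sup>2) \<le> C * t"
    and lower: "\<And>t. 0 < t \<Longrightarrow> t \<le> t0 \<Longrightarrow> ennreal (exp (- (t * rate))) * (\<integral>\<^sup>+z. one_jump g z \<partial>Z t) \<le> ennreal (1 / t) * (\<integral>\<^sup>+x. ennreal (g x) \<partial>\<mu> t)"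
    and upper: "\<And>t. 0 < t \<Longrightarrow> t \<le> t0 \<Longrightarrow> (\<integral>\<^sup>+x. ennreal 1 * indicator big x \<partial>N) < \<infinity> \<Longrightarrow>
       ennreal (1 / t) * (\<integral>\<^sup>+x. ennreal (g x) \<partial>\<mu> t) \<le> (\<integral>\<^sup>+z. one_jump g z \<partial>Z t) + ennreal (C * t)"
  proof (rule expansion[OF \<mu> g g0 a, of "\<lambda>_. 1" B])
    show "1 \<le> 2 * exp \<bar>x\<bar>" for x :: real
    proof -
      have "1 \<le> exp \<bar>x\<bar>" by simp
      then show ?thesis by linarith
    qed
  qed (use B B0 in auto)
  have fin: "(\<integral>\<^sup>+x. ennreal 1 * indicator big x \<partial>N) < \<infinity>"
    using emeasure_big_eq by simp
  define h where "h z = (LINT x|N. indicator big x * g (z + x))" for z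
  have ib: "integrable N (\<lambda>x. indicator big x * B)"
    using emeasure_big_eq by auto
  have ih: "integrable N (\<lambda>x. indicator big x * g (z + x))" for z
    by (rule Bochner_Integration.integrable_bound[OF ib]) (use gpos B B0 in \<open>auto simp: indicator_def\<close>)
  have h0: "0 \<le> h z" for z unfolding h_def using gpos by simp
  have hB: "h z \<le> B * rate" for z
  proof -
    have "h z \<le> (LINT x|N. indicator big x * B)"
      unfolding h_def by (intro integral_mono ih ib) (use gpos B B0 in \<open>auto simp: indicator_def\<close>)
    then show ?thesis by (simp add: rate_def mult.commute)
  qed
  have Hh: "one_jump g z = ennreal (h z)" for z
  proof -
    have "one_jump g z = (\<integral>\<^sup>+x. ennreal (indicator big x * g (z + x)) \<partial>N)"
      unfolding one_jump_def by (intro nn_integral_cong) (auto simp: indicator_def)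
    also have "\<dots> = ennreal (h z)"
      unfolding h_def by (intro nn_integral_eq_integral ih) (use gpos in auto)
    finally show ?thesis .
  qed
  have "h = (\<lambda>z. enn2real (one_jump g z))" by (simp add: Hh h0 fun_eq_iff)
  then have hm[measurable]: "h \<in> borel_measurable borel" by simp
  have hN: "h 0 = (LINT x|N. g x)"
    unfolding h_def by (intro Bochner_Integration.integral_cong) (use g0 a \<epsilon> in \<open>auto simp: indicator_def\<close>)
  have hc: "isCont h 0"
    unfolding continuous_at_sequentially comp_def
  proof safe
    fix s :: "nat \<Rightarrow> real" assume s: "s \<longlonglongrightarrow> 0"
    show "(\<lambda>n. h (s n)) \<longlonglongrightarrow> h 0"
      unfolding h_def
    proof (rule integral_dominated_convergence[OF _ _ ib])
      show "AE x in N. (\<lambda>n. indicat_real big x * g (s n + x)) \<longlonglongrightarrow> indicat_real big x * g (0 + x)"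
      proof (rule AE_I2, intro tendsto_mult tendsto_const)
        fix x
        have "isCont g (0 + x)" using cont by (simp add: continuous_on_eq_continuous_at)
        then show "(\<lambda>n. g (s n + x)) \<longlonglongrightarrow> g (0 + x)"
          by (rule isCont_tendsto_compose) (intro tendsto_intros s)
      qed
      show "AE x in N. norm (indicat_real big x * g (s n + x)) \<le> indicat_real big x * B" for n
        using gpos B by (auto simp: indicator_def)
    qed measurable
  qed
  define J where "J t = (LINT z|Z t. h z)" for t
  have J: "(\<integral>\<^sup>+z. one_jump g z \<partial>Z t) = ennreal (J t)" "J t \<ge> 0" "integrable (Z t) h" if t: "0 < t" "t \<le> t0" for t
  proof -
    interpret Z: real_distribution "Z t" by (rule Z[OF t])
    show i: "integrable (Z t) h"
      by (rule Z.integrable_const_bound[of _ "B * rate"]) (use h0 hB in auto)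
    then show "(\<integral>\<^sup>+z. one_jump g z \<partial>Z t) = ennreal (J t)"
      unfolding Hh J_def by (intro nn_integral_eq_integral) (auto simp: h0)
    show "J t \<ge> 0" unfolding J_def using h0 by simp
  qed
  have ev: "\<forall>\<^sub>F t in at_right (0::real). 0 < t \<and> t \<le> t0"
    using t0 by (auto simp: eventually_at_right_field intro!: exI[of _ "t0"])
  have Jlim: "(J \<longlongrightarrow> h 0) (at_right 0)"
  proof (rule tendstoI)
    fix e :: real assume e: "e > 0"
    obtain d where d: "d > 0" "\<And>z. \<bar>z\<bar> < d \<Longrightarrow> \<bar>h z - h 0\<bar> < e / 2"
      using hc e unfolding continuous_at_eps_delta by (metis half_gt_zero dist_real_def diff_zero)
    \<comment> \<open>Outside the continuity radius \<open>d\<close> the oscillation of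
      \<open>h\<close> is at most \<open>B * rate\<close>, and \<open>Q\<close> is chosen so that
      \<open>Q * z\<^sup>2\<close> exceeds this there.\<close>
    define Q where "Q = B * rate / d\<^sup>2"
    have Q: "Q \<ge> 0" using B0 rate_pos by (simp add: Q_def)
    have q: "\<bar>h z - h 0\<bar> \<le> e / 2 + Q * z\<^sup>2" for z
    proof (cases "\<bar>z\<bar> < d")
      case True
      have "0 \<le> Q * z\<^sup>2" using Q by simp
      then show ?thesis using d(2)[OF True] by linarith
    next
      case False
      then have "d\<^sup>2 \<le> z\<^sup>2" using d(1) abs_le_square_iff[of d z] by simp
      then have "B * rate \<le> Q * z\<^sup>2" using d(1) B0 rate_pos
        by (simp add: Q_def field_simps mult_left_mono)
      moreover have "\<bar>h z - h 0\<bar> \<le> B * rate" using h0[of z] h0[of 0] hB[of z] hB[of 0] by linarith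
      ultimately show ?thesis using e by linarith
    qed
    have "((\<lambda>t. Q * (C * t)) \<longlongrightarrow> Q * (C * 0)) (at_right 0)" by (intro tendsto_intros)
    then have "\<forall>\<^sub>F t in at_right 0. Q * (C * t) < e / 2"
      using e by (intro order_tendstoD) auto
    then show "\<forall>\<^sub>F t in at_right 0. dist (J t) (h 0) < e"
      using ev
    proof eventually_elim
      case (elim t)
      then have t: "0 < t" "t \<le> t0" by auto
      interpret Z: real_distribution "Z t" by (rule Z[OF t])
      have "J t - h 0 = (LINT z|Z t. h z - h 0)" using J(3)[OF t] Z.prob_space by (simp add: J_def)
      also have "\<bar>\<dots>\<bar> \<le> (LINT z|Z t. e / 2 + Q * z\<^sup>2)"
        by (rule order_trans[OF integral_abs_bound integral_mono]) (use J(3)[OF t] Z2[OF t] q in auto)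
      also have "\<dots> = e / 2 + Q * (LINT z|Z t. z\<^sup>2)" using Z2[OF t] Z.prob_space by simp
      also have "\<dots> \<le> e / 2 + Q * (C * t)" using Z2[OF t] Q by (intro add_left_mono mult_left_mono) auto
      finally show ?case using elim by (simp add: dist_real_def)
    qed
  qed
  have bounds: "exp (- (t * rate)) * J t \<le> (1 / t) * (LINT x|\<mu> t. g x) \<and> (1 / t) * (LINT x|\<mu> t. g x) \<le> J t + C * t" if t: "0 < t" "t \<le> t0" for t
  proof -
    interpret m: real_distribution "\<mu> t" by (rule \<mu>(1)[OF t(1)])
    have i: "integrable (\<mu> t) g" by (rule m.integrable_const_bound[of _ B]) (use gpos B in auto)
    have n: "(\<integral>\<^sup>+x. ennreal (g x) \<partial>\<mu> t) = ennreal (LINT x|\<mu> t. g x)"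
      by (rule nn_integral_eq_integral[OF i]) (use gpos in auto)
    have p: "(LINT x|\<mu> t. g x) \<ge> 0" using gpos by simp
    have n': "ennreal (1 / t) * (\<integral>\<^sup>+x. ennreal (g x) \<partial>\<mu> t) = ennreal ((1 / t) * (LINT x|\<mu> t. g x))"
      unfolding n using t p by (subst ennreal_mult) auto
    show ?thesis
      using lower[OF t] upper[OF t fin] J(2)[OF t] p C t
      unfolding n' J(1)[OF t]
      by (simp add: ennreal_mult'[symmetric] ennreal_plus[symmetric] ennreal_le_iff del: ennreal_plus)
  qed
  show ?thesis
    unfolding hN[symmetric]
  proof (rule tendsto_sandwich)
    show "\<forall>\<^sub>F t in at_right 0. exp (- (t * rate)) * J t \<le> (1 / t) * (LINT x|\<mu> t. g x)"
      "\<forall>\<^sub>F t in at_right 0. (1 / t) * (LINT x|\<mu> t. g x) \<le> J t + C * t"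
      using ev by (auto elim!: eventually_mono dest: bounds)
    have "((\<lambda>t. exp (- (t * rate)) * J t) \<longlongrightarrow> exp (- (0 * rate)) * h 0) (at_right 0)"
      by (intro tendsto_intros Jlim)
    then show "((\<lambda>t. exp (- (t * rate)) * J t) \<longlongrightarrow> h 0) (at_right 0)" by simp
    have "((\<lambda>t. J t + C * t) \<longlongrightarrow> h 0 + C * 0) (at_right 0)"
      by (intro tendsto_intros Jlim)
    then show "((\<lambda>t. J t + C * t) \<longlongrightarrow> h 0) (at_right 0)" by simp
  qed
qed

end

text \<open>Complex integrands are needed for exponentials of jump functionals minus 1. Real and
  imaginary parts, and their positive and negative parts, reduce them to the nonnegative
  case.\<close>

lemma (in levy_data) tendsto_jump_integral:
  fixes F :: "real \<Rightarrow> complex"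
  assumes mass: "\<And>\<epsilon>. 0 < \<epsilon> \<Longrightarrow> measure N {x. \<bar>x\<bar> > \<epsilon>} > 0"
    and \<mu>: "\<And>t. t > 0 \<Longrightarrow> real_distribution (\<mu> t)"
      "\<And>t u. t > 0 \<Longrightarrow> char (\<mu> t) u = exp (of_real t * levy_exponent v b N u)"
    and cont: "continuous_on UNIV F" and F0: "\<And>x. \<bar>x\<bar> \<le> a \<Longrightarrow> F x = 0" and a: "0 < a"
    and B: "\<And>x. norm (F x) \<le> B"
  shows "((\<lambda>t. of_real (1 / t) * (CLINT x|\<mu> t. F x)) \<longlongrightarrow> (CLINT x|N. F x)) (at_right 0)"
proof -
  define e where "e = min 1 (a / 4)"
  interpret S: levy_split v b N e
    by unfold_locales (use a mass[of e] in \<open>auto simp: e_def\<close>)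
  have ea: "4 * e \<le> a" by (simp add: e_def)
  have B0: "B \<ge> 0" using B[of 0] by (rule order_trans[OF norm_ge_zero])
  have R: "((\<lambda>t. (1 / t) * (LINT x|\<mu> t. f x)) \<longlongrightarrow> (LINT x|N. f x)) (at_right 0)
      \<and> integrable N f \<and> (\<forall>t>0. integrable (\<mu> t) f)"
    if f: "continuous_on UNIV f" "\<And>x. \<bar>x\<bar> \<le> a \<Longrightarrow> f x = 0" "\<And>x. \<bar>f x\<bar> \<le> B" for f :: "real \<Rightarrow> real"
  proof -
    have [measurable]: "f \<in> borel_measurable borel" by (rule borel_measurable_continuous_onI[OF f(1)])
    have i: "integrable N h" "t > 0 \<Longrightarrow> integrable (\<mu> t) h"
      if "h \<in> borel_measurable borel" "\<And>x. \<bar>h x\<bar> \<le> \<bar>f x\<bar>" for h :: "real \<Rightarrow> real" and t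
    proof -
      have hB: "\<bar>h x\<bar> \<le> B" for x using that(2) f(3) order_trans by blast
      have h0: "h x = 0" if "\<bar>x\<bar> \<le> a" for x using \<open>\<And>x. \<bar>h x\<bar> \<le> \<bar>f x\<bar>\<close>[of x] f(2)[OF that] by simp
      show "integrable N h"
        by (rule integrable_bigI[OF that(1) a, of B]) (use hB h0 in auto)
      assume "t > 0"
      then interpret m: real_distribution "\<mu> t" by (rule \<mu>(1))
      show "integrable (\<mu> t) h"
        by (rule m.integrable_const_bound[of _ B]) (use that hB in auto)
    qed
    have p: "((\<lambda>t. (1 / t) * (LINT x|\<mu> t. max (f x) 0)) \<longlongrightarrow> (LINT x|N. max (f x) 0)) (at_right 0)"
      by (rule S.tendsto_jump_integral_nonneg[OF \<mu> _ _ ea, of _ B])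
         (use f B0 in \<open>auto intro!: continuous_intros simp: abs_le_iff\<close>)
    have n: "((\<lambda>t. (1 / t) * (LINT x|\<mu> t. max (- f x) 0)) \<longlongrightarrow> (LINT x|N. max (- f x) 0)) (at_right 0)"
      by (rule S.tendsto_jump_integral_nonneg[OF \<mu> _ _ ea, of _ B])
         (use f B0 in \<open>auto intro!: continuous_intros simp: abs_le_iff\<close>)
    have eq: "(LINT x|M. max (f x) 0) - (LINT x|M. max (- f x) 0) = (LINT x|M. f x)"
      if "integrable M (\<lambda>x. max (f x) 0)" "integrable M (\<lambda>x. max (- f x) 0)" for M
    proof -
      have "(\<lambda>x. max (f x) 0 - max (- f x) 0) = f" by (auto simp: fun_eq_iff)
      then show ?thesis using Bochner_Integration.integral_diff[OF that] by simp
    qed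
    have im: "integrable N (\<lambda>x. max (f x) 0)" "integrable N (\<lambda>x. max (- f x) 0)"
      and im': "integrable (\<mu> t) (\<lambda>x. max (f x) 0)" "integrable (\<mu> t) (\<lambda>x. max (- f x) 0)" if "t > 0" for t
      using that by (auto intro!: i simp: max_def)
    have "((\<lambda>t. (1 / t) * (LINT x|\<mu> t. max (f x) 0) - (1 / t) * (LINT x|\<mu> t. max (- f x) 0)) \<longlongrightarrow> (LINT x|N. f x)) (at_right 0)"
      using tendsto_diff[OF p n] unfolding eq[OF im[OF zero_less_one]] .
    moreover have "\<forall>\<^sub>F t in at_right 0. (1 / t) * (LINT x|\<mu> t. max (f x) 0) - (1 / t) * (LINT x|\<mu> t. max (- f x) 0) = (1 / t) * (LINT x|\<mu> t. f x)"
      using eventually_at_right_less[of "0::real"]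
    proof eventually_elim
      case (elim t)
      show ?case
        unfolding right_diff_distrib[symmetric] eq[OF im'[OF elim]] ..
    qed
    ultimately have "((\<lambda>t. (1 / t) * (LINT x|\<mu> t. f x)) \<longlongrightarrow> (LINT x|N. f x)) (at_right 0)"
      by (rule Lim_transform_eventually)
    then show ?thesis using i(1)[of f] i(2)[of f] \<open>f \<in> borel_measurable borel\<close> by auto
  qed
  have Re: "\<bar>Re (F x)\<bar> \<le> B" "\<bar>Im (F x)\<bar> \<le> B" for x
    using abs_Re_le_cmod[of "F x"] abs_Im_le_cmod[of "F x"] B[of x] by linarith+
  have c: "continuous_on UNIV (\<lambda>x. Re (F x))" "continuous_on UNIV (\<lambda>x. Im (F x))"
    using cont by (auto intro!: continuous_intros)
  have R1: "((\<lambda>t. (1 / t) * (LINT x|\<mu> t. Re (F x))) \<longlongrightarrow> (LINT x|N. Re (F x))) (at_right 0)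
      \<and> integrable N (\<lambda>x. Re (F x)) \<and> (\<forall>t>0. integrable (\<mu> t) (\<lambda>x. Re (F x)))"
    by (rule R[OF c(1)]) (use F0 Re in auto)
  have R2: "((\<lambda>t. (1 / t) * (LINT x|\<mu> t. Im (F x))) \<longlongrightarrow> (LINT x|N. Im (F x))) (at_right 0)
      \<and> integrable N (\<lambda>x. Im (F x)) \<and> (\<forall>t>0. integrable (\<mu> t) (\<lambda>x. Im (F x)))"
    by (rule R[OF c(2)]) (use F0 Re in auto)
  have i: "complex_integrable M F \<and> Re (CLINT x|M. F x) = (LINT x|M. Re (F x)) \<and> Im (CLINT x|M. F x) = (LINT x|M. Im (F x))"
    if "integrable M (\<lambda>x. Re (F x))" "integrable M (\<lambda>x. Im (F x))" for M
  proof -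
    have "complex_integrable M (\<lambda>x. of_real (Re (F x)) + \<i> * of_real (Im (F x)))"
      using that by (intro Bochner_Integration.integrable_add integrable_mult_right integrable_of_real)
    then have "complex_integrable M F" by (simp add: complex_eq[symmetric])
    then show ?thesis by simp
  qed
  have lim: "((\<lambda>t. Complex ((1 / t) * (LINT x|\<mu> t. Re (F x))) ((1 / t) * (LINT x|\<mu> t. Im (F x)))) \<longlongrightarrow> Complex (LINT x|N. Re (F x)) (LINT x|N. Im (F x))) (at_right 0)"
    by (rule tendsto_Complex[OF conjunct1[OF R1] conjunct1[OF R2]])
  have "\<forall>\<^sub>F t in at_right 0. Complex ((1 / t) * (LINT x|\<mu> t. Re (F x))) ((1 / t) * (LINT x|\<mu> t. Im (F x))) = of_real (1 / t) * (CLINT x|\<mu> t. F x)"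
    using eventually_at_right_less[of "0::real"]
  proof eventually_elim
    case (elim t)
    then have "complex_integrable (\<mu> t) F \<and> Re (CLINT x|\<mu> t. F x) = (LINT x|\<mu> t. Re (F x)) \<and> Im (CLINT x|\<mu> t. F x) = (LINT x|\<mu> t. Im (F x))"
      using R1 R2 by (intro i) auto
    then show ?case by (simp add: complex_eq_iff del: integral_Re integral_Im)
  qed
  moreover have "Complex (LINT x|N. Re (F x)) (LINT x|N. Im (F x)) = (CLINT x|N. F x)"
    using i[OF conjunct1[OF conjunct2[OF R1]] conjunct1[OF conjunct2[OF R2]]]
    by (simp add: complex_eq_iff del: integral_Re integral_Im)
  ultimately show ?thesis using lim by (auto elim: Lim_transform_eventually)
qed

section \<open>Jumps of cadlag paths\<close>

lemma cadlag_left_limit: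
  assumes "cadlag x" "t > 0"
  shows "(x \<longlongrightarrow> x t - jump x t) (at_left t)"
proof -
  obtain l where l: "(x \<longlongrightarrow> l) (at_left t)" using assms by (auto simp: cadlag_def)
  then have "Lim (at_left t) x = l" by (intro tendsto_Lim) (simp_all add: trivial_limit_at_left_real)
  then show ?thesis using l by (simp add: jump_def)
qed

text \<open>Compactness, in the form of interval bisection: around each \<open>r\<close> the
  one-sided limits make the oscillation small on either side, and \<open>r\<close> itself is put
  into \<open>D\<close>. The half-open interval fits right-continuity: it may start at a point of
  \<open>D\<close>, but may not contain or end at one.\<close>

lemma cadlag_finite_oscillation:
  assumes x: "cadlag x" and ab: "a \<le> b" and \<eta>: "\<eta> > 0"
  shows "\<exists>D. finite D \<and> (\<forall>u v. 0 \<le> u \<and> a \<le> u \<and> u < v \<and> v \<le> b \<and> D \<inter> {u<..v} = {} \<longrightarrow> \<bar>x v - x u\<bar> \<le> \<eta>)"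
  using ab
proof (induction a b rule: Bolzano)
  case (trans a b c)
  then obtain D1 D2 where D: "finite D1" "finite D2"
    "\<And>u v. 0 \<le> u \<Longrightarrow> a \<le> u \<Longrightarrow> u < v \<Longrightarrow> v \<le> b \<Longrightarrow> D1 \<inter> {u<..v} = {} \<Longrightarrow> \<bar>x v - x u\<bar> \<le> \<eta>"
    "\<And>u v. 0 \<le> u \<Longrightarrow> b \<le> u \<Longrightarrow> u < v \<Longrightarrow> v \<le> c \<Longrightarrow> D2 \<inter> {u<..v} = {} \<Longrightarrow> \<bar>x v - x u\<bar> \<le> \<eta>"
    by metis
  show ?case
  proof (intro exI[of _ "D1 \<union> D2 \<union> {b}"] conjI allI impI)
    fix u v assume uv: "0 \<le> u \<and> a \<le> u \<and> u < v \<and> v \<le> c \<and> (D1 \<union> D2 \<union> {b}) \<inter> {u<..v} = {}"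
    then have "b \<notin> {u<..v}" "D1 \<inter> {u<..v} = {}" "D2 \<inter> {u<..v} = {}" by auto
    then show "\<bar>x v - x u\<bar> \<le> \<eta>"
      using D(3)[of u v] D(4)[of u v] uv by (cases "v < b") auto
  qed (use D in auto)
next
  case (local r)
  show ?case
  \<comment> \<open>Only nonnegative times carry information: a short enough interval around a
    negative \<open>r\<close> contains none.\<close>
  proof (cases "r < 0")
    case True
    then show ?thesis
      by (intro exI[of _ "- r"]) (auto intro!: exI[of _ "{}"])
  next
    case False
    then have r: "r \<ge> 0" by simp
    have half: "\<eta> / 2 > 0" using \<eta> by simp
    have "(x \<longlongrightarrow> x r) (at_right r)" using x r by (simp add: cadlag_def)
    then have "\<forall>\<^sub>F y in at_right r. dist (x y) (x r) < \<eta> / 2" using half by (rule tendstoD)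
    then obtain d1 where d1: "d1 > r" "\<And>y. r < y \<Longrightarrow> y < d1 \<Longrightarrow> \<bar>x y - x r\<bar> < \<eta> / 2"
      unfolding eventually_at_right_field dist_real_def by auto
    obtain d2 l where d2: "d2 < r" "\<And>y. 0 \<le> y \<Longrightarrow> d2 < y \<Longrightarrow> y < r \<Longrightarrow> \<bar>x y - l\<bar> < \<eta> / 2"
    \<comment> \<open>At time 0 there is no left limit to use; the condition on \<open>l\<close> is
      then empty.\<close>
    proof (cases "r = 0")
      case True
      then show ?thesis by (intro that[of "-1"]) auto
    next
      case False
      then have "(x \<longlongrightarrow> x r - jump x r) (at_left r)" using x r by (intro cadlag_left_limit) auto
      then have "\<forall>\<^sub>F y in at_left r. dist (x y) (x r - jump x r) < \<eta> / 2" using half by (rule tendstoD)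
      then show ?thesis unfolding eventually_at_left_field dist_real_def using that by blast
    qed
    have close: "\<bar>y - z\<bar> \<le> \<eta>" if "\<bar>y - l\<bar> < \<eta> / 2" "\<bar>z - l\<bar> < \<eta> / 2" for y z l :: real
      using that by linarith
    show ?thesis
    proof (intro exI[of _ "min (d1 - r) (r - d2)"] conjI allI impI)
      fix a b assume ab: "a \<le> r \<and> r \<le> b \<and> b - a < min (d1 - r) (r - d2)"
      show "\<exists>D. finite D \<and> (\<forall>u v. 0 \<le> u \<and> a \<le> u \<and> u < v \<and> v \<le> b \<and> D \<inter> {u<..v} = {} \<longrightarrow> \<bar>x v - x u\<bar> \<le> \<eta>)"
      proof (intro exI[of _ "{r}"] conjI allI impI)
        fix u v assume uv: "0 \<le> u \<and> a \<le> u \<and> u < v \<and> v \<le> b \<and> {r} \<inter> {u<..v} = {}"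
        then consider "v < r" | "r \<le> u" by fastforce
        then show "\<bar>x v - x u\<bar> \<le> \<eta>"
        proof cases
          case 1
          then show ?thesis using uv ab by (intro close[of _ l] d2(2)) auto
        next
          case 2
          have "\<bar>x y - x r\<bar> < \<eta> / 2" if "r \<le> y" "y < d1" for y
            using d1(2)[of y] that half by (cases "y = r") auto
          then show ?thesis using 2 uv ab by (intro close[of _ "x r"]) auto
        qed
      qed simp
    qed (use d1 d2 in auto)
  qed
qed

section \<open>Sums over increments and over jumps\<close>

definition increment_sum :: "(real \<Rightarrow> real) \<Rightarrow> (real \<Rightarrow> real) \<Rightarrow> real \<Rightarrow> real \<Rightarrow> nat \<Rightarrow> real" where
  "increment_sum f x a b n =
     (\<Sum>i<n. f (x (a + real (Suc i) * ((b - a) / real n)) - x (a + real i * ((b - a) / real n))))"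

definition jump_sum :: "(real \<Rightarrow> real) \<Rightarrow> (real \<Rightarrow> real) \<Rightarrow> real \<Rightarrow> real \<Rightarrow> real" where
  "jump_sum f x a b = (\<Sum>\<^sub>\<infinity>s\<in>{a<..b}. f (jump x s))"

text \<open>A function vanishing near 0 sees only the finitely many jumps larger than
  \<open>\<eta>\<close>. Away from the exceptional set a jump is a limit of increments over
  intervals that avoid this set, so it inherits their bound; the infinite sum is therefore
  finite.\<close>

lemma jump_sum_finite:
  assumes x: "cadlag x" and ab: "0 \<le> a" "a \<le> b" and \<eta>: "\<eta> > 0" "\<And>y. \<bar>y\<bar> \<le> \<eta> \<Longrightarrow> f y = 0"
  shows "\<exists>D. finite D \<and> D \<subseteq> {a<..b} \<and> (\<forall>s\<in>{a<..b} - D. f (jump x s) = 0) \<and>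
    (\<forall>u v. a \<le> u \<longrightarrow> u < v \<longrightarrow> v \<le> b \<longrightarrow> D \<inter> {u<..v} = {} \<longrightarrow> f (x v - x u) = 0) \<and>
    jump_sum f x a b = (\<Sum>s\<in>D. f (jump x s))"
proof -
  obtain D' where D': "finite D'" "\<And>u v. 0 \<le> u \<Longrightarrow> a \<le> u \<Longrightarrow> u < v \<Longrightarrow> v \<le> b \<Longrightarrow> D' \<inter> {u<..v} = {} \<Longrightarrow> \<bar>x v - x u\<bar> \<le> \<eta>"
    using cadlag_finite_oscillation[OF x ab(2) \<eta>(1)] by metis
  define D where "D = D' \<inter> {a<..b}"
  have D: "finite D" "D \<subseteq> {a<..b}" using D' by (auto simp: D_def)
  have osc: "\<bar>x v - x u\<bar> \<le> \<eta>" if "a \<le> u" "u < v" "v \<le> b" "D \<inter> {u<..v} = {}" for u v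
    using that ab by (intro D'(2)) (auto simp: D_def)
  have z: "f (jump x s) = 0" if s: "s \<in> {a<..b} - D" for s
  proof (rule \<eta>(2))
    have "s > 0" using s ab by auto
    from cadlag_left_limit[OF x this] have lim: "((\<lambda>u. \<bar>x s - x u\<bar>) \<longlongrightarrow> \<bar>x s - (x s - jump x s)\<bar>) (at_left s)"
      by (intro tendsto_intros)
    have "closed D" using D(1) by (rule finite_imp_closed)
    then have "open (- D)" by auto
    then obtain e where e: "e > 0" "\<And>y. dist y s < e \<Longrightarrow> y \<notin> D"
      using s unfolding open_dist by (metis ComplD ComplI DiffD2)
    have "\<forall>\<^sub>F u in at_left s. max a (s - e) < u \<and> u < s"
      using e s by (auto simp: eventually_at_left_field intro!: exI[of _ "max a (s - e)"])
    then have "\<forall>\<^sub>F u in at_left s. \<bar>x s - x u\<bar> \<le> \<eta>"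
    proof eventually_elim
      case (elim u)
      show ?case using elim s e(2) by (intro osc) (auto simp: dist_real_def)
    qed
    then show "\<bar>jump x s\<bar> \<le> \<eta>"
      using tendsto_upperbound[OF lim, of \<eta>] by (simp add: trivial_limit_at_left_real)
  qed
  have "jump_sum f x a b = (\<Sum>\<^sub>\<infinity>s\<in>D. f (jump x s))"
    unfolding jump_sum_def by (rule infsum_cong_neutral) (use z D in auto)
  then have "jump_sum f x a b = (\<Sum>s\<in>D. f (jump x s))" using D by simp
  then show ?thesis using D z osc \<eta>(2) by (intro exI[of _ D]) simp
qed

text \<open>Cells that contain no point of \<open>D\<close> contribute 0. Once the mesh is small,
  distinct points of \<open>D\<close> lie in distinct cells, and the increment over the cell around
  \<open>d\<close> tends to the jump at \<open>d\<close>: its left end approaches \<open>d\<close>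
  strictly from below, its right end from above or with equality.\<close>

lemma increment_sum_tendsto:
  assumes x: "cadlag x" and ab: "0 \<le> a" "a \<le> b" and \<eta>: "\<eta> > 0" "\<And>y. \<bar>y\<bar> \<le> \<eta> \<Longrightarrow> f y = 0"
    and f: "\<And>y. isCont f y"
  shows "(\<lambda>n. increment_sum f x a b n) \<longlonglongrightarrow> jump_sum f x a b"
proof (cases "a = b")
  case True
  have "f 0 = 0" using \<eta> by simp
  then show ?thesis using True by (simp add: increment_sum_def jump_sum_def)
next
  case False
  then have ab': "a < b" using ab by simp
  obtain D where D: "finite D" "D \<subseteq> {a<..b}" "\<And>s. s \<in> {a<..b} - D \<Longrightarrow> f (jump x s) = 0"
    "\<And>u v. a \<le> u \<Longrightarrow> u < v \<Longrightarrow> v \<le> b \<Longrightarrow> D \<inter> {u<..v} = {} \<Longrightarrow> f (x v - x u) = 0"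
    "jump_sum f x a b = (\<Sum>s\<in>D. f (jump x s))"
    using jump_sum_finite[where f=f, OF x ab \<eta>] by metis
  define h where "h n = (b - a) / real n" for n
  have h: "h n > 0" if "n > 0" for n using that ab' by (simp add: h_def)
  have hlim: "h \<longlonglongrightarrow> 0" unfolding h_def by real_asymp
  \<comment> \<open>Cells are open on the left and closed on the right, so the index is the ceiling
    minus 1: a point of \<open>D\<close> on the grid belongs to the cell that ends there.\<close>
  define k where "k n d = nat (\<lceil>(d - a) / h n\<rceil> - 1)" for n d
  have k: "a + real (k n d) * h n < d" "d \<le> a + real (Suc (k n d)) * h n" "k n d < n"
    if n: "n > 0" and d: "d \<in> {a<..b}" for n d
  proof -
    have q: "(d - a) / h n > 0" using h[OF n] d by simp
    have c: "\<lceil>(d - a) / h n\<rceil> \<ge> 1" using q by linarith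
    then have kr: "real (k n d) = of_int \<lceil>(d - a) / h n\<rceil> - 1" by (simp add: k_def)
    have "real (k n d) < (d - a) / h n" "(d - a) / h n \<le> real (Suc (k n d))" using kr by linarith+
    then show "a + real (k n d) * h n < d" "d \<le> a + real (Suc (k n d)) * h n"
      using h[OF n] by (simp_all add: pos_less_divide_eq pos_divide_le_eq)
    have "(d - a) / h n \<le> real n" using d n ab' by (simp add: h_def field_simps)
    then show "k n d < n" using \<open>real (k n d) < (d - a) / h n\<close> by linarith
  qed
  have kk: "i = k n d" if n: "n > 0" and d: "d \<in> {a<..b}" and i: "a + real i * h n < d" "d \<le> a + real (Suc i) * h n" for n d i
  proof -
    have "real i * h n < real (Suc (k n d)) * h n" "real (k n d) * h n < real (Suc i) * h n"
      using k[OF n d] i by linarith+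
    then have "i < Suc (k n d)" "k n d < Suc i"
      using h[OF n] by (simp_all only: mult_less_cancel_right_pos of_nat_less_iff)
    then show ?thesis by simp
  qed
  have inj: "\<forall>\<^sub>F n in sequentially. inj_on (k n) D"
  proof -
    have "\<forall>\<^sub>F n in sequentially. d \<noteq> d' \<longrightarrow> k n d \<noteq> k n d'" if "d \<in> D" "d' \<in> D" for d d'
    proof (cases "d = d'")
      case False
      then have "\<forall>\<^sub>F n in sequentially. h n < \<bar>d - d'\<bar>" using hlim by (intro order_tendstoD) auto
      then show ?thesis using eventually_gt_at_top[of 0]
      proof eventually_elim
        case (elim n)
        show ?case
        proof (rule impI, rule notI)
          assume e: "k n d = k n d'"
          have "d \<in> {a<..b}" "d' \<in> {a<..b}" using that D(2) by auto
          note K = k[OF elim(2) this(1)] k[OF elim(2) this(2)]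
          have "\<bar>d - d'\<bar> \<le> h n" using K e by (simp add: algebra_simps abs_le_iff)
          then show False using elim by simp
        qed
      qed
    qed simp
    then have "\<forall>\<^sub>F n in sequentially. \<forall>d\<in>D. \<forall>d'\<in>D. d \<noteq> d' \<longrightarrow> k n d \<noteq> k n d'"
      using D(1) by (intro eventually_ball_finite ballI) auto
    then show ?thesis by eventually_elim (auto simp: inj_on_def)
  qed
  define g where "g n i = f (x (a + real (Suc i) * h n) - x (a + real i * h n))" for n i
  have eq: "\<forall>\<^sub>F n in sequentially. (\<Sum>d\<in>D. g n (k n d)) = increment_sum f x a b n"
    using inj eventually_gt_at_top[of 0]
  proof eventually_elim
    case (elim n)
    have "increment_sum f x a b n = (\<Sum>i<n. g n i)" by (simp add: increment_sum_def g_def h_def)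
    also have "\<dots> = (\<Sum>i\<in>k n ` D. g n i)"
    proof (rule sum.mono_neutral_right)
      show "k n ` D \<subseteq> {..<n}" using k[OF elim(2)] D(2) by auto
      show "\<forall>i\<in>{..<n} - k n ` D. g n i = 0"
      proof
        fix i assume i: "i \<in> {..<n} - k n ` D"
        have le: "a + real (Suc i) * h n \<le> b"
        proof -
          have "real (Suc i) * h n \<le> real n * h n" using i h[OF elim(2)] by (intro mult_right_mono) auto
          also have "\<dots> = b - a" using elim by (simp add: h_def)
          finally show ?thesis by simp
        qed
        have "D \<inter> {a + real i * h n<..a + real (Suc i) * h n} = {}"
          using kk[OF elim(2)] D(2) i by fastforce
        then show "g n i = 0" unfolding g_def using le h[OF elim(2)]
          by (intro D(4)) (auto simp: algebra_simps)
      qed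
    qed simp
    also have "\<dots> = (\<Sum>d\<in>D. g n (k n d))" using elim(1) by (simp add: sum.reindex)
    finally show ?case by simp
  qed
  have "(\<lambda>n. \<Sum>d\<in>D. g n (k n d)) \<longlonglongrightarrow> (\<Sum>d\<in>D. f (jump x d))"
  proof (rule tendsto_sum)
    fix d assume "d \<in> D"
    then have d: "d \<in> {a<..b}" "d > 0" using D(2) ab by auto
    have left: "(\<lambda>n. x (a + real (k n d) * h n)) \<longlonglongrightarrow> x d - jump x d"
    proof (rule filterlim_compose[OF cadlag_left_limit[OF x d(2)]])
      have "(\<lambda>n. d - h n) \<longlonglongrightarrow> d - 0" by (intro tendsto_intros hlim)
      then have l1: "(\<lambda>n. d - h n) \<longlonglongrightarrow> d" by simp
      have "(\<lambda>n. a + real (k n d) * h n) \<longlonglongrightarrow> d"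
      proof (rule tendsto_sandwich[OF _ _ l1 tendsto_const])
        show "\<forall>\<^sub>F n in sequentially. d - h n \<le> a + real (k n d) * h n"
          using eventually_gt_at_top[of 0]
        proof eventually_elim
          case (elim n)
          then show ?case using k(2)[OF elim d(1)] by (simp add: algebra_simps)
        qed
        show "\<forall>\<^sub>F n in sequentially. a + real (k n d) * h n \<le> d"
          using eventually_gt_at_top[of 0]
        proof eventually_elim
          case (elim n)
          then show ?case using k(1)[OF elim d(1)] by simp
        qed
      qed
      moreover have "\<forall>\<^sub>F n in sequentially. a + real (k n d) * h n \<in> {..<d} \<and> a + real (k n d) * h n \<noteq> d"
        using eventually_gt_at_top[of 0]
      proof eventually_elim
        case (elim n)
        then show ?case using k(1)[OF elim d(1)] by simp
      qed
      ultimately show "filterlim (\<lambda>n. a + real (k n d) * h n) (at_left d) sequentially"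
        by (simp add: filterlim_at)
    qed
    have right: "(\<lambda>n. x (a + real (Suc (k n d)) * h n)) \<longlonglongrightarrow> x d"
    proof (rule tendstoI)
      fix e :: real assume e: "e > 0"
      have "(x \<longlongrightarrow> x d) (at_right d)" using x d by (simp add: cadlag_def)
      then have "\<forall>\<^sub>F y in at_right d. dist (x y) (x d) < e" using e by (rule tendstoD)
      then obtain d1 where d1: "d1 > d" "\<And>y. d < y \<Longrightarrow> y < d1 \<Longrightarrow> dist (x y) (x d) < e"
        unfolding eventually_at_right_field by auto
      have "\<forall>\<^sub>F n in sequentially. h n < d1 - d" using hlim d1 by (intro order_tendstoD) auto
      then show "\<forall>\<^sub>F n in sequentially. dist (x (a + real (Suc (k n d)) * h n)) (x d) < e"
        using eventually_gt_at_top[of 0]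
      proof eventually_elim
        case (elim n)
        have "d \<le> a + real (Suc (k n d)) * h n" "a + real (Suc (k n d)) * h n < d1"
          using k[OF elim(2) d(1)] elim by (auto simp: algebra_simps)
        then show ?case using d1(2) e by (cases "a + real (Suc (k n d)) * h n = d") auto
      qed
    qed
    have "(\<lambda>n. x (a + real (Suc (k n d)) * h n) - x (a + real (k n d) * h n)) \<longlonglongrightarrow> x d - (x d - jump x d)"
      by (intro tendsto_diff left right)
    then have "(\<lambda>n. x (a + real (Suc (k n d)) * h n) - x (a + real (k n d) * h n)) \<longlonglongrightarrow> jump x d" by simp
    then show "(\<lambda>n. g n (k n d)) \<longlonglongrightarrow> f (jump x d)"
      unfolding g_def by (rule isCont_tendsto_compose[OF f])
  qed
  then show ?thesis unfolding D(5) using eq by (rule Lim_transform_eventually)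
qed

text \<open>A soft threshold instead of a cut-off: it is continuous, vanishes near 0 and increases
  to the square with \<open>k\<close>.\<close>

definition trunc_square :: "nat \<Rightarrow> real \<Rightarrow> real" where
  "trunc_square k y = max (y\<^sup>2 - 1 / real (Suc k)) 0"

lemma trunc_square_nonneg: "trunc_square k y \<ge> 0" by (simp add: trunc_square_def)

lemma trunc_square_le: "trunc_square k y \<le> y\<^sup>2" by (simp add: trunc_square_def)

lemma trunc_square_vanishing: "\<bar>y\<bar> \<le> sqrt (1 / real (Suc k)) \<Longrightarrow> trunc_square k y = 0"
  unfolding trunc_square_def
  using abs_le_square_iff[of y "sqrt (1 / real (Suc k))"] by simp

lemma isCont_trunc_square: "isCont (trunc_square k) y"
  unfolding trunc_square_def[abs_def] by (intro continuous_intros)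

lemma trunc_square_mono: "k \<le> l \<Longrightarrow> trunc_square k y \<le> trunc_square l y"
  unfolding trunc_square_def by (intro max.mono diff_left_mono divide_left_mono) auto

lemma trunc_square_tendsto: "(\<lambda>k. trunc_square k y) \<longlonglongrightarrow> y\<^sup>2"
proof -
  have "(\<lambda>k. max (y\<^sup>2 - 1 / real (Suc k)) 0) \<longlonglongrightarrow> max (y\<^sup>2 - 0) 0"
    by (intro tendsto_intros LIMSEQ_Suc lim_1_over_n)
  then show ?thesis by (simp add: trunc_square_def)
qed

text \<open>Only finitely many terms of the jump sum are nonzero, so the comparison with an
  arbitrary finite set of times is available before the squared jumps are known to be
  summable.\<close>

lemma jump_sum_trunc_square_ge:
  assumes x: "cadlag x" and ab: "0 \<le> a" "a \<le> b" and F: "finite F" "F \<subseteq> {a<..b}"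
  shows "(\<Sum>s\<in>F. trunc_square k (jump x s)) \<le> jump_sum (trunc_square k) x a b"
proof -
  have "0 < sqrt (1 / real (Suc k))" by simp
  from jump_sum_finite[where f="trunc_square k", OF x ab this trunc_square_vanishing] obtain D where D: "finite D" "D \<subseteq> {a<..b}"
    "\<And>s. s \<in> {a<..b} - D \<Longrightarrow> trunc_square k (jump x s) = 0"
    "jump_sum (trunc_square k) x a b = (\<Sum>s\<in>D. trunc_square k (jump x s))"
    by metis
  have "(\<Sum>s\<in>F. trunc_square k (jump x s)) \<le> (\<Sum>s\<in>F \<union> D. trunc_square k (jump x s))"
    using F D by (intro sum_mono2) (auto simp: trunc_square_nonneg)
  also have "\<dots> = (\<Sum>s\<in>D. trunc_square k (jump x s))"
    using F D by (intro sum.mono_neutral_right) auto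
  finally show ?thesis using D by simp
qed

lemma jump_sum_trunc_square_mono:
  assumes x: "cadlag x" and ab: "0 \<le> a" "a \<le> b" and kl: "k \<le> l"
  shows "jump_sum (trunc_square k) x a b \<le> jump_sum (trunc_square l) x a b"
proof -
  have "0 < sqrt (1 / real (Suc k))" by simp
  from jump_sum_finite[where f="trunc_square k", OF x ab this trunc_square_vanishing] obtain D where D: "finite D" "D \<subseteq> {a<..b}"
    "jump_sum (trunc_square k) x a b = (\<Sum>s\<in>D. trunc_square k (jump x s))"
    by metis
  have "(\<Sum>s\<in>D. trunc_square k (jump x s)) \<le> (\<Sum>s\<in>D. trunc_square l (jump x s))"
    by (intro sum_mono trunc_square_mono kl)
  also have "\<dots> \<le> jump_sum (trunc_square l) x a b"
    by (rule jump_sum_trunc_square_ge[OF x ab D(1,2)])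
  finally show ?thesis using D by simp
qed

lemma summable_squared_jumps:
  assumes x: "cadlag x" and ab: "0 \<le> a" "a \<le> b" and B: "\<And>k. jump_sum (trunc_square k) x a b \<le> B"
  shows "(\<lambda>s. (jump x s)\<^sup>2) summable_on {a<..b}"
proof (rule nonneg_bdd_above_summable_on)
  show "bdd_above (sum (\<lambda>s. (jump x s)\<^sup>2) ` {F. F \<subseteq> {a<..b} \<and> finite F})"
  proof (rule bdd_aboveI2)
    fix F assume F: "F \<in> {F. F \<subseteq> {a<..b} \<and> finite F}"
    have "(\<lambda>k. \<Sum>s\<in>F. trunc_square k (jump x s)) \<longlonglongrightarrow> (\<Sum>s\<in>F. (jump x s)\<^sup>2)"
      by (intro tendsto_sum trunc_square_tendsto)
    moreover have "(\<Sum>s\<in>F. trunc_square k (jump x s)) \<le> B" for k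
      using F jump_sum_trunc_square_ge[OF x ab, of F k] B[of k] by simp
    ultimately show "(\<Sum>s\<in>F. (jump x s)\<^sup>2) \<le> B"
      by (intro LIMSEQ_le_const2) auto
  qed
qed simp

text \<open>Interchange of two limits: a finite set of times nearly exhausts the full sum, and on
  this finite set the truncation may be removed term by term.\<close>

lemma jump_sum_trunc_square_tendsto:
  assumes x: "cadlag x" and ab: "0 \<le> a" "a \<le> b" and S: "(\<lambda>s. (jump x s)\<^sup>2) summable_on {a<..b}"
  shows "(\<lambda>k. jump_sum (trunc_square k) x a b) \<longlonglongrightarrow> jump_sum (\<lambda>y. y\<^sup>2) x a b"
proof (rule LIMSEQ_I)
  fix e :: real assume e: "e > 0"
  have le: "jump_sum (trunc_square k) x a b \<le> jump_sum (\<lambda>y. y\<^sup>2) x a b" for k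
  proof -
    have "0 < sqrt (1 / real (Suc k))" by simp
    from jump_sum_finite[where f="trunc_square k", OF x ab this trunc_square_vanishing] obtain D where D: "finite D" "D \<subseteq> {a<..b}"
      "jump_sum (trunc_square k) x a b = (\<Sum>s\<in>D. trunc_square k (jump x s))"
      by metis
    have "(\<Sum>s\<in>D. trunc_square k (jump x s)) \<le> (\<Sum>s\<in>D. (jump x s)\<^sup>2)"
      by (intro sum_mono trunc_square_le)
    also have "\<dots> \<le> jump_sum (\<lambda>y. y\<^sup>2) x a b"
      unfolding jump_sum_def using D by (intro finite_sum_le_infsum S) auto
    finally show ?thesis using D by simp
  qed
  have "(sum (\<lambda>s. (jump x s)\<^sup>2) \<longlongrightarrow> jump_sum (\<lambda>y. y\<^sup>2) x a b) (finite_subsets_at_top {a<..b})"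
    using has_sum_infsum[OF S] by (simp add: has_sum_def jump_sum_def)
  then have "\<forall>\<^sub>F F in finite_subsets_at_top {a<..b}. jump_sum (\<lambda>y. y\<^sup>2) x a b - e / 2 < (\<Sum>s\<in>F. (jump x s)\<^sup>2)"
    using e by (intro order_tendstoD) auto
  then obtain F where F: "finite F" "F \<subseteq> {a<..b}" "jump_sum (\<lambda>y. y\<^sup>2) x a b - e / 2 < (\<Sum>s\<in>F. (jump x s)\<^sup>2)"
    unfolding eventually_finite_subsets_at_top by blast
  have "(\<lambda>k. \<Sum>s\<in>F. trunc_square k (jump x s)) \<longlonglongrightarrow> (\<Sum>s\<in>F. (jump x s)\<^sup>2)"
    by (intro tendsto_sum trunc_square_tendsto)
  then have "\<forall>\<^sub>F k in sequentially. jump_sum (\<lambda>y. y\<^sup>2) x a b - e / 2 < (\<Sum>s\<in>F. trunc_square k (jump x s))"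
    using F(3) by (intro order_tendstoD)
  then obtain n where n: "\<And>k. k \<ge> n \<Longrightarrow> jump_sum (\<lambda>y. y\<^sup>2) x a b - e / 2 < (\<Sum>s\<in>F. trunc_square k (jump x s))"
    unfolding eventually_sequentially by blast
  show "\<exists>n. \<forall>k\<ge>n. norm (jump_sum (trunc_square k) x a b - jump_sum (\<lambda>y. y\<^sup>2) x a b) < e"
  proof (intro exI[of _ n] allI impI)
    fix k assume "k \<ge> n"
    from n[OF this] jump_sum_trunc_square_ge[OF x ab F(1,2), of k] le[of k] e
    show "norm (jump_sum (trunc_square k) x a b - jump_sum (\<lambda>y. y\<^sup>2) x a b) < e"
      by (simp add: abs_less_iff)
  qed
qed

lemma jump_sum_split:
  assumes "f summable_on {a<..c}" "f = (\<lambda>s. (jump x s)\<^sup>2)" "a \<le> b" "b \<le> c"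
  shows "jump_sum (\<lambda>y. y\<^sup>2) x a c = jump_sum (\<lambda>y. y\<^sup>2) x a b + jump_sum (\<lambda>y. y\<^sup>2) x b c"
proof -
  have "{a<..c} = {a<..b} \<union> {b<..c}" using assms by auto
  moreover have "f summable_on {a<..b}" "f summable_on {b<..c}"
    using assms by (auto intro: summable_on_subset_banach)
  ultimately show ?thesis
    unfolding jump_sum_def using assms(2) by (simp add: infsum_Un_disjoint)
qed

lemma jump_sum_nonneg: "jump_sum (\<lambda>y. y\<^sup>2) x a b \<ge> 0"
  unfolding jump_sum_def by (intro infsum_nonneg) auto

text \<open>Left limits come from monotonicity. For right-continuity, the summable squared jumps
  after \<open>t\<close> are exhausted up to \<open>e / 2\<close> by a finite set \<open>F\<close>,
  and before the first point of \<open>F\<close> only this remainder can have accumulated.\<close>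

lemma cadlag_quad_var_path:
  assumes S: "\<And>t. t \<ge> 0 \<Longrightarrow> (\<lambda>s. (jump x s)\<^sup>2) summable_on {0<..t}" and c: "c \<ge> 0"
  defines "Q \<equiv> (\<lambda>t. c * t + jump_sum (\<lambda>y. y\<^sup>2) x 0 t)"
  shows "mono_on {0..} Q" "cadlag Q"
proof -
  have diff: "Q t - Q s = c * (t - s) + jump_sum (\<lambda>y. y\<^sup>2) x s t" if "0 \<le> s" "s \<le> t" for s t
    unfolding Q_def using jump_sum_split[OF S refl that] that by (simp add: algebra_simps)
  show mono: "mono_on {0..} Q"
  proof (rule mono_onI)
    fix s t :: real assume "s \<in> {0..}" "t \<in> {0..}" "s \<le> t"
    moreover then have "c * (t - s) \<ge> 0" using c by simp
    ultimately show "Q s \<le> Q t" using diff[of s t] jump_sum_nonneg[of x s t] by simp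
  qed
  show "cadlag Q"
    unfolding cadlag_def
  proof (intro conjI allI impI)
    fix t :: real assume t: "t \<ge> 0"
    show "(Q \<longlongrightarrow> Q t) (at_right t)"
    proof (rule tendstoI)
      fix e :: real assume e: "e > 0"
      let ?f = "\<lambda>s. (jump x s)\<^sup>2"
      have S1: "?f summable_on {t<..t+1}" using S[of "t+1"] t by (auto intro: summable_on_subset_banach)
      have "(sum ?f \<longlongrightarrow> infsum ?f {t<..t+1}) (finite_subsets_at_top {t<..t+1})"
        using has_sum_infsum[OF S1] by (simp add: has_sum_def)
      then have "\<forall>\<^sub>F F in finite_subsets_at_top {t<..t+1}. infsum ?f {t<..t+1} - e / 2 < sum ?f F"
        using e by (intro order_tendstoD) auto
      then obtain F where F: "finite F" "F \<subseteq> {t<..t+1}" "infsum ?f {t<..t+1} - e / 2 < sum ?f F"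
        unfolding eventually_finite_subsets_at_top by blast
      \<comment> \<open>The inserted point \<open>t + 1\<close> keeps the minimum defined when
        \<open>F\<close> is empty.\<close>
      define d where "d = Min (insert (t + 1) F)"
      have d: "d > t" "d \<le> t + 1" "\<And>s. s \<in> F \<Longrightarrow> d \<le> s" using F by (auto simp: d_def)
      have tail: "jump_sum (\<lambda>y. y\<^sup>2) x t u < e / 2" if u: "t < u" "u < d" for u
      proof -
        have "{t<..u} \<inter> F = {}" using d(3) u by fastforce
        moreover have Su: "?f summable_on {t<..u}" using S1 u d(2) by (auto intro: summable_on_subset_banach)
        moreover have "?f summable_on F" using F by simp
        ultimately have "infsum ?f ({t<..u} \<union> F) = infsum ?f {t<..u} + sum ?f F"
          using F(1) by (simp add: infsum_Un_disjoint)
        moreover have "infsum ?f ({t<..u} \<union> F) \<le> infsum ?f {t<..t+1}"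
        proof (rule infsum_mono_neutral)
          have sub: "{t<..u} \<union> F \<subseteq> {t<..t+1}" using F(2) u d(2) by auto
          show "?f summable_on {t<..u} \<union> F" by (rule summable_on_subset_banach[OF S1 sub])
          show "?f summable_on {t<..t+1}" by (rule S1)
          show "?f s \<le> 0" if "s \<in> ({t<..u} \<union> F) - {t<..t+1}" for s using that sub by blast
        qed simp_all
        ultimately show ?thesis using F(3) by (simp add: jump_sum_def)
      qed
      have "((\<lambda>u. c * (u - t)) \<longlongrightarrow> c * (t - t)) (at_right t)" by (intro tendsto_intros)
      then have "\<forall>\<^sub>F u in at_right t. c * (u - t) < e / 2" using e by (intro order_tendstoD) auto
      moreover have "\<forall>\<^sub>F u in at_right t. t < u \<and> u < d"
        using d by (auto simp: eventually_at_right_field)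
      ultimately show "\<forall>\<^sub>F u in at_right t. dist (Q u) (Q t) < e"
      proof eventually_elim
        case (elim u)
        have "c * (u - t) \<ge> 0" using c elim by simp
        then show ?case using diff[of t u] tail[of u] elim t jump_sum_nonneg[of x t u]
          by (simp add: dist_real_def)
      qed
    qed
  next
    fix t :: real assume t: "t > 0"
    define l where "l = (SUP s\<in>{0..<t}. Q s)"
    have bdd: "bdd_above (Q ` {0..<t})"
      using t by (intro bdd_aboveI2[of _ _ "Q t"] mono_onD[OF mono]) auto
    show "\<exists>l. (Q \<longlongrightarrow> l) (at_left t)"
    proof (intro exI[of _ l] tendstoI)
      fix e :: real assume e: "e > 0"
      have "\<exists>s\<in>{0..<t}. l - e < Q s"
        unfolding l_def using t e bdd by (subst less_cSUP_iff[symmetric]) auto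
      then obtain s where s: "0 \<le> s" "s < t" "l - e < Q s" by auto
      have "\<forall>\<^sub>F u in at_left t. s < u \<and> u < t" using s by (auto simp: eventually_at_left_field)
      then show "\<forall>\<^sub>F u in at_left t. dist (Q u) l < e"
      proof eventually_elim
        case (elim u)
        have "Q s \<le> Q u" using elim s by (intro mono_onD[OF mono]) auto
        moreover have "Q u \<le> l" unfolding l_def using elim s bdd by (intro cSUP_upper) auto
        ultimately show ?case using s e by (simp add: dist_real_def)
      qed
    qed
  qed
qed

section \<open>Characteristic functions of jump functionals\<close>

lemma sets_borel_half_lines:
  "sets (borel :: real measure) = sigma_sets UNIV (insert UNIV (range (\<lambda>a. {..a})))"
proof -
  have "sets (borel :: real measure) = sigma_sets UNIV (range (\<lambda>a. {..a}))"
    by (subst borel_eq_atMost) simp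
  moreover have "sigma_sets UNIV (insert UNIV (range (\<lambda>a::real. {..a}))) = sigma_sets UNIV (range (\<lambda>a. {..a}))"
    by (intro sigma_sets_eqI) (auto intro: sigma_sets_top)
  ultimately show ?thesis by simp
qed

text \<open>For closed half lines the approximants decrease linearly from 1 to 0 over an interval of
  length \<open>1 / real (Suc m)\<close> to the right of the end point. They let almost sure
  convergence act on probabilities of generating sets.\<close>

lemma half_line_approx:
  assumes "A \<in> insert UNIV (range (\<lambda>a::real. {..a}))"
  shows "\<exists>\<phi> :: nat \<Rightarrow> real \<Rightarrow> real. (\<forall>m. continuous_on UNIV (\<phi> m)) \<and> (\<forall>m y. \<bar>\<phi> m y\<bar> \<le> 1) \<and>
    (\<forall>y. (\<lambda>m. \<phi> m y) \<longlonglongrightarrow> indicat_real A y)"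
proof (cases "A = UNIV")
  case True
  then show ?thesis by (intro exI[of _ "\<lambda>_ _. 1"]) auto
next
  case False
  then obtain a where a: "A = {..a}" using assms by auto
  show ?thesis
  proof (intro exI[of _ "\<lambda>m. cts_step a (a + 1 / real (Suc m))"] conjI allI)
    show "continuous_on UNIV (cts_step a (a + 1 / real (Suc m)))" for m
      by (intro uniformly_continuous_imp_continuous cts_step_uniformly_continuous) simp
    show "\<bar>cts_step a (a + 1 / real (Suc m)) y\<bar> \<le> 1" for m y
      by (auto simp: cts_step_def divide_simps)
    show "(\<lambda>m. cts_step a (a + 1 / real (Suc m)) y) \<longlonglongrightarrow> indicator A y" for y
    proof (cases "y \<le> a")
      case True
      then show ?thesis by (simp add: cts_step_def a)
    next
      case False
      have "(\<lambda>m. 1 / real (Suc m)) \<longlonglongrightarrow> 0" by (rule LIMSEQ_Suc[OF lim_1_over_n])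
      then have "\<forall>\<^sub>F m in sequentially. 1 / real (Suc m) < y - a" using False by (intro order_tendstoD) auto
      then show ?thesis
        by (intro tendsto_eventually) (auto elim!: eventually_mono simp: cts_step_def a False)
    qed
  qed
qed

text \<open>Two successive limits. Product formulas for expectations of bounded continuous functions
  pass from \<open>Z k\<close> to \<open>Y\<close> by dominated convergence; then the continuous
  functions are sent to indicators of half lines, which form an intersection-stable
  generator.\<close>

lemma (in prob_space) indep_vars_limit:
  fixes Z :: "nat \<Rightarrow> 'i \<Rightarrow> 'a \<Rightarrow> real"
  assumes ind: "\<And>k. indep_vars (\<lambda>_. borel) (Z k) I" and fin: "finite I"
    and Y: "\<And>i. i \<in> I \<Longrightarrow> Y i \<in> borel_measurable M"
    and lim: "\<And>i. i \<in> I \<Longrightarrow> AE \<omega> in M. (\<lambda>k. Z k i \<omega>) \<longlonglongrightarrow> Y i \<omega>"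
  shows "indep_vars (\<lambda>_. borel) Y I"
proof (cases "I = {}")
  case True
  then show ?thesis by (simp add: indep_vars_def indep_sets_def)
next
  case False
  let ?E = "insert UNIV (range (\<lambda>a::real. {..a}))"
  have Zm: "Z k i \<in> borel_measurable M" if "i \<in> I" for k i
    using ind[of k] that by (auto simp: indep_vars_def)
  show ?thesis
  proof (subst indep_vars_finite[OF False fin, where E="\<lambda>_. ?E"])
    show "Int_stable ?E"
    proof (rule Int_stableI)
      fix A B :: "real set" assume "A \<in> ?E" "B \<in> ?E"
      moreover have "{..a} \<inter> {..b} = {..min a b}" for a b :: real by auto
      ultimately show "A \<inter> B \<in> ?E" by auto
    qed
    show "\<forall>A\<in>I \<rightarrow> ?E. prob (\<Inter>j\<in>I. Y j -` A j \<inter> space M) = (\<Prod>j\<in>I. prob (Y j -` A j \<inter> space M))"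
    proof
      fix A assume A: "A \<in> I \<rightarrow> ?E"
      then have "\<forall>j\<in>I. \<exists>\<phi>. (\<forall>m. continuous_on UNIV (\<phi> m)) \<and> (\<forall>m y. \<bar>\<phi> m y\<bar> \<le> 1) \<and> (\<forall>y. (\<lambda>m. \<phi> m y) \<longlonglongrightarrow> indicat_real (A j) y)"
        by (intro ballI half_line_approx) auto
      from bchoice[OF this] obtain \<phi> where \<phi>: "\<forall>j\<in>I. (\<forall>m. continuous_on UNIV (\<phi> j m)) \<and> (\<forall>m y. \<bar>\<phi> j m y\<bar> \<le> 1) \<and> (\<forall>y. (\<lambda>m. \<phi> j m y) \<longlonglongrightarrow> indicat_real (A j) y)" ..
      have \<phi>: "\<And>j m. j \<in> I \<Longrightarrow> continuous_on UNIV (\<phi> j m)" "\<And>j m y. j \<in> I \<Longrightarrow> \<bar>\<phi> j m y\<bar> \<le> 1"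
        "\<And>j y. j \<in> I \<Longrightarrow> (\<lambda>m. \<phi> j m y) \<longlonglongrightarrow> indicat_real (A j) y"
        using \<phi> by simp_all
      have \<phi>m: "\<phi> j m \<in> borel_measurable borel" if "j \<in> I" for j m
        using \<phi>(1)[OF that] by (rule borel_measurable_continuous_onI)
      have AA: "A j \<in> sets borel" if "j \<in> I" for j using A that by (auto simp: Pi_def)
      have iY: "(\<lambda>\<omega>. \<phi> j m (Y j \<omega>)) \<in> borel_measurable M" if "j \<in> I" for j m
        using Y[OF that] \<phi>m[OF that] by (rule measurable_compose)
      have iZ: "(\<lambda>\<omega>. \<phi> j m (Z k j \<omega>)) \<in> borel_measurable M" if "j \<in> I" for j m k
        using Zm[OF that] \<phi>m[OF that] by (rule measurable_compose)
      have prod1: "\<bar>\<Prod>j\<in>I. f j\<bar> \<le> 1" if "\<And>j. j \<in> I \<Longrightarrow> \<bar>f j\<bar> \<le> 1" for f :: "'i \<Rightarrow> real"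
        unfolding abs_prod using that by (intro prod_le_1) auto
      have step1: "expectation (\<lambda>\<omega>. \<Prod>j\<in>I. \<phi> j m (Y j \<omega>)) = (\<Prod>j\<in>I. expectation (\<lambda>\<omega>. \<phi> j m (Y j \<omega>)))" for m
      proof (rule LIMSEQ_unique)
        have c: "AE \<omega> in M. (\<lambda>k. \<phi> j m (Z k j \<omega>)) \<longlonglongrightarrow> \<phi> j m (Y j \<omega>)" if "j \<in> I" for j
          using lim[OF that]
        proof eventually_elim
          case (elim \<omega>)
          have "isCont (\<phi> j m) (Y j \<omega>)" using \<phi>(1)[OF that] by (simp add: continuous_on_eq_continuous_at)
          then show ?case using elim by (rule isCont_tendsto_compose)
        qed
        have c': "AE \<omega> in M. \<forall>j\<in>I. (\<lambda>k. \<phi> j m (Z k j \<omega>)) \<longlonglongrightarrow> \<phi> j m (Y j \<omega>)"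
          using c fin by (intro AE_ball_countable[THEN iffD2] countable_finite) auto
        show "(\<lambda>k. expectation (\<lambda>\<omega>. \<Prod>j\<in>I. \<phi> j m (Z k j \<omega>))) \<longlonglongrightarrow> expectation (\<lambda>\<omega>. \<Prod>j\<in>I. \<phi> j m (Y j \<omega>))"
        proof (rule integral_dominated_convergence[where w="\<lambda>_. 1"])
          show "AE \<omega> in M. (\<lambda>k. \<Prod>j\<in>I. \<phi> j m (Z k j \<omega>)) \<longlonglongrightarrow> (\<Prod>j\<in>I. \<phi> j m (Y j \<omega>))"
            using c' by eventually_elim (intro tendsto_prod, auto)
          show "AE \<omega> in M. norm (\<Prod>j\<in>I. \<phi> j m (Z k j \<omega>)) \<le> 1" for k
            using prod1 \<phi>(2) by simp
        qed (use iY iZ in \<open>auto intro!: borel_measurable_prod\<close>)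
        have "(\<lambda>k. \<Prod>j\<in>I. expectation (\<lambda>\<omega>. \<phi> j m (Z k j \<omega>))) \<longlonglongrightarrow> (\<Prod>j\<in>I. expectation (\<lambda>\<omega>. \<phi> j m (Y j \<omega>)))"
        proof (rule tendsto_prod)
          fix j assume j: "j \<in> I"
          show "(\<lambda>k. expectation (\<lambda>\<omega>. \<phi> j m (Z k j \<omega>))) \<longlonglongrightarrow> expectation (\<lambda>\<omega>. \<phi> j m (Y j \<omega>))"
            by (rule integral_dominated_convergence[where w="\<lambda>_. 1"]) (use iY iZ c \<phi>(2) j in auto)
        qed
        moreover have "(\<Prod>j\<in>I. expectation (\<lambda>\<omega>. \<phi> j m (Z k j \<omega>))) = expectation (\<lambda>\<omega>. \<Prod>j\<in>I. \<phi> j m (Z k j \<omega>))" for k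
        proof (rule indep_vars_lebesgue_integral[symmetric, OF fin])
          show "indep_vars (\<lambda>_. borel) (\<lambda>j \<omega>. \<phi> j m (Z k j \<omega>)) I"
            by (rule indep_vars_compose2[OF ind]) (use \<phi>m in auto)
          show "integrable M (\<lambda>\<omega>. \<phi> j m (Z k j \<omega>))" if "j \<in> I" for j
            by (rule integrable_const_bound[of _ 1]) (use iZ \<phi>(2) that in auto)
        qed
        ultimately show "(\<lambda>k. expectation (\<lambda>\<omega>. \<Prod>j\<in>I. \<phi> j m (Z k j \<omega>))) \<longlonglongrightarrow> (\<Prod>j\<in>I. expectation (\<lambda>\<omega>. \<phi> j m (Y j \<omega>)))"
          by simp
      qed
      have iA: "(\<lambda>\<omega>. indicat_real (A j) (Y j \<omega>)) \<in> borel_measurable M" if "j \<in> I" for j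
        using Y[OF that] AA[OF that] by measurable
      have "expectation (\<lambda>\<omega>. \<Prod>j\<in>I. indicat_real (A j) (Y j \<omega>)) = (\<Prod>j\<in>I. expectation (\<lambda>\<omega>. indicat_real (A j) (Y j \<omega>)))"
      proof (rule LIMSEQ_unique)
        show "(\<lambda>m. expectation (\<lambda>\<omega>. \<Prod>j\<in>I. \<phi> j m (Y j \<omega>))) \<longlonglongrightarrow> expectation (\<lambda>\<omega>. \<Prod>j\<in>I. indicat_real (A j) (Y j \<omega>))"
        proof (rule integral_dominated_convergence[where w="\<lambda>_. 1"])
          show "AE \<omega> in M. (\<lambda>m. \<Prod>j\<in>I. \<phi> j m (Y j \<omega>)) \<longlonglongrightarrow> (\<Prod>j\<in>I. indicat_real (A j) (Y j \<omega>))"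
            using \<phi>(3) by (intro AE_I2 tendsto_prod)
          show "AE \<omega> in M. norm (\<Prod>j\<in>I. \<phi> j m (Y j \<omega>)) \<le> 1" for m
            using prod1 \<phi>(2) by simp
        qed (use iY iA in \<open>auto intro!: borel_measurable_prod\<close>)
        show "(\<lambda>m. expectation (\<lambda>\<omega>. \<Prod>j\<in>I. \<phi> j m (Y j \<omega>))) \<longlonglongrightarrow> (\<Prod>j\<in>I. expectation (\<lambda>\<omega>. indicat_real (A j) (Y j \<omega>)))"
          unfolding step1
        proof (rule tendsto_prod)
          fix j assume j: "j \<in> I"
          show "(\<lambda>m. expectation (\<lambda>\<omega>. \<phi> j m (Y j \<omega>))) \<longlonglongrightarrow> expectation (\<lambda>\<omega>. indicat_real (A j) (Y j \<omega>))"
            by (rule integral_dominated_convergence[where w="\<lambda>_. 1"]) (use iY iA \<phi>(2,3) j in auto)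
        qed
      qed
      moreover have "expectation (\<lambda>\<omega>. indicat_real (A j) (Y j \<omega>)) = prob (Y j -` A j \<inter> space M)" if "j \<in> I" for j
      proof -
        have "expectation (\<lambda>\<omega>. indicat_real (A j) (Y j \<omega>)) = expectation (indicator (Y j -` A j \<inter> space M))"
          by (rule Bochner_Integration.integral_cong) (auto simp: indicator_def)
        then show ?thesis using measurable_sets[OF Y[OF that] AA[OF that]] by simp
      qed
      moreover have "expectation (\<lambda>\<omega>. \<Prod>j\<in>I. indicat_real (A j) (Y j \<omega>)) = prob (\<Inter>j\<in>I. Y j -` A j \<inter> space M)"
      proof -
        have "(\<Prod>j\<in>I. indicat_real (A j) (Y j \<omega>)) = indicator (\<Inter>j\<in>I. Y j -` A j \<inter> space M) \<omega>" if "\<omega> \<in> space M" for \<omega>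
          using that fin False by (auto simp: indicator_def prod_zero_iff)
        then have "expectation (\<lambda>\<omega>. \<Prod>j\<in>I. indicat_real (A j) (Y j \<omega>)) = expectation (indicator (\<Inter>j\<in>I. Y j -` A j \<inter> space M))"
          by (rule Bochner_Integration.integral_cong[OF refl])
        moreover have "(\<Inter>j\<in>I. Y j -` A j \<inter> space M) \<in> events"
          using measurable_sets[OF Y AA] fin False by (intro sets.finite_INT) auto
        ultimately show ?thesis by simp
      qed
      ultimately show "prob (\<Inter>j\<in>I. Y j -` A j \<inter> space M) = (\<Prod>j\<in>I. prob (Y j -` A j \<inter> space M))"
        by simp
    qed
  qed (use Y in \<open>auto simp: sets_borel_half_lines\<close>)
qed

text \<open>The comparison sequence \<open>exp (a / n)\<close> has exact n-th power
  \<open>exp a\<close> and satisfies the same first-order limit. As both bases lie in the unit disc,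
  which for the comparison sequence uses \<open>Re a \<le> 0\<close>, the difference of the powers
  is at most n times the difference of the bases.\<close>

lemma power_tendsto_exp:
  fixes z :: "nat \<Rightarrow> complex"
  assumes z: "\<And>n. norm (z n) \<le> 1" and lim: "(\<lambda>n. of_nat n * (z n - 1)) \<longlonglongrightarrow> a" and a: "Re a \<le> 0"
  shows "(\<lambda>n. z n ^ n) \<longlonglongrightarrow> exp a"
proof -
  define w where "w n = exp (a / of_nat n)" for n :: nat
  have w: "norm (w n) \<le> 1" for n
    using a by (simp add: w_def divide_nonpos_nonneg)
  have wn: "\<forall>\<^sub>F n in sequentially. w n ^ n = exp a"
    using eventually_gt_at_top[of 0] by eventually_elim (simp add: w_def exp_of_nat_mult[symmetric])
  have "((\<lambda>h. (exp (h * a) - 1) / h) \<longlongrightarrow> a) (at 0)"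
  proof -
    have "((\<lambda>h. exp (h * a)) has_field_derivative a) (at 0)"
      by (auto intro!: derivative_eq_intros)
    then show ?thesis by (simp add: has_field_derivative_iff)
  qed
  moreover have "filterlim (\<lambda>n. 1 / of_nat n :: complex) (at 0) sequentially"
  proof -
    have "(\<lambda>n. 1 / of_nat n :: complex) \<longlonglongrightarrow> 0" by (rule lim_1_over_n)
    moreover have "\<forall>\<^sub>F n in sequentially. (1 / of_nat n :: complex) \<noteq> 0"
      using eventually_gt_at_top[of 0] by eventually_elim simp
    ultimately show ?thesis by (simp add: filterlim_at)
  qed
  ultimately have "(\<lambda>n. (exp (1 / of_nat n * a) - 1) / (1 / of_nat n)) \<longlonglongrightarrow> a"
    by (rule filterlim_compose)
  then have wl: "(\<lambda>n. of_nat n * (w n - 1)) \<longlonglongrightarrow> a"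
    by (simp add: w_def mult.commute)
  have "(\<lambda>n. norm (of_nat n * (z n - 1) - of_nat n * (w n - 1))) \<longlonglongrightarrow> norm (a - a)"
    by (intro tendsto_norm tendsto_diff lim wl)
  then have 0: "(\<lambda>n. norm (of_nat n * (z n - 1) - of_nat n * (w n - 1))) \<longlonglongrightarrow> 0" by simp
  have "(\<lambda>n. z n ^ n - w n ^ n) \<longlonglongrightarrow> 0"
  proof (rule Lim_null_comparison[OF always_eventually 0], rule allI)
    fix n
    have "norm (z n ^ n - w n ^ n) \<le> real n * norm (z n - w n)" by (rule norm_power_diff[OF z w])
    also have "\<dots> = norm (of_nat n * (z n - w n))" by (simp add: norm_mult)
    also have "of_nat n * (z n - w n) = of_nat n * (z n - 1) - of_nat n * (w n - 1)" by (simp add: algebra_simps)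
    finally show "norm (z n ^ n - w n ^ n) \<le> norm (of_nat n * (z n - 1) - of_nat n * (w n - 1))" .
  qed
  then have "(\<lambda>n. (z n ^ n - w n ^ n) + w n ^ n) \<longlonglongrightarrow> 0 + exp a"
    by (intro tendsto_add tendsto_eventually[OF wn])
  then show ?thesis by simp
qed

text \<open>Fixing one measurable set \<open>\<Omega>\<close> of full measure turns the almost sure
  path property into one that holds at every point of a set usable in definitions.\<close>

locale levy_path = prob_space M + levy_data v b N
  for M :: "'a measure" and v b :: real and N :: "real measure" +
  fixes X :: "real \<Rightarrow> 'a \<Rightarrow> real" and \<Omega> :: "'a set"
  assumes levy: "levy_process M X"
    and char_X: "\<And>t u. t \<ge> 0 \<Longrightarrow> char (distr M borel (X t)) u = exp (of_real t * levy_exponent v b N u)"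
    and mass: "\<And>\<epsilon>. 0 < \<epsilon> \<Longrightarrow> measure N {x. \<bar>x\<bar> > \<epsilon>} > 0"
    and \<Omega>_sets[measurable]: "\<Omega> \<in> sets M" and AE_\<Omega>: "AE \<omega> in M. \<omega> \<in> \<Omega>"
    and cadlag_\<Omega>: "\<And>\<omega>. \<omega> \<in> \<Omega> \<Longrightarrow> cadlag (\<lambda>t. X t \<omega>)"
begin

lemma X_measurable: "t \<ge> 0 \<Longrightarrow> X t \<in> borel_measurable M"
  using levy by (simp add: levy_process_def)

lemma indep_increments:
  assumes "0 \<le> \<tau> 0" "mono \<tau>"
  shows "indep_vars (\<lambda>_. borel) (\<lambda>i \<omega>. X (\<tau> (Suc i)) \<omega> - X (\<tau> i) \<omega>) {..<n::nat}"
  using levy assms unfolding levy_process_def by blast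

lemma distr_increment:
  "0 \<le> s \<Longrightarrow> s \<le> t \<Longrightarrow> distr M borel (\<lambda>\<omega>. X t \<omega> - X s \<omega>) = distr M borel (X (t - s))"
proof -
  assume st: "0 \<le> s" "s \<le> t"
  have "\<forall>s\<ge>0. \<forall>t\<ge>0. distr M borel (\<lambda>\<omega>. X (s + t) \<omega> - X s \<omega>) = distr M borel (X t)"
    using levy by (simp add: levy_process_def)
  from this[rule_format, of s "t - s"] st show ?thesis by simp
qed

lemma real_distribution_X: "t \<ge> 0 \<Longrightarrow> real_distribution (distr M borel (X t))"
  by (intro real_distribution_distr X_measurable)

lemma increment_sum_measurable:
  assumes "0 \<le> s" "s \<le> t" and [measurable]: "f \<in> borel_measurable borel"
  shows "(\<lambda>\<omega>. increment_sum f (\<lambda>r. X r \<omega>) s t n) \<in> borel_measurable M"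
proof -
  have [measurable]: "X (s + real i * ((t - s) / real n)) \<in> borel_measurable M" for i
    using assms by (intro X_measurable) auto
  show ?thesis unfolding increment_sum_def by measurable
qed

text \<open>Independence turns the exponential of the sum into a product and stationarity makes its
  factors equal. A complex \<open>c\<close> covers imaginary values, for characteristic functions,
  and negative real ones, for Laplace transforms; the condition on the real part keeps the integrand
  in the unit disc.\<close>

lemma expectation_increment_sum:
  fixes c :: complex
  assumes st: "0 \<le> s" "s \<le> t" and [measurable]: "f \<in> borel_measurable borel"
    and c: "\<And>y. Re (c * of_real (f y)) \<le> 0"
  shows "(CLINT \<omega>|M. exp (c * of_real (increment_sum f (\<lambda>r. X r \<omega>) s t n)))
    = (CLINT x|distr M borel (X ((t - s) / real n)). exp (c * of_real (f x))) ^ n"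
proof -
  define h where "h = (t - s) / real n"
  define \<tau> where "\<tau> i = s + real i * h" for i
  have h: "h \<ge> 0" using st by (simp add: h_def)
  have \<tau>: "\<tau> 0 \<ge> 0" "mono \<tau>" "\<And>i. \<tau> i \<ge> 0" "\<And>i. \<tau> i \<le> \<tau> (Suc i)" "\<And>i. \<tau> (Suc i) - \<tau> i = h"
    using st h by (auto simp: \<tau>_def mono_iff_le_Suc algebra_simps)
  have [measurable]: "X (\<tau> i) \<in> borel_measurable M" for i using \<tau>(3) by (rule X_measurable)
  have eq: "exp (c * of_real (increment_sum f (\<lambda>r. X r \<omega>) s t n)) = (\<Prod>i<n. exp (c * of_real (f (X (\<tau> (Suc i)) \<omega> - X (\<tau> i) \<omega>))))" for \<omega>
    unfolding increment_sum_def h_def[symmetric] \<tau>_def[symmetric] by (simp add: sum_distrib_left exp_sum)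
  have "(CLINT \<omega>|M. exp (c * of_real (increment_sum f (\<lambda>r. X r \<omega>) s t n)))
     = (\<Prod>i<n. CLINT \<omega>|M. exp (c * of_real (f (X (\<tau> (Suc i)) \<omega> - X (\<tau> i) \<omega>))))"
    unfolding eq
  proof (rule indep_vars_lebesgue_integral)
    show "indep_vars (\<lambda>_. borel) (\<lambda>i \<omega>. exp (c * of_real (f (X (\<tau> (Suc i)) \<omega> - X (\<tau> i) \<omega>)))) {..<n}"
      by (rule indep_vars_compose2[OF indep_increments[OF \<tau>(1,2)], where Y="\<lambda>_ y. exp (c * of_real (f y))"]) measurable
    show "complex_integrable M (\<lambda>\<omega>. exp (c * of_real (f (X (\<tau> (Suc i)) \<omega> - X (\<tau> i) \<omega>))))" for i
      by (rule integrable_const_bound[of _ 1]) (use c in auto)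
  qed simp
  also have "\<dots> = (\<Prod>i<n. CLINT x|distr M borel (X h). exp (c * of_real (f x)))"
  proof (rule prod.cong[OF refl])
    fix i
    have "(CLINT x|distr M borel (\<lambda>\<omega>. X (\<tau> (Suc i)) \<omega> - X (\<tau> i) \<omega>). exp (c * of_real (f x))) = (CLINT \<omega>|M. exp (c * of_real (f (X (\<tau> (Suc i)) \<omega> - X (\<tau> i) \<omega>))))"
      by (rule integral_distr) auto
    then show "(CLINT \<omega>|M. exp (c * of_real (f (X (\<tau> (Suc i)) \<omega> - X (\<tau> i) \<omega>)))) = (CLINT x|distr M borel (X h). exp (c * of_real (f x)))"
      using distr_increment[OF \<tau>(3) \<tau>(4), of i] \<tau>(5) by simp
  qed
  finally show ?thesis by (simp add: h_def)
qed

text \<open>Since \<open>exp (c f) - 1\<close> vanishes near 0, the small-time limit applies to it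
  and supplies the first-order limit required by \<open>power_tendsto_exp\<close>.\<close>

lemma expectation_increment_sum_tendsto:
  fixes c :: complex
  assumes st: "0 \<le> s" "s \<le> t" and f: "\<And>y. isCont f y" and \<eta>: "\<eta> > 0" "\<And>y. \<bar>y\<bar> \<le> \<eta> \<Longrightarrow> f y = 0"
    and c: "\<And>y. Re (c * of_real (f y)) \<le> 0"
  shows "(\<lambda>n. CLINT \<omega>|M. exp (c * of_real (increment_sum f (\<lambda>r. X r \<omega>) s t n)))
    \<longlonglongrightarrow> exp (of_real (t - s) * (CLINT x|N. exp (c * of_real (f x)) - 1))"
proof (cases "s = t")
  case True
  have "f 0 = 0" using \<eta> by simp
  then show ?thesis using True prob_space by (simp add: increment_sum_def)
next
  case False
  define T where "T = t - s"
  have T: "T > 0" using False st by (simp add: T_def)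
  have fc: "continuous_on UNIV f" using f by (simp add: continuous_on_eq_continuous_at)
  have [measurable]: "f \<in> borel_measurable borel" using fc by (rule borel_measurable_continuous_onI)
  define F where "F x = exp (c * of_real (f x)) - 1" for x
  define I where "I = (CLINT x|N. F x)"
  have nF: "norm (exp (c * of_real (f x))) \<le> 1" for x using c by simp
  have F2: "norm (F x) \<le> 2" for x
    unfolding F_def using norm_triangle_ineq4[of "exp (c * of_real (f x))" 1] nF[of x] unfolding norm_one by linarith
  have Fm[measurable]: "F \<in> borel_measurable borel" unfolding F_def[abs_def] by measurable
  have Fc: "continuous_on UNIV F" unfolding F_def[abs_def] by (intro continuous_intros fc)
  have F0: "F x = 0" if "\<bar>x\<bar> \<le> \<eta>" for x using \<eta>(2)[OF that] by (simp add: F_def)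
  have iF: "complex_integrable N F"
    by (rule integrable_bigI[OF Fm \<eta>(1) F0 F2])
  have "Re I = (LINT x|N. Re (F x))" unfolding I_def using iF by simp
  moreover have "Re (F x) \<le> 0" for x
  proof -
    have "Re (exp (c * of_real (f x))) \<le> 1"
      using complex_Re_le_cmod nF by (rule order_trans)
    then show ?thesis by (simp add: F_def)
  qed
  ultimately have ReI: "Re I \<le> 0"
    by (simp del: integral_Re add: Bochner_Integration.integral_nonneg[where f="\<lambda>x. - Re (F x)", simplified])
  have lim: "((\<lambda>t. of_real (1 / t) * (CLINT x|distr M borel (X t). F x)) \<longlongrightarrow> I) (at_right 0)"
    unfolding I_def
    by (rule tendsto_jump_integral[OF mass _ _ Fc F0 \<eta>(1) F2]) (auto simp: real_distribution_X char_X)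
  define z where "z n = (CLINT x|distr M borel (X (T / real n)). exp (c * of_real (f x)))" for n
  have z1: "norm (z n) \<le> 1" for n
  proof -
    interpret D: real_distribution "distr M borel (X (T / real n))" by (rule real_distribution_X) (use T in simp)
    have "norm (z n) \<le> (LINT x|distr M borel (X (T / real n)). norm (exp (c * of_real (f x))))"
      unfolding z_def by (rule integral_norm_bound)
    also have "\<dots> \<le> (LINT x|distr M borel (X (T / real n)). 1)"
      by (intro integral_mono D.integrable_const_bound[of _ 1]) (use c in auto)
    also have "\<dots> = 1" using D.prob_space by simp
    finally show ?thesis .
  qed
  have "filterlim (\<lambda>n. T / real n) (at_right 0) sequentially"
    using T by real_asymp
  from filterlim_compose[OF lim this]
  have "(\<lambda>n. of_real T * (of_real (1 / (T / real n)) * (CLINT x|distr M borel (X (T / real n)). F x))) \<longlonglongrightarrow> of_real T * I"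
    by (intro tendsto_intros)
  then have "(\<lambda>n. of_nat n * (z n - 1)) \<longlonglongrightarrow> of_real T * I"
  proof (rule Lim_transform_eventually)
    show "\<forall>\<^sub>F n in sequentially. of_real T * (of_real (1 / (T / real n)) * (CLINT x|distr M borel (X (T / real n)). F x)) = of_nat n * (z n - 1)"
      using eventually_gt_at_top[of 0]
    proof eventually_elim
      case (elim n)
      interpret D: real_distribution "distr M borel (X (T / real n))" by (rule real_distribution_X) (use T in simp)
      have "complex_integrable (distr M borel (X (T / real n))) (\<lambda>x. exp (c * of_real (f x)))"
        by (rule D.integrable_const_bound[of _ 1]) (use c in auto)
      then have "(CLINT x|distr M borel (X (T / real n)). F x) = z n - 1"
        unfolding F_def z_def using D.prob_space by simp
      then show ?case using T elim by simp
    qed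
  qed
  then have "(\<lambda>n. z n ^ n) \<longlonglongrightarrow> exp (of_real T * I)"
    using ReI T by (intro power_tendsto_exp z1) (auto simp: mult_nonneg_nonpos)
  then show ?thesis
    unfolding expectation_increment_sum[OF st \<open>f \<in> borel_measurable borel\<close> c] z_def T_def I_def F_def .
qed

text \<open>The value \<open>0\<close> off \<open>\<Omega>\<close> makes the functional measurable, since \<open>M\<close> need not be complete.\<close>

definition jumps :: "(real \<Rightarrow> real) \<Rightarrow> real \<Rightarrow> real \<Rightarrow> 'a \<Rightarrow> real" where
  "jumps f s t \<omega> = (if \<omega> \<in> \<Omega> then jump_sum f (\<lambda>r. X r \<omega>) s t else 0)"

context
  fixes f :: "real \<Rightarrow> real" and \<eta> :: real
  assumes f: "\<And>y. isCont f y" and \<eta>: "\<eta> > 0" "\<And>y. \<bar>y\<bar> \<le> \<eta> \<Longrightarrow> f y = 0"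
begin

lemma borel_measurable_isCont: "f \<in> borel_measurable borel"
  using f by (intro borel_measurable_continuous_onI) (simp add: continuous_on_eq_continuous_at)

lemma jumps_limit:
  assumes "0 \<le> s" "s \<le> t" "\<omega> \<in> \<Omega>"
  shows "(\<lambda>n. increment_sum f (\<lambda>r. X r \<omega>) s t n) \<longlonglongrightarrow> jumps f s t \<omega>"
  using increment_sum_tendsto[OF cadlag_\<Omega>[OF assms(3)] assms(1,2) \<eta> f] assms by (simp add: jumps_def)

text \<open>A sum over uncountably many times is measurable here as a limit of increment sums along
  grids. Multiplication by the indicator of \<open>\<Omega>\<close> makes the convergence hold at
  every point.\<close>

lemma jumps_measurable:
  assumes st: "0 \<le> s" "s \<le> t"
  shows "jumps f s t \<in> borel_measurable M"
proof (rule borel_measurable_LIMSEQ_real)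
  note increment_sum_measurable[OF st borel_measurable_isCont, measurable]
  show "(\<lambda>\<omega>. indicator \<Omega> \<omega> * increment_sum f (\<lambda>r. X r \<omega>) s t n) \<in> borel_measurable M" for n
    by measurable
  show "(\<lambda>n. indicator \<Omega> \<omega> * increment_sum f (\<lambda>r. X r \<omega>) s t n) \<longlonglongrightarrow> jumps f s t \<omega>" for \<omega>
    using jumps_limit[OF st, of \<omega>] by (cases "\<omega> \<in> \<Omega>") (auto simp: jumps_def)
qed

lemma expectation_jumps:
  fixes c :: complex
  assumes st: "0 \<le> s" "s \<le> t" and c: "\<And>y. Re (c * of_real (f y)) \<le> 0"
  shows "(CLINT \<omega>|M. exp (c * of_real (jumps f s t \<omega>))) = exp (of_real (t - s) * (CLINT x|N. exp (c * of_real (f x)) - 1))"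
proof (rule LIMSEQ_unique)
  note [measurable] = increment_sum_measurable[OF st borel_measurable_isCont] jumps_measurable[OF st]
  have "Re c * increment_sum f (\<lambda>r. X r \<omega>) s t n \<le> 0" for \<omega> n
  proof -
    have "Re c * increment_sum f (\<lambda>r. X r \<omega>) s t n = (\<Sum>i<n. Re c * f (X (s + real (Suc i) * ((t - s) / real n)) \<omega> - X (s + real i * ((t - s) / real n)) \<omega>))"
      unfolding increment_sum_def by (rule sum_distrib_left)
    also have "\<dots> \<le> 0" using c by (intro sum_nonpos) simp
    finally show ?thesis .
  qed
  then have b: "norm (exp (c * of_real (increment_sum f (\<lambda>r. X r \<omega>) s t n))) \<le> 1" for \<omega> n by simp
  show "(\<lambda>n. CLINT \<omega>|M. exp (c * of_real (increment_sum f (\<lambda>r. X r \<omega>) s t n))) \<longlonglongrightarrow> (CLINT \<omega>|M. exp (c * of_real (jumps f s t \<omega>)))"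
  proof (rule integral_dominated_convergence[where w="\<lambda>_. 1"])
    show "AE \<omega> in M. (\<lambda>n. exp (c * of_real (increment_sum f (\<lambda>r. X r \<omega>) s t n))) \<longlonglongrightarrow> exp (c * of_real (jumps f s t \<omega>))"
      using AE_\<Omega> by eventually_elim (intro tendsto_intros jumps_limit st)
  qed (use b in auto)
  show "(\<lambda>n. CLINT \<omega>|M. exp (c * of_real (increment_sum f (\<lambda>r. X r \<omega>) s t n)))
    \<longlonglongrightarrow> exp (of_real (t - s) * (CLINT x|N. exp (c * of_real (f x)) - 1))"
    by (rule expectation_increment_sum_tendsto[OF st f \<eta> c])
qed

end

end

section \<open>The quadratic variation as a subordinator\<close>

context levy_path
begin

lemma trunc_jumps_measurable:
  "0 \<le> s \<Longrightarrow> s \<le> t \<Longrightarrow> jumps (trunc_square k) s t \<in> borel_measurable M"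
  by (rule jumps_measurable[OF isCont_trunc_square _ trunc_square_vanishing]) auto

lemma trunc_jumps_mono:
  assumes "0 \<le> s" "s \<le> t" "k \<le> l"
  shows "jumps (trunc_square k) s t \<omega> \<le> jumps (trunc_square l) s t \<omega>"
  using jump_sum_trunc_square_mono[OF cadlag_\<Omega> assms] by (simp add: jumps_def)

lemma trunc_jumps_nonneg:
  assumes "0 \<le> s" "s \<le> t"
  shows "0 \<le> jumps (trunc_square k) s t \<omega>"
  using jump_sum_trunc_square_ge[OF cadlag_\<Omega> assms, of \<omega> "{}" k] by (simp add: jumps_def)

lemma expectation_trunc_jumps:
  fixes c :: complex
  assumes "0 \<le> s" "s \<le> t" "Re c \<le> 0"
  shows "(CLINT \<omega>|M. exp (c * of_real (jumps (trunc_square k) s t \<omega>)))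
    = exp (of_real (t - s) * (CLINT x|N. exp (c * of_real (trunc_square k x)) - 1))"
  by (rule expectation_jumps[OF isCont_trunc_square _ trunc_square_vanishing assms(1,2)])
     (use assms(3) trunc_square_nonneg in \<open>auto simp: mult_nonpos_nonneg\<close>)

lemma integrable_min_scaled:
  assumes "a \<ge> 0"
  shows "integrable N (\<lambda>x. min 1 (a * x\<^sup>2))"
proof (rule Bochner_Integration.integrable_bound)
  show "integrable N (\<lambda>x. (1 + a) * min 1 (x\<^sup>2))" by (intro integrable_mult_right integrable_min)
  have "min 1 (a * y) \<le> (1 + a) * min 1 y" if "y \<ge> 0" for y
    using assms that by (cases "y \<le> 1") (auto simp: min_def algebra_simps)
  then show "AE x in N. norm (min 1 (a * x\<^sup>2)) \<le> norm ((1 + a) * min 1 (x\<^sup>2))"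
    using assms by (intro AE_I2) (auto simp: abs_mult)
qed measurable

text \<open>The inequality \<open>1 - exp (- y) \<le> min 1 y\<close>, combined with
  \<open>trunc_square k x \<le> x\<^sup>2\<close>, bounds the exponent by a quantity free of
  \<open>k\<close>.\<close>

lemma laplace_trunc_jumps:
  assumes t: "0 \<le> t" and l: "a \<ge> 0"
  shows "exp (- (t * (LINT x|N. min 1 (a * x\<^sup>2)))) \<le> (LINT \<omega>|M. exp (- (a * jumps (trunc_square k) 0 t \<omega>)))"
proof -
  let ?f = "trunc_square k"
  have f[measurable]: "?f \<in> borel_measurable borel" unfolding trunc_square_def[abs_def] by measurable
  have e1: "exp (- of_real a * of_real y) = (of_real (exp (- (a * y))) :: complex)" for y
    by (simp flip: of_real_mult of_real_minus exp_of_real)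
  have e2: "exp (- of_real a * of_real y) - 1 = (of_real (exp (- (a * y)) - 1) :: complex)" for y
    unfolding e1 by simp
  have "of_real (LINT \<omega>|M. exp (- (a * jumps ?f 0 t \<omega>))) = (CLINT \<omega>|M. exp (- of_real a * of_real (jumps ?f 0 t \<omega>)))"
    unfolding e1 by simp
  also have "\<dots> = exp (of_real (t - 0) * (CLINT x|N. exp (- of_real a * of_real (?f x)) - 1))"
    using l t by (intro expectation_trunc_jumps) auto
  also have "\<dots> = of_real (exp (t * (LINT x|N. exp (- (a * ?f x)) - 1)))"
    unfolding e2 integral_complex_of_real by (simp flip: exp_of_real)
  finally have eq: "(LINT \<omega>|M. exp (- (a * jumps ?f 0 t \<omega>))) = exp (t * (LINT x|N. exp (- (a * ?f x)) - 1))"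
    by (simp only: of_real_eq_iff)
  have b: "- min 1 (a * x\<^sup>2) \<le> exp (- (a * ?f x)) - 1" "exp (- (a * ?f x)) - 1 \<le> 0" for x
  proof -
    have 1: "0 \<le> a * ?f x" "a * ?f x \<le> a * x\<^sup>2"
      using l trunc_square_nonneg trunc_square_le by (auto intro: mult_left_mono)
    have 2: "1 + - (a * ?f x) \<le> exp (- (a * ?f x))" by (rule exp_ge_add_one_self)
    have 3: "0 < exp (- (a * ?f x))" by simp
    show "- min 1 (a * x\<^sup>2) \<le> exp (- (a * ?f x)) - 1"
      using 1 2 3 unfolding min_def by (simp split: if_splits)
    show "exp (- (a * ?f x)) - 1 \<le> 0" using 1(1) by simp
  qed
  have i: "integrable N (\<lambda>x. exp (- (a * ?f x)) - 1)"
  proof (rule Bochner_Integration.integrable_bound[OF integrable_min_scaled[OF l]])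
    show "AE x in N. norm (exp (- (a * ?f x)) - 1) \<le> norm (min 1 (a * x\<^sup>2))"
    proof (rule AE_I2)
      fix x
      have "0 \<le> a * x\<^sup>2" using l by simp
      then show "norm (exp (- (a * ?f x)) - 1) \<le> norm (min 1 (a * x\<^sup>2))"
        using b[of x] by (simp add: abs_le_iff min_def split: if_splits)
    qed
  qed measurable
  have "(LINT x|N. - min 1 (a * x\<^sup>2)) \<le> (LINT x|N. exp (- (a * ?f x)) - 1)"
    by (intro integral_mono i) (use integrable_min_scaled[OF l] b in auto)
  then have "t * - (LINT x|N. min 1 (a * x\<^sup>2)) \<le> t * (LINT x|N. exp (- (a * ?f x)) - 1)"
    using t by (intro mult_left_mono) auto
  then show ?thesis unfolding eq by simp
qed

text \<open>The Laplace transforms of the truncated sums are bounded below uniformly in the truncation, by a bound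
  that tends to \<open>1\<close> as the argument \<open>a\<close> of the transform tends to \<open>0\<close>.\<close>

lemma AE_bounded_trunc_jumps:
  assumes t: "0 \<le> t"
  shows "AE \<omega> in M. \<exists>B::nat. \<forall>k. jumps (trunc_square k) 0 t \<omega> \<le> real B"
proof -
  let ?J = "\<lambda>k. jumps (trunc_square k) 0 t"
  have [measurable]: "?J k \<in> borel_measurable M" for k by (rule trunc_jumps_measurable[OF order_refl t])
  \<comment> \<open>Restricting the bounds to natural numbers makes this event a countable
    combination of measurable ones.\<close>
  define A where "A = {\<omega>\<in>space M. \<exists>B::nat. \<forall>k. ?J k \<omega> \<le> real B}"
  have A[measurable]: "A \<in> sets M" unfolding A_def by measurable
  have le: "exp (- (t * (LINT x|N. min 1 (a * x\<^sup>2)))) \<le> prob A" if l: "a > 0" for a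
  proof -
    have J0: "0 \<le> ?J k \<omega>" for k \<omega> by (rule trunc_jumps_nonneg[OF order_refl t])
    \<comment> \<open>Off \<open>A\<close> the truncated sums are unbounded and increasing in
      \<open>k\<close>, hence divergent, so their exponentials disappear in the limit and only
      \<open>prob A\<close> can support the lower bound.\<close>
    have lim0: "(\<lambda>k. exp (- (a * ?J k \<omega>)) * indicator (space M - A) \<omega>) \<longlonglongrightarrow> 0" if "\<omega> \<in> space M" for \<omega>
    proof (cases "\<omega> \<in> A")
      case False
      have "filterlim (\<lambda>k. ?J k \<omega>) at_top sequentially"
        unfolding filterlim_at_top
      proof
        fix Z :: real
        obtain B :: nat where B: "Z \<le> real B" using real_arch_simple by blast
        obtain k where "?J k \<omega> > real B" using False \<open>\<omega> \<in> space M\<close> unfolding A_def by (auto simp: not_le)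
        then have "Z \<le> ?J l \<omega>" if "l \<ge> k" for l
          using trunc_jumps_mono[OF order_refl t that, of \<omega>] B by linarith
        then show "\<forall>\<^sub>F k in sequentially. Z \<le> ?J k \<omega>" unfolding eventually_sequentially by blast
      qed
      then have "filterlim (\<lambda>k. a * ?J k \<omega>) at_top sequentially"
        by (intro filterlim_tendsto_pos_mult_at_top[OF tendsto_const l])
      then have "filterlim (\<lambda>k. - (a * ?J k \<omega>)) at_bot sequentially"
        by (simp add: filterlim_uminus_at_top)
      then have "(\<lambda>k. exp (- (a * ?J k \<omega>))) \<longlonglongrightarrow> 0" by (rule filterlim_compose[OF exp_at_bot])
      then show ?thesis by (intro tendsto_mult_left_zero)
    qed simp
    have "(\<lambda>k. LINT \<omega>|M. exp (- (a * ?J k \<omega>)) * indicator (space M - A) \<omega>) \<longlonglongrightarrow> (LINT \<omega>|M. 0)"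
      by (rule integral_dominated_convergence[where w="\<lambda>_. 1"])
         (use lim0 l J0 in \<open>auto simp: indicator_def\<close>)
    then have "(\<lambda>k. prob A + (LINT \<omega>|M. exp (- (a * ?J k \<omega>)) * indicator (space M - A) \<omega>)) \<longlonglongrightarrow> prob A + 0"
      by (intro tendsto_intros) simp
    then have lim: "(\<lambda>k. prob A + (LINT \<omega>|M. exp (- (a * ?J k \<omega>)) * indicator (space M - A) \<omega>)) \<longlonglongrightarrow> prob A" by simp
    have "exp (- (t * (LINT x|N. min 1 (a * x\<^sup>2)))) \<le> prob A + (LINT \<omega>|M. exp (- (a * ?J k \<omega>)) * indicator (space M - A) \<omega>)" for k
    proof -
      have i1: "integrable M (\<lambda>\<omega>. exp (- (a * ?J k \<omega>)))"
        by (rule integrable_const_bound[of _ 1]) (use l J0 in auto)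
      have i2: "integrable M (\<lambda>\<omega>. exp (- (a * ?J k \<omega>)) * indicator (space M - A) \<omega>)"
        by (rule integrable_const_bound[of _ 1]) (use l J0 in \<open>auto simp: indicator_def\<close>)
      have i3: "integrable M (indicat_real A)"
        by (rule integrable_const_bound[of _ 1]) (auto simp: indicator_def)
      have "(LINT \<omega>|M. exp (- (a * ?J k \<omega>))) \<le> (LINT \<omega>|M. indicator A \<omega> + exp (- (a * ?J k \<omega>)) * indicator (space M - A) \<omega>)"
        by (intro integral_mono i1 Bochner_Integration.integrable_add i2 i3) (use l J0 in \<open>auto simp: indicator_def\<close>)
      also have "\<dots> = prob A + (LINT \<omega>|M. exp (- (a * ?J k \<omega>)) * indicator (space M - A) \<omega>)"
        using i2 i3 by simp
      finally show ?thesis using laplace_trunc_jumps[OF t, of a k] l by simp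
    qed
    then show ?thesis by (intro LIMSEQ_le_const[OF lim]) auto
  qed
  \<comment> \<open>The argument of the transform now runs through \<open>1 / real (Suc m)\<close>,
    and the lower bound for \<open>prob A\<close> rises to 1.\<close>
  have "(\<lambda>m. LINT x|N. min 1 (1 / real (Suc m) * x\<^sup>2)) \<longlonglongrightarrow> (LINT x|N. 0)"
  proof (rule integral_dominated_convergence[OF _ _ integrable_min])
    show "AE x in N. (\<lambda>m. min 1 (1 / real (Suc m) * x\<^sup>2)) \<longlonglongrightarrow> 0"
    proof (rule AE_I2)
      fix x
      have "(\<lambda>m. min 1 (1 / real (Suc m) * x\<^sup>2)) \<longlonglongrightarrow> min 1 (0 * x\<^sup>2)"
        by (intro tendsto_intros LIMSEQ_Suc[OF lim_1_over_n])
      then show "(\<lambda>m. min 1 (1 / real (Suc m) * x\<^sup>2)) \<longlonglongrightarrow> 0" by simp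
    qed
    show "AE x in N. norm (min 1 (1 / real (Suc m) * x\<^sup>2)) \<le> min 1 (x\<^sup>2)" for m
    proof (rule AE_I2)
      fix x :: real
      have "1 / real (Suc m) * x\<^sup>2 \<le> 1 * x\<^sup>2" by (intro mult_right_mono) auto
      moreover have "0 \<le> 1 / real (Suc m) * x\<^sup>2" by simp
      ultimately show "norm (min 1 (1 / real (Suc m) * x\<^sup>2)) \<le> min 1 (x\<^sup>2)" by auto
    qed
  qed measurable
  then have "(\<lambda>m. exp (- (t * (LINT x|N. min 1 (1 / real (Suc m) * x\<^sup>2))))) \<longlonglongrightarrow> exp (- (t * 0))"
    by (intro tendsto_intros) simp
  then have "exp (- (t * 0)) \<le> prob A"
  proof (rule LIMSEQ_le_const2)
    show "\<exists>n0. \<forall>m\<ge>n0. exp (- (t * (LINT x|N. min 1 (1 / real (Suc m) * x\<^sup>2)))) \<le> prob A"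
      by (intro exI allI impI le) simp
  qed
  then have "prob A = 1" using prob_le_1[of A] by simp
  then have "AE \<omega> in M. \<omega> \<in> A" using prob_eq_1[OF A] by simp
  then show ?thesis by eventually_elim (auto simp: A_def)
qed

lemma AE_summable_squared_jumps:
  "AE \<omega> in M. \<omega> \<in> \<Omega> \<and> (\<forall>t\<ge>0. (\<lambda>s. (jump (\<lambda>r. X r \<omega>) s)\<^sup>2) summable_on {0<..t})"
proof -
  \<comment> \<open>Integer horizons form a countable family, so one null set serves all of them;
    every real horizon lies below an integer one.\<close>
  have "AE \<omega> in M. \<forall>m::nat. \<exists>B::nat. \<forall>k. jumps (trunc_square k) 0 (real m) \<omega> \<le> real B"
    unfolding AE_all_countable by (intro allI AE_bounded_trunc_jumps) simp
  then show ?thesis using AE_\<Omega>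
  proof eventually_elim
    case (elim \<omega>)
    show ?case
    proof (intro conjI allI impI elim)
      fix t :: real assume t: "t \<ge> 0"
      obtain m :: nat where m: "t \<le> real m" using real_arch_simple by blast
      obtain B where "\<forall>k. jumps (trunc_square k) 0 (real m) \<omega> \<le> real B" using elim(1) by blast
      then have "(\<lambda>s. (jump (\<lambda>r. X r \<omega>) s)\<^sup>2) summable_on {0<..real m}"
        using elim(2) by (intro summable_squared_jumps[OF cadlag_\<Omega>[OF elim(2)]]) (auto simp: jumps_def)
      then show "(\<lambda>s. (jump (\<lambda>r. X r \<omega>) s)\<^sup>2) summable_on {0<..t}"
        by (rule summable_on_subset_banach) (use m in auto)
    qed
  qed
qed

text \<open>All increment sums are read off one common refined grid. Its increments are independent,
  and each sum depends only on its own block of \<open>n\<close> consecutive increments; the blocks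
  are disjoint.\<close>

lemma indep_increment_sums:
  assumes \<tau>: "0 \<le> \<tau> 0" "mono \<tau>" and f[measurable]: "f \<in> borel_measurable borel" and n: "n > 0"
  shows "indep_vars (\<lambda>_. borel) (\<lambda>i \<omega>. increment_sum f (\<lambda>r. X r \<omega>) (\<tau> i) (\<tau> (Suc i)) n) {..<m::nat}"
proof -
  \<comment> \<open>\<open>\<rho>\<close> enumerates the grid that splits every interval of \<open>\<tau>\<close> into \<open>n\<close> equal cells\<close>
  define h where "h q = (\<tau> (Suc q) - \<tau> q) / real n" for q
  have h: "h q \<ge> 0" for q using monoD[OF \<tau>(2), of q "Suc q"] by (simp add: h_def)
  define \<rho> where "\<rho> j = \<tau> (j div n) + real (j mod n) * h (j div n)" for j
  have \<rho>1: "\<rho> (q * n + r) = \<tau> q + real r * h q" if "r < n" for q r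
    using that by (simp add: \<rho>_def)
  have \<rho>2: "\<rho> (Suc (q * n + r)) = \<tau> q + real (Suc r) * h q" if "r < n" for q r
  proof (cases "Suc r < n")
    case True
    then show ?thesis using \<rho>1[OF True, of q] by simp
  next
    case False
    then have r: "Suc r = n" using that by simp
    then have "Suc (q * n + r) = Suc q * n + 0" by simp
    then have "\<rho> (Suc (q * n + r)) = \<rho> (Suc q * n + 0)" by (rule arg_cong)
    also have "\<dots> = \<tau> (Suc q) + real 0 * h (Suc q)" by (rule \<rho>1[OF n])
    also have "\<dots> = \<tau> (Suc q)" by simp
    also have "\<dots> = \<tau> q + real n * h q" using n by (simp add: h_def)
    finally show ?thesis by (simp only: r)
  qed
  have \<rho>_mono: "mono \<rho>"
    unfolding mono_iff_le_Suc
  proof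
    fix j
    have "j = (j div n) * n + j mod n" by simp
    then show "\<rho> j \<le> \<rho> (Suc j)"
      using \<rho>1[of "j mod n" "j div n"] \<rho>2[of "j mod n" "j div n"] n h[of "j div n"] by (simp add: algebra_simps)
  qed
  have \<rho>0: "0 \<le> \<rho> 0" using \<tau>(1) n by (simp add: \<rho>_def)
  let ?K = "\<lambda>i. {i * n..<i * n + n}"
  have "indep_vars (\<lambda>i. PiM (?K i) (\<lambda>_. borel)) (\<lambda>i \<omega>. restrict (\<lambda>j. X (\<rho> (Suc j)) \<omega> - X (\<rho> j) \<omega>) (?K i)) {..<m}"
  proof (rule indep_vars_restrict[OF indep_increments[OF \<rho>0 \<rho>_mono, of "m * n"]])
    show "?K i \<subseteq> {..<m * n}" if i: "i \<in> {..<m}" for i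
    proof -
      have "Suc i * n \<le> m * n" using i by (intro mult_le_mono1) simp
      then show ?thesis by auto
    qed
    have d: "?K i \<inter> ?K j = {}" if "i < j" for i j
    proof -
      have "Suc i * n \<le> j * n" using that by (intro mult_le_mono1) simp
      then show ?thesis by auto
    qed
    show "disjoint_family_on ?K {..<m}"
      unfolding disjoint_family_on_def
    proof (intro ballI impI)
      fix i j :: nat assume "i \<noteq> j"
      then show "?K i \<inter> ?K j = {}" using d[of i j] d[of j i] by (cases i j rule: linorder_cases) auto
    qed
  qed
  then have "indep_vars (\<lambda>_. borel) (\<lambda>i \<omega>. (\<lambda>g. \<Sum>j\<in>?K i. f (g j)) (restrict (\<lambda>j. X (\<rho> (Suc j)) \<omega> - X (\<rho> j) \<omega>) (?K i))) {..<m}"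
    by (rule indep_vars_compose2) measurable
  moreover have "(\<Sum>j\<in>?K i. f (restrict (\<lambda>j. X (\<rho> (Suc j)) \<omega> - X (\<rho> j) \<omega>) (?K i) j))
      = increment_sum f (\<lambda>r. X r \<omega>) (\<tau> i) (\<tau> (Suc i)) n" for i \<omega>
  proof -
    have "(\<Sum>j\<in>?K i. f (restrict (\<lambda>j. X (\<rho> (Suc j)) \<omega> - X (\<rho> j) \<omega>) (?K i) j)) = (\<Sum>j\<in>?K i. f (X (\<rho> (Suc j)) \<omega> - X (\<rho> j) \<omega>))"
      by (intro sum.cong) auto
    also have "\<dots> = (\<Sum>r<n. f (X (\<rho> (Suc (i * n + r))) \<omega> - X (\<rho> (i * n + r)) \<omega>))"
      by (rule sum.reindex_bij_witness[of _ "\<lambda>r. i * n + r" "\<lambda>j. j - i * n"]) auto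
    also have "\<dots> = increment_sum f (\<lambda>r. X r \<omega>) (\<tau> i) (\<tau> (Suc i)) n"
      unfolding increment_sum_def by (intro sum.cong) (simp_all add: \<rho>1 \<rho>2 h_def del: of_nat_Suc)
    finally show ?thesis .
  qed
  ultimately show ?thesis by simp
qed

end

text \<open>Almost sure summability is itself derived in \<open>levy_path\<close>; the set
  \<open>\<Omega>\<close> is then shrunk so that it holds at every point, and the earlier results
  apply to the smaller set.\<close>

locale levy_path_summable = levy_path +
  assumes summable_\<Omega>: "\<And>\<omega> t. \<omega> \<in> \<Omega> \<Longrightarrow> t \<ge> 0 \<Longrightarrow> (\<lambda>s. (jump (\<lambda>r. X r \<omega>) s)\<^sup>2) summable_on {0<..t}"
begin

abbreviation "squares \<equiv> jumps (\<lambda>y. y\<^sup>2)"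

lemma squares_limit:
  assumes "0 \<le> s" "s \<le> t"
  shows "(\<lambda>k. jumps (trunc_square k) s t \<omega>) \<longlonglongrightarrow> squares s t \<omega>"
proof (cases "\<omega> \<in> \<Omega>")
  case True
  have "(\<lambda>r. (jump (\<lambda>r. X r \<omega>) r)\<^sup>2) summable_on {s<..t}"
    by (rule summable_on_subset_banach[OF summable_\<Omega>[OF True, of t]]) (use assms in auto)
  then show ?thesis
    using jump_sum_trunc_square_tendsto[OF cadlag_\<Omega>[OF True] assms] True by (simp add: jumps_def)
qed (simp add: jumps_def)

lemma squares_measurable:
  "0 \<le> s \<Longrightarrow> s \<le> t \<Longrightarrow> squares s t \<in> borel_measurable M"
  by (rule borel_measurable_LIMSEQ_real[OF squares_limit trunc_jumps_measurable])

lemma squares_add: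
  assumes "0 \<le> s" "s \<le> t"
  shows "squares 0 t \<omega> = squares 0 s \<omega> + squares s t \<omega>"
  using jump_sum_split[OF summable_\<Omega> refl assms] assms by (auto simp: jumps_def)

lemma expectation_squares:
  assumes st: "0 \<le> s" "s \<le> t"
  shows "(CLINT \<omega>|M. iexp (u * squares s t \<omega>)) = exp (of_real (t - s) * (CLINT x|N. iexp (u * x\<^sup>2) - 1))"
proof (rule LIMSEQ_unique)
  note [measurable] = trunc_jumps_measurable[OF st] squares_measurable[OF st]
  have [measurable]: "trunc_square k \<in> borel_measurable borel" for k unfolding trunc_square_def[abs_def] by measurable
  show "(\<lambda>k. CLINT \<omega>|M. iexp (u * jumps (trunc_square k) s t \<omega>)) \<longlonglongrightarrow> (CLINT \<omega>|M. iexp (u * squares s t \<omega>))"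
    by (rule integral_dominated_convergence[where w="\<lambda>_. 1"])
       (auto intro!: tendsto_intros squares_limit st)
  have eq: "(CLINT \<omega>|M. iexp (u * jumps (trunc_square k) s t \<omega>)) = exp (of_real (t - s) * (CLINT x|N. iexp (u * trunc_square k x) - 1))" for k
    using expectation_trunc_jumps[OF st, of "\<i> * of_real u" k] by (simp add: mult.assoc)
  have "(\<lambda>k. CLINT x|N. iexp (u * trunc_square k x) - 1) \<longlonglongrightarrow> (CLINT x|N. iexp (u * x\<^sup>2) - 1)"
  proof (rule integral_dominated_convergence)
    show "integrable N (\<lambda>x. 2 * min 1 (\<bar>u\<bar> * x\<^sup>2))"
      \<comment> \<open>The distance of \<open>iexp y\<close> from 1 is at most |y| and at most 2,
        which yields a dominating function that does not depend on \<open>k\<close>.\<close>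
      by (intro integrable_mult_right integrable_min_scaled) simp
    show "AE x in N. (\<lambda>k. iexp (u * trunc_square k x) - 1) \<longlonglongrightarrow> iexp (u * x\<^sup>2) - 1"
      by (intro AE_I2 tendsto_intros trunc_square_tendsto)
    show "AE x in N. norm (iexp (u * trunc_square k x) - 1) \<le> 2 * min 1 (\<bar>u\<bar> * x\<^sup>2)" for k
    proof (rule AE_I2)
      fix x
      have "norm (iexp (u * trunc_square k x) - 1) \<le> \<bar>u * trunc_square k x\<bar>" by (rule iexp_remainder_1)
      also have "\<dots> \<le> \<bar>u\<bar> * x\<^sup>2"
        using trunc_square_le[of k x] trunc_square_nonneg[of k x] by (auto simp: abs_mult intro!: mult_left_mono)
      finally have 1: "norm (iexp (u * trunc_square k x) - 1) \<le> \<bar>u\<bar> * x\<^sup>2" .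
      have 2: "norm (iexp (u * trunc_square k x) - 1) \<le> 2"
        using norm_triangle_ineq4[of "iexp (u * trunc_square k x)" 1] by simp
      have min2: "y \<le> 2 * min 1 q" if "0 \<le> q" "y \<le> q" "y \<le> 2" for y q :: real
        using that by (simp add: min_def)
      show "norm (iexp (u * trunc_square k x) - 1) \<le> 2 * min 1 (\<bar>u\<bar> * x\<^sup>2)"
        by (rule min2[OF _ 1 2]) simp
    qed
  qed measurable
  then show "(\<lambda>k. CLINT \<omega>|M. iexp (u * jumps (trunc_square k) s t \<omega>)) \<longlonglongrightarrow> exp (of_real (t - s) * (CLINT x|N. iexp (u * x\<^sup>2) - 1))"
    unfolding eq by (intro tendsto_intros)
qed

text \<open>The process \<open>Y\<close> of the theorem: on \<open>\<Omega>\<close> it agrees with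
  \<open>quad_var\<close>, where \<open>v\<close> is the Gaussian variance, and off
  \<open>\<Omega>\<close> its jump part is 0, which makes it measurable.\<close>

definition qv_process :: "real \<Rightarrow> 'a \<Rightarrow> real" where
  "qv_process t \<omega> = v * t + squares 0 t \<omega>"

lemma qv_process_measurable: "t \<ge> 0 \<Longrightarrow> qv_process t \<in> borel_measurable M"
  unfolding qv_process_def[abs_def] using squares_measurable[OF order_refl, of t] by simp

lemma qv_process_increment:
  "0 \<le> s \<Longrightarrow> s \<le> t \<Longrightarrow> qv_process t \<omega> - qv_process s \<omega> = v * (t - s) + squares s t \<omega>"
  using squares_add[of s t \<omega>] by (simp add: qv_process_def algebra_simps)

lemma char_qv_process_increment:
  assumes st: "0 \<le> s" "s \<le> t"
  shows "char (distr M borel (\<lambda>\<omega>. qv_process t \<omega> - qv_process s \<omega>)) u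
    = exp (of_real (t - s) * (\<i> * of_real (u * v) + (CLINT x|N. iexp (u * x\<^sup>2) - 1)))"
proof -
  note [measurable] = squares_measurable[OF st]
  have "char (distr M borel (\<lambda>\<omega>. qv_process t \<omega> - qv_process s \<omega>)) u = (CLINT \<omega>|M. iexp (u * (v * (t - s) + squares s t \<omega>)))"
    unfolding qv_process_increment[OF st] char_def by (rule integral_distr) auto
  also have "\<dots> = (CLINT \<omega>|M. iexp (u * (v * (t - s))) * iexp (u * squares s t \<omega>))"
    by (simp add: distrib_left exp_add)
  also have "\<dots> = iexp (u * (v * (t - s))) * (CLINT \<omega>|M. iexp (u * squares s t \<omega>))"
    by (rule integral_mult_right_zero)
  also have "\<dots> = exp (\<i> * of_real (u * (v * (t - s))) + of_real (t - s) * (CLINT x|N. iexp (u * x\<^sup>2) - 1))"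
    unfolding expectation_squares[OF st] exp_add ..
  finally show ?thesis by (simp add: algebra_simps)
qed

lemma qv_process_0: "qv_process 0 \<omega> = 0"
  by (simp add: qv_process_def jumps_def jump_sum_def)

lemma char_qv_process:
  "0 \<le> t \<Longrightarrow> char (distr M borel (qv_process t)) u = exp (of_real t * (\<i> * of_real (u * v) + (CLINT x|N. iexp (u * x\<^sup>2) - 1)))"
  using char_qv_process_increment[of 0 t u] by (simp add: qv_process_0)

lemma qv_process_path:
  assumes "\<omega> \<in> \<Omega>"
  shows "mono_on {0..} (\<lambda>t. qv_process t \<omega>)" "cadlag (\<lambda>t. qv_process t \<omega>)"
  using cadlag_quad_var_path[OF summable_\<Omega>[OF assms] v] assms
  by (simp_all add: qv_process_def jumps_def)

text \<open>Stationarity holds because the characteristic function of an increment depends only on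
  its duration. Independence is carried over by \<open>indep_vars_limit\<close> twice, from
  increment sums to truncated jump sums and from these to the sums of squares.\<close>

lemma subordinator_qv_process: "subordinator M qv_process"
  unfolding subordinator_def levy_process_def
proof (intro conjI allI impI)
  show "prob_space M" by (rule prob_space_axioms)
  show "qv_process t \<in> borel_measurable M" if "t \<ge> 0" for t by (rule qv_process_measurable[OF that])
  show "AE \<omega> in M. qv_process 0 \<omega> = 0" by (simp add: qv_process_0)
  show "AE \<omega> in M. cadlag (\<lambda>t. qv_process t \<omega>)" "AE \<omega> in M. mono_on {0..} (\<lambda>t. qv_process t \<omega>)"
    using AE_\<Omega> by (eventually_elim; simp add: qv_process_path)+
  show "distr M borel (\<lambda>\<omega>. qv_process (s + t) \<omega> - qv_process s \<omega>) = distr M borel (qv_process t)" if st: "0 \<le> s" "0 \<le> t" for s t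
  proof (rule Levy_uniqueness)
    have [measurable]: "qv_process s \<in> borel_measurable M" "qv_process t \<in> borel_measurable M" "qv_process (s + t) \<in> borel_measurable M"
      using st by (auto intro: qv_process_measurable)
    show "real_distribution (distr M borel (\<lambda>\<omega>. qv_process (s + t) \<omega> - qv_process s \<omega>))"
      "real_distribution (distr M borel (qv_process t))"
      by (intro real_distribution_distr; measurable)+
    show "char (distr M borel (\<lambda>\<omega>. qv_process (s + t) \<omega> - qv_process s \<omega>)) = char (distr M borel (qv_process t))"
      using st by (intro ext) (simp add: char_qv_process_increment char_qv_process)
  qed
  fix n :: nat and \<tau> :: "nat \<Rightarrow> real"
  assume "0 \<le> \<tau> 0 \<and> mono \<tau>"
  then have \<tau>: "0 \<le> \<tau> 0" "mono \<tau>" by auto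
  have \<tau>i: "0 \<le> \<tau> i" "\<tau> i \<le> \<tau> (Suc i)" for i
    using \<tau> monoD[OF \<tau>(2), of 0 i] monoD[OF \<tau>(2), of i "Suc i"] by auto
  have trunc: "indep_vars (\<lambda>_. borel) (\<lambda>i. jumps (trunc_square k) (\<tau> i) (\<tau> (Suc i))) {..<n}" for k
  proof (rule indep_vars_limit)
    \<comment> \<open>The grids have \<open>Suc l\<close> cells, as block independence requires at
      least one cell.\<close>
    show "indep_vars (\<lambda>_. borel) (\<lambda>i \<omega>. increment_sum (trunc_square k) (\<lambda>r. X r \<omega>) (\<tau> i) (\<tau> (Suc i)) (Suc l)) {..<n}" for l
      by (rule indep_increment_sums[OF \<tau>]) (auto simp: trunc_square_def[abs_def])
    show "AE \<omega> in M. (\<lambda>l. increment_sum (trunc_square k) (\<lambda>r. X r \<omega>) (\<tau> i) (\<tau> (Suc i)) (Suc l)) \<longlonglongrightarrow> jumps (trunc_square k) (\<tau> i) (\<tau> (Suc i)) \<omega>" for i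
      using AE_\<Omega>
    proof eventually_elim
      case (elim \<omega>)
      show ?case
        by (rule LIMSEQ_Suc, rule jumps_limit[OF isCont_trunc_square _ trunc_square_vanishing \<tau>i elim]) auto
    qed
  qed (auto intro: trunc_jumps_measurable \<tau>i)
  have "indep_vars (\<lambda>_. borel) (\<lambda>i. squares (\<tau> i) (\<tau> (Suc i))) {..<n}"
    by (rule indep_vars_limit[where Z="\<lambda>k i. jumps (trunc_square k) (\<tau> i) (\<tau> (Suc i))", OF trunc])
       (auto intro: squares_measurable \<tau>i squares_limit)
  then have "indep_vars (\<lambda>_. borel) (\<lambda>i \<omega>. (\<lambda>y. v * (\<tau> (Suc i) - \<tau> i) + y) (squares (\<tau> i) (\<tau> (Suc i)) \<omega>)) {..<n}"
    by (rule indep_vars_compose2) measurable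
  then show "indep_vars (\<lambda>_. borel) (\<lambda>i \<omega>. qv_process (\<tau> (Suc i)) \<omega> - qv_process (\<tau> i) \<omega>) {..<n}"
    by (simp add: qv_process_increment[OF \<tau>i])
qed

end

section \<open>Payoffs with kinks and the density of squared jumps\<close>

text \<open>The derivative \<open>2 * max y 0\<close> is Lipschitz with constant 2, which gives the
  remainder z^2.\<close>

lemma pos_part_square_expansion:
  "\<bar>(max (y + z) 0)\<^sup>2 - (max y 0)\<^sup>2 - 2 * z * max y 0\<bar> \<le> (z::real)\<^sup>2"
proof -
  consider "y \<ge> 0" "y + z \<ge> 0" | "y \<ge> 0" "y + z < 0" | "y < 0" "y + z \<ge> 0" | "y < 0" "y + z < 0"
    by linarith
  then show ?thesis
  proof cases
    case 1
    then show ?thesis by (simp add: power2_eq_square algebra_simps)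
  next
    case 2
    have "0 \<le> (y + z)\<^sup>2" "0 \<le> y * (- y - 2 * z)" using 2 by (auto intro!: mult_nonneg_nonneg)
    then show ?thesis using 2 by (simp add: power2_eq_square algebra_simps abs_le_iff)
  next
    case 3
    then have "\<bar>y + z\<bar> \<le> \<bar>z\<bar>" by simp
    then show ?thesis using 3 by (simp add: abs_le_square_iff)
  qed simp
qed

text \<open>The function is linear on either side of 0, so an error arises only if the step crosses
  the kink, that is, only for \<open>y\<close> within |z| of 0.\<close>

lemma pos_part_expansion:
  "\<bar>max (y + z) 0 - max y 0 - z * indicator {0<..} y\<bar> \<le> \<bar>z\<bar> * indicator {-\<bar>z\<bar>..\<bar>z::real\<bar>} y"
  by (auto simp: indicator_def max_def abs_if split: if_splits)

text \<open>With \<open>h y = (max y 0)\<^sup>2 + 2 k max y 0\<close> the payoff \<open>max (x\<^sup>2 - k\<^sup>2) 0\<close> is \<open>h (x - k) + h (- x - k)\<close>.\<close>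

lemma kinked_square_expansion:
  fixes k :: real
  assumes k: "k > 0"
  defines "g \<equiv> \<lambda>x. max (x\<^sup>2 - k\<^sup>2) 0"
    and "g' \<equiv> \<lambda>x. 2 * max (x - k) 0 - 2 * max (- x - k) 0 + 2 * k * (indicator {0<..} (x - k) - indicator {0<..} (- x - k))"
  shows "\<bar>g (z + x) - g x - z * g' x\<bar> \<le> 2 * z\<^sup>2 + 2 * k * \<bar>z\<bar> * (indicator {k - \<bar>z\<bar>..k + \<bar>z\<bar>} x + indicator {- k - \<bar>z\<bar>..- k + \<bar>z\<bar>} x)"
proof -
  define h where "h y = (max y 0)\<^sup>2 + 2 * k * max y 0" for y :: real
  define h' where "h' y = 2 * max y 0 + 2 * k * indicator {0<..} y" for y :: real
  have gh: "g x = h (x - k) + h (- x - k)" for x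
  proof -
    consider "x > k" | "x < - k" | "\<bar>x\<bar> \<le> k" by linarith
    then show ?thesis
    proof cases
      case 1
      then have "k * k \<le> x * x" using k by (intro mult_mono) auto
      then show ?thesis using 1 k by (simp add: g_def h_def power2_eq_square algebra_simps max_def)
    next
      case 2
      then have "k * k \<le> (- x) * (- x)" using k by (intro mult_mono) auto
      then show ?thesis using 2 k by (simp add: g_def h_def power2_eq_square algebra_simps max_def)
    next
      case 3
      then have "x\<^sup>2 \<le> k\<^sup>2" using k abs_le_square_iff[of x k] by simp
      then show ?thesis using 3 by (simp add: g_def h_def)
    qed
  qed
  have gh': "g' x = h' (x - k) - h' (- x - k)" by (simp add: g'_def h'_def algebra_simps)
  have h: "\<bar>h (y + z) - h y - z * h' y\<bar> \<le> z\<^sup>2 + 2 * k * (\<bar>z\<bar> * indicator {-\<bar>z\<bar>..\<bar>z\<bar>} y)" for y z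
  proof -
    have "h (y + z) - h y - z * h' y = ((max (y + z) 0)\<^sup>2 - (max y 0)\<^sup>2 - 2 * z * max y 0)
       + 2 * k * (max (y + z) 0 - max y 0 - z * indicator {0<..} y)"
      by (simp add: h_def h'_def algebra_simps)
    also have "\<bar>\<dots>\<bar> \<le> z\<^sup>2 + 2 * k * (\<bar>z\<bar> * indicator {-\<bar>z\<bar>..\<bar>z\<bar>} y)"
    proof (rule order_trans[OF abs_triangle_ineq add_mono[OF pos_part_square_expansion]])
      show "\<bar>2 * k * (max (y + z) 0 - max y 0 - z * indicat_real {0<..} y)\<bar> \<le> 2 * k * (\<bar>z\<bar> * indicat_real {- \<bar>z\<bar>..\<bar>z\<bar>} y)"
        unfolding abs_mult[of "2 * k"] using k by (simp only: abs_of_pos mult_pos_pos zero_less_numeral) (intro mult_left_mono pos_part_expansion, simp)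
    qed
    finally show ?thesis .
  qed
  have "g (z + x) - g x - z * g' x = (h ((x - k) + z) - h (x - k) - z * h' (x - k)) + (h ((- x - k) + (- z)) - h (- x - k) - (- z) * h' (- x - k))"
    unfolding gh gh' by (simp add: algebra_simps)
  also have "\<bar>\<dots>\<bar> \<le> (z\<^sup>2 + 2 * k * (\<bar>z\<bar> * indicator {-\<bar>z\<bar>..\<bar>z\<bar>} (x - k))) + ((- z)\<^sup>2 + 2 * k * (\<bar>- z\<bar> * indicator {-\<bar>- z\<bar>..\<bar>- z\<bar>} (- x - k)))"
    by (rule order_trans[OF abs_triangle_ineq add_mono[OF h h]])
  also have "\<dots> = 2 * z\<^sup>2 + 2 * k * \<bar>z\<bar> * (indicator {k - \<bar>z\<bar>..k + \<bar>z\<bar>} x + indicator {- k - \<bar>z\<bar>..- k + \<bar>z\<bar>} x)"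
    by (auto simp: indicator_def)
  finally show ?thesis .
qed

text \<open>Integrating the pointwise expansion, the smooth error contributes
  \<open>c1 * rate * z\<^sup>2\<close>. Each kink error, of size \<open>c2 * \<bar>z\<bar>\<close>,
  lives on an interval of length 2 |z|, whose mass is at most \<open>2 * B * \<bar>z\<bar>\<close>;
  two kinks together give \<open>4 * c2 * B * z\<^sup>2\<close>. The slope at 0 is the integral of
  \<open>g'\<close>, and the weight \<open>W\<close> provides integrability of all terms.\<close>

lemma (in levy_split) one_jump_quadratic:
  assumes dens: "N = density lborel (\<lambda>x. ennreal (p x))" and p[measurable]: "p \<in> borel_measurable borel"
    and pB: "\<And>x. \<epsilon> < \<bar>x\<bar> \<Longrightarrow> p x \<le> B" and B: "B \<ge> 0"
    and W[measurable]: "W \<in> borel_measurable borel" and W0: "\<And>x. W x \<ge> 0"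
    and Wsub: "\<And>x y. W (x + y) \<le> 2 * W x * W y"
    and fin: "(\<integral>\<^sup>+x. ennreal (W x) * indicator big x \<partial>N) < \<infinity>"
    and g[measurable]: "g \<in> borel_measurable borel" and g'[measurable]: "g' \<in> borel_measurable borel"
    and g0: "\<And>x. 0 \<le> g x" and gW: "\<And>x. g x \<le> c * W x" and g'W: "\<And>x. \<bar>g' x\<bar> \<le> d * W x" and c: "c \<ge> 0"
    and kinks: "\<And>x z. \<bar>g (z + x) - g x - z * g' x\<bar> \<le> c1 * z\<^sup>2 + c2 * \<bar>z\<bar> * (indicator {k1 - \<bar>z\<bar>..k1 + \<bar>z\<bar>} x + indicator {k2 - \<bar>z\<bar>..k2 + \<bar>z\<bar>} x)"
    and c1: "c1 \<ge> 0" and c2: "c2 \<ge> 0"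
  shows "\<exists>k C. \<forall>z. \<bar>enn2real (one_jump g z) - enn2real (one_jump g 0) - k * z\<bar> \<le> C * z\<^sup>2"
proof -
  have iW: "integrable N (\<lambda>x. indicator big x * W x)"
  proof (rule integrableI_nonneg)
    have "(\<integral>\<^sup>+x. ennreal (indicat_real big x * W x) \<partial>N) = (\<integral>\<^sup>+x. ennreal (W x) * indicator big x \<partial>N)"
      by (intro nn_integral_cong) (auto simp: indicator_def)
    then show "(\<integral>\<^sup>+x. ennreal (indicat_real big x * W x) \<partial>N) < \<infinity>" using fin by simp
  qed (use W0 in auto)
  have ig: "integrable N (\<lambda>x. indicator big x * g (z + x))" for z
  proof (rule Bochner_Integration.integrable_bound[OF integrable_mult_right[OF iW, of "2 * c * W z"]])
    have "g (z + x) \<le> 2 * c * W z * W x" for x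
      using order_trans[OF gW mult_left_mono[OF Wsub c], of z x] by (simp add: mult_ac)
    then show "AE x in N. norm (indicat_real big x * g (z + x)) \<le> norm (2 * c * W z * (indicat_real big x * W x))"
      using g0 W0 c by (intro AE_I2) (auto simp: indicator_def abs_mult)
  qed measurable
  have ig': "integrable N (\<lambda>x. indicator big x * g' x)"
    by (rule Bochner_Integration.integrable_bound[OF integrable_mult_right[OF iW, of d]])
       (use g'W W0 in \<open>auto simp: indicator_def intro: order_trans[OF _ abs_ge_self]\<close>)
  define G where "G z = (LINT x|N. indicator big x * g (z + x))" for z
  have G: "enn2real (one_jump g z) = G z" for z
  proof -
    have "one_jump g z = (\<integral>\<^sup>+x. ennreal (indicator big x * g (z + x)) \<partial>N)"
      unfolding one_jump_def by (intro nn_integral_cong) (auto simp: indicator_def)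
    also have "\<dots> = ennreal (G z)"
      unfolding G_def by (intro nn_integral_eq_integral ig) (use g0 in auto)
    finally show ?thesis using g0 by (simp add: G_def)
  qed
  define k where "k = (LINT x|N. indicator big x * g' x)"
  define C where "C = c1 * rate + 4 * c2 * B"
  have int: "integrable N (\<lambda>x. indicator big x * indicator {a..b} x :: real) \<and> (LINT x|N. indicator big x * indicator {a..b} x) \<le> B * (b - a)"
    if ab: "a \<le> b" for a b :: real
  proof
    show i: "integrable N (\<lambda>x. indicator big x * indicator {a..b} x :: real)"
      by (rule integrable_bigI[OF _ \<epsilon>(1), of _ 1]) (auto simp: indicator_def)
    have "ennreal (LINT x|N. indicator big x * indicator {a..b} x) = (\<integral>\<^sup>+x. ennreal (indicator big x * indicator {a..b} x) \<partial>N)"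
      by (rule nn_integral_eq_integral[OF i, symmetric]) auto
    also have "\<dots> = (\<integral>\<^sup>+x. ennreal (p x) * ennreal (indicator big x * indicator {a..b} x) \<partial>lborel)"
      unfolding dens by (rule nn_integral_density) measurable
    also have "\<dots> \<le> (\<integral>\<^sup>+x. ennreal B * indicator {a..b} x \<partial>lborel)"
      using pB by (intro nn_integral_mono) (auto simp: indicator_def intro!: ennreal_leI)
    also have "\<dots> = ennreal (B * (b - a))"
      using ab B by (simp add: nn_integral_cmult ennreal_mult)
    finally show "(LINT x|N. indicator big x * indicator {a..b} x) \<le> B * (b - a)"
      using ab B by (simp add: ennreal_le_iff)
  qed
  show ?thesis
    unfolding G
  proof (intro exI allI)
    fix z
    let ?I = "\<lambda>q x. indicat_real big x * indicat_real {q - \<bar>z\<bar>..q + \<bar>z\<bar>} x"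
    have ib: "integrable N (indicat_real big)" using emeasure_big_eq by auto
    have "k1 - \<bar>z\<bar> \<le> k1 + \<bar>z\<bar>" "k2 - \<bar>z\<bar> \<le> k2 + \<bar>z\<bar>" by simp_all
    note i12 = int[OF this(1)] int[OF this(2)]
    have i1: "integrable N (?I k1)" and i2: "integrable N (?I k2)" using i12 by blast+
    have l1: "(LINT x|N. ?I k1 x) \<le> B * (2 * \<bar>z\<bar>)" and l2: "(LINT x|N. ?I k2 x) \<le> B * (2 * \<bar>z\<bar>)"
      using conjunct2[OF i12(1)] conjunct2[OF i12(2)] by simp_all
    define F where "F x = (c1 * z\<^sup>2) * indicat_real big x + c2 * \<bar>z\<bar> * (?I k1 x + ?I k2 x)" for x
    have iF: "integrable N F"
      unfolding F_def[abs_def]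
      by (rule Bochner_Integration.integrable_add[OF integrable_mult_right[OF ib] integrable_mult_right[OF Bochner_Integration.integrable_add[OF i1 i2]]])
    have iL: "integrable N (\<lambda>x. \<bar>indicat_real big x * g (z + x) - indicator big x * g (0 + x) - z * (indicator big x * g' x)\<bar>)"
      by (rule integrable_abs[OF Bochner_Integration.integrable_diff[OF Bochner_Integration.integrable_diff[OF ig ig] integrable_mult_right[OF ig']]])
    have pt: "\<bar>indicat_real big x * g (z + x) - indicator big x * g (0 + x) - z * (indicator big x * g' x)\<bar> \<le> F x" for x
    proof (cases "x \<in> big")
      case True
      then have 1: "indicat_real big x = 1" by simp
      show ?thesis unfolding F_def 1 mult_1_left mult_1_right add_0_left by (rule kinks)
    next
      case False
      then have 0: "indicat_real big x = 0" by simp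
      show ?thesis unfolding F_def 0 mult_zero_left mult_zero_right by simp
    qed
    have "G z - G 0 - k * z = (LINT x|N. indicator big x * g (z + x) - indicator big x * g (0 + x) - z * (indicator big x * g' x))"
      unfolding G_def k_def using ig[of z] ig[of 0] ig' by simp
    then have le: "\<bar>G z - G 0 - k * z\<bar> \<le> integral\<^sup>L N F"
      by (simp only: order_trans[OF integral_abs_bound integral_mono[OF iL iF pt]])
    have "integral\<^sup>L N F = (c1 * z\<^sup>2) * rate + c2 * \<bar>z\<bar> * ((LINT x|N. ?I k1 x) + (LINT x|N. ?I k2 x))"
      unfolding F_def[abs_def] Bochner_Integration.integral_add[OF integrable_mult_right[OF ib] integrable_mult_right[OF Bochner_Integration.integrable_add[OF i1 i2]]]
        integral_mult_right_zero Bochner_Integration.integral_add[OF i1 i2] by (simp add: rate_def)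
    note le[unfolded this]
    also have "(c1 * z\<^sup>2) * rate + c2 * \<bar>z\<bar> * ((LINT x|N. ?I k1 x) + (LINT x|N. ?I k2 x))
        \<le> (c1 * z\<^sup>2) * rate + c2 * \<bar>z\<bar> * (B * (2 * \<bar>z\<bar>) + B * (2 * \<bar>z\<bar>))"
      using c2 by (intro add_left_mono mult_left_mono add_mono l1 l2) auto
    also have "\<dots> = C * z\<^sup>2" by (simp add: C_def algebra_simps power2_eq_square flip: abs_mult)
    finally show "\<bar>G z - G 0 - k * z\<bar> \<le> C * z\<^sup>2" .
  qed
qed

text \<open>The change of variables is made on the compact intervals from
  \<open>1 / real (Suc n)\<close> to \<open>real (Suc n)\<close> and extended to the open half line
  by monotone convergence.\<close>

lemma nn_integral_square_substitution:
  fixes f :: "real \<Rightarrow> real"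
  assumes [measurable]: "f \<in> borel_measurable borel" and f0: "\<And>y. y > 0 \<Longrightarrow> f y \<ge> 0"
  shows "(\<integral>\<^sup>+y. ennreal (f y) * indicator {0<..} y \<partial>lborel) = (\<integral>\<^sup>+x. ennreal (f (x\<^sup>2) * (2 * x)) * indicator {0<..} x \<partial>lborel)"
proof (rule LIMSEQ_unique)
  define a b where "a n = 1 / real (Suc n)" and "b n = real (Suc n)" for n
  have ab: "0 < a n" "a n \<le> b n" for n
  proof -
    have "a n \<le> 1" "1 \<le> b n" by (simp_all add: a_def b_def)
    then show "a n \<le> b n" by (rule order_trans)
  qed (simp add: a_def)
  have mono: "a m \<le> a n" "b n \<le> b m" if "n \<le> m" for n m using that by (auto simp: a_def b_def divide_simps)
  have sub: "(\<integral>\<^sup>+y. ennreal (f y) * indicator {(a n)\<^sup>2..(b n)\<^sup>2} y \<partial>lborel) = (\<integral>\<^sup>+x. ennreal (f (x\<^sup>2) * (2 * x)) * indicator {a n..b n} x \<partial>lborel)" for n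
  proof -
    have "(\<integral>\<^sup>+y. ennreal (f y * indicator {(a n)\<^sup>2..(b n)\<^sup>2} y) \<partial>lborel) = (\<integral>\<^sup>+x. ennreal (f (x\<^sup>2) * (2 * x) * indicator {a n..b n} x) \<partial>lborel)"
      by (rule nn_integral_substitution) (use ab[of n] in \<open>auto intro!: derivative_eq_intros continuous_intros simp: set_borel_measurable_def\<close>)
    then show ?thesis by (simp add: ennreal_indicator[symmetric] ennreal_mult'' flip: ennreal_mult'')
  qed
  have ev: "\<forall>\<^sub>F n in sequentially. a n < e \<and> e < b n" if "e > 0" for e
  proof -
    have "a \<longlonglongrightarrow> 0" unfolding a_def by (rule LIMSEQ_Suc[OF lim_1_over_n])
    then have "\<forall>\<^sub>F n in sequentially. a n < e" using that by (intro order_tendstoD)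
    moreover have "filterlim b at_top sequentially" unfolding b_def by real_asymp
    then have "\<forall>\<^sub>F n in sequentially. e < b n" by (simp add: filterlim_at_top_dense)
    ultimately show ?thesis by eventually_elim auto
  qed
  have lim1: "(\<lambda>n. h y * indicator {a n..b n} y) \<longlonglongrightarrow> h y * indicator {0<..} y" for h :: "real \<Rightarrow> ennreal" and y
  proof (cases "y > 0")
    case True
    have "\<forall>\<^sub>F n in sequentially. h y * indicator {a n..b n} y = h y * indicator {0<..} y"
      using ev[OF True] by eventually_elim (use True in auto)
    then show ?thesis by (rule tendsto_eventually)
  next
    case False
    then have "indicator {a n..b n} y = (0::ennreal)" for n using ab[of n] by auto
    then show ?thesis using False by simp
  qed
  have lim2: "(\<lambda>n. h y * indicator {(a n)\<^sup>2..(b n)\<^sup>2} y) \<longlonglongrightarrow> h y * indicator {0<..} y" for h :: "real \<Rightarrow> ennreal" and y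
  proof (cases "y > 0")
    case True
    then have "\<forall>\<^sub>F n in sequentially. a n < sqrt y \<and> sqrt y < b n" by (intro ev) simp
    then have "\<forall>\<^sub>F n in sequentially. h y * indicator {(a n)\<^sup>2..(b n)\<^sup>2} y = h y * indicator {0<..} y"
    proof eventually_elim
      case (elim n)
      have "(a n)\<^sup>2 \<le> (sqrt y)\<^sup>2" "(sqrt y)\<^sup>2 \<le> (b n)\<^sup>2" using elim ab[of n] True
        by (intro power_mono; simp add: less_imp_le)+
      then show ?case using True by simp
    qed
    then show ?thesis by (rule tendsto_eventually)
  next
    case False
    then have "indicator {(a n)\<^sup>2..(b n)\<^sup>2} y = (0::ennreal)" for n
      using ab(1)[of n] by (auto simp: indicator_def not_le intro: order_less_le_trans[of _ "(a n)\<^sup>2"])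
    then show ?thesis using False by simp
  qed
  show "(\<lambda>n. \<integral>\<^sup>+x. ennreal (f (x\<^sup>2) * (2 * x)) * indicator {a n..b n} x \<partial>lborel) \<longlonglongrightarrow> (\<integral>\<^sup>+x. ennreal (f (x\<^sup>2) * (2 * x)) * indicator {0<..} x \<partial>lborel)"
  proof (rule nn_integral_LIMSEQ)
    show "incseq (\<lambda>n x. ennreal (f (x\<^sup>2) * (2 * x)) * indicator {a n..b n} x)"
      using mono by (fastforce simp: incseq_def le_fun_def indicator_def intro: order_trans)
  qed (use lim1 in auto)
  show "(\<lambda>n. \<integral>\<^sup>+x. ennreal (f (x\<^sup>2) * (2 * x)) * indicator {a n..b n} x \<partial>lborel) \<longlonglongrightarrow> (\<integral>\<^sup>+y. ennreal (f y) * indicator {0<..} y \<partial>lborel)"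
    unfolding sub[symmetric]
  proof (rule nn_integral_LIMSEQ)
    have "(a m)\<^sup>2 \<le> (a n)\<^sup>2 \<and> (b n)\<^sup>2 \<le> (b m)\<^sup>2" if "n \<le> m" for n m
      using mono[OF that] ab[of n] ab[of m] by (intro conjI power_mono) auto
    then show "incseq (\<lambda>n y. ennreal (f y) * indicator {(a n)\<^sup>2..(b n)\<^sup>2} y)"
      by (fastforce simp: incseq_def le_fun_def indicator_def intro: order_trans)
  qed (use lim2 in auto)
qed

text \<open>A positive y has the two square roots on either side of 0; the two terms of
  \<open>qv_density\<close> are their contributions after substitution, the negative one after a
  reflection. The origin is a null set.\<close>

lemma density_qv_density:
  assumes [measurable]: "\<nu> \<in> borel_measurable borel" and pos: "\<And>x. x \<noteq> 0 \<Longrightarrow> \<nu> x > 0"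
  shows "density lborel (\<lambda>y. ennreal (qv_density \<nu> y)) = distr (density lborel (\<lambda>x. ennreal (\<nu> x))) borel (\<lambda>x. x\<^sup>2)"
proof (rule measure_eqI)
  have [measurable]: "qv_density \<nu> \<in> borel_measurable borel" unfolding qv_density_def[abs_def] by measurable
  fix A assume "A \<in> sets (density lborel (\<lambda>y. ennreal (qv_density \<nu> y)))"
  then have A[measurable]: "A \<in> sets borel" by simp
  have "emeasure (density lborel (\<lambda>y. ennreal (qv_density \<nu> y))) A = (\<integral>\<^sup>+y. ennreal (qv_density \<nu> y) * indicator A y \<partial>lborel)"
    by (rule emeasure_density) auto
  also have "\<dots> = (\<integral>\<^sup>+y. ennreal (qv_density \<nu> y * indicator A y) * indicator {0<..} y \<partial>lborel)"
    by (intro nn_integral_cong) (auto simp: qv_density_def indicator_def)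
  also have "\<dots> = (\<integral>\<^sup>+x. ennreal (qv_density \<nu> (x\<^sup>2) * indicator A (x\<^sup>2) * (2 * x)) * indicator {0<..} x \<partial>lborel)"
    by (rule nn_integral_square_substitution) (use pos in \<open>auto simp: qv_density_def indicator_def less_imp_le\<close>)
  also have "\<dots> = (\<integral>\<^sup>+x. ennreal (\<nu> x) * indicator A (x\<^sup>2) * indicator {0<..} x + ennreal (\<nu> (- x)) * indicator A (x\<^sup>2) * indicator {0<..} x \<partial>lborel)"
  proof (rule nn_integral_cong)
    fix x :: real
    show "ennreal (qv_density \<nu> (x\<^sup>2) * indicator A (x\<^sup>2) * (2 * x)) * indicator {0<..} x =
        ennreal (\<nu> x) * indicator A (x\<^sup>2) * indicator {0<..} x + ennreal (\<nu> (- x)) * indicator A (x\<^sup>2) * indicator {0<..} x"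
    proof (cases "x > 0")
      case True
      have "qv_density \<nu> (x\<^sup>2) * (2 * x) = \<nu> x + \<nu> (- x)"
        using True by (simp add: qv_density_def field_simps)
      then show ?thesis
        using True pos[of x] pos[of "- x"] by (auto simp: indicator_def ennreal_plus[symmetric] simp del: ennreal_plus)
    qed simp
  qed
  also have "\<dots> = (\<integral>\<^sup>+x. ennreal (\<nu> x) * indicator A (x\<^sup>2) * indicator {0<..} x \<partial>lborel) + (\<integral>\<^sup>+x. ennreal (\<nu> (- x)) * indicator A (x\<^sup>2) * indicator {0<..} x \<partial>lborel)"
    by (rule nn_integral_add) auto
  also have "(\<integral>\<^sup>+x. ennreal (\<nu> (- x)) * indicator A (x\<^sup>2) * indicator {0<..} x \<partial>lborel) = (\<integral>\<^sup>+x. ennreal (\<nu> x) * indicator A (x\<^sup>2) * indicator {..<0} x \<partial>lborel)"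
    by (subst nn_integral_real_affine[where c="-1" and t=0]) (auto intro!: nn_integral_cong simp: indicator_def)
  also have "(\<integral>\<^sup>+x. ennreal (\<nu> x) * indicator A (x\<^sup>2) * indicator {0<..} x \<partial>lborel) + \<dots> = (\<integral>\<^sup>+x. ennreal (\<nu> x) * indicator A (x\<^sup>2) * indicator {0<..} x + ennreal (\<nu> x) * indicator A (x\<^sup>2) * indicator {..<0} x \<partial>lborel)"
    by (rule nn_integral_add[symmetric]) auto
  also have "\<dots> = (\<integral>\<^sup>+x. ennreal (\<nu> x) * indicator ((\<lambda>x. x\<^sup>2) -` A) x \<partial>lborel)"
  proof (rule nn_integral_cong_AE)
    show "AE x in lborel. ennreal (\<nu> x) * indicator A (x\<^sup>2) * indicator {0<..} x + ennreal (\<nu> x) * indicator A (x\<^sup>2) * indicator {..<0} x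
        = ennreal (\<nu> x) * indicator ((\<lambda>x. x\<^sup>2) -` A) x"
      using AE_lborel_singleton[of 0] by eventually_elim (auto simp: indicator_def)
  qed
  also have "\<dots> = emeasure (density lborel (\<lambda>x. ennreal (\<nu> x))) ((\<lambda>x. x\<^sup>2) -` A)"
    using measurable_sets[of "\<lambda>x::real. x\<^sup>2" borel borel A] by (intro emeasure_density[symmetric]) auto
  also have "\<dots> = emeasure (distr (density lborel (\<lambda>x. ennreal (\<nu> x))) borel (\<lambda>x. x\<^sup>2)) A"
    by (subst emeasure_distr) auto
  finally show "emeasure (density lborel (\<lambda>y. ennreal (qv_density \<nu> y))) A = \<dots>" .
qed simp

section \<open>Calculus of equality up to O(t)\<close>

lemma eq_up_to_O_t_sym: "eq_up_to_O_t f g \<Longrightarrow> eq_up_to_O_t g f"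
  unfolding eq_up_to_O_t_def by (auto elim!: eventually_mono)

lemma eq_up_to_O_t_trans:
  assumes "eq_up_to_O_t f g" "eq_up_to_O_t g h"
  shows "eq_up_to_O_t f h"
proof -
  \<comment> \<open>The constants in \<open>eq_up_to_O_t\<close> carry no sign, and
    \<open>ennreal\<close> sends negative values to 0; absolute values make them additive.\<close>
  have bound: "x \<le> z + ennreal ((\<bar>C\<bar> + \<bar>D\<bar>) * t)"
    if "x \<le> y + ennreal (C * t)" "y \<le> z + ennreal (D * t)" "t > 0" for x y z :: ennreal and C D t :: real
  proof -
    have "ennreal (C * t) \<le> ennreal (\<bar>C\<bar> * t)" "ennreal (D * t) \<le> ennreal (\<bar>D\<bar> * t)"
      using that(3) by (auto intro!: ennreal_leI mult_right_mono)
    then have "x \<le> (z + ennreal (\<bar>D\<bar> * t)) + ennreal (\<bar>C\<bar> * t)"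
      using that(1,2) by (meson add_mono order_refl order_trans)
    also have "\<dots> = z + ennreal ((\<bar>C\<bar> + \<bar>D\<bar>) * t)"
      using that(3) by (simp add: distrib_right add_ac)
    finally show ?thesis .
  qed
  obtain C D where CD: "\<forall>\<^sub>F t in at_right 0. f t \<le> g t + ennreal (C * t) \<and> g t \<le> f t + ennreal (C * t)"
    "\<forall>\<^sub>F t in at_right 0. g t \<le> h t + ennreal (D * t) \<and> h t \<le> g t + ennreal (D * t)"
    using assms unfolding eq_up_to_O_t_def by blast
  have "\<forall>\<^sub>F t in at_right 0. f t \<le> h t + ennreal ((\<bar>C\<bar> + \<bar>D\<bar>) * t) \<and> h t \<le> f t + ennreal ((\<bar>C\<bar> + \<bar>D\<bar>) * t)"
    using CD eventually_at_right_less[of "0::real"]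
  proof eventually_elim
    case (elim t)
    then show ?case using bound[of "f t" "g t" C t "h t" D] bound[of "h t" "g t" D t "f t" C] by (simp add: add.commute)
  qed
  then show ?thesis unfolding eq_up_to_O_t_def by blast
qed

lemma eq_up_to_O_t_cong:
  assumes "\<And>t. t > 0 \<Longrightarrow> f t = f' t" "eq_up_to_O_t f' g"
  shows "eq_up_to_O_t f g"
proof -
  have "eq_up_to_O_t f f'"
    unfolding eq_up_to_O_t_def
    by (intro exI[of _ 0]) (use eventually_at_right_less[of "0::real"] assms(1) in \<open>auto elim!: eventually_mono\<close>)
  then show ?thesis using assms(2) by (rule eq_up_to_O_t_trans)
qed

section \<open>Variance calls\<close>

lemma one_plus_pos_part_le_exp: "1 + max x 0 \<le> 2 * exp \<bar>x::real\<bar>"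
proof -
  have "1 + \<bar>x\<bar> \<le> exp \<bar>x\<bar>" by (rule exp_ge_add_one_self)
  moreover have "0 \<le> exp \<bar>x\<bar>" "max x 0 \<le> \<bar>x\<bar>" by simp_all
  ultimately show ?thesis by linarith
qed

lemma one_plus_square_submult: "1 + (x + y)\<^sup>2 \<le> 2 * (1 + x\<^sup>2) * (1 + (y::real)\<^sup>2)"
proof -
  have "0 \<le> (x - y)\<^sup>2 + 2 * (x * y)\<^sup>2" by simp
  then show ?thesis by (simp add: power2_eq_square algebra_simps)
qed

lemma one_plus_pos_part_submult: "1 + max (x + y) 0 \<le> 2 * (1 + max x 0) * (1 + max (y::real) 0)"
proof -
  have "2 * (1 + max x 0) * (1 + max y 0) = 2 + 2 * max x 0 + 2 * max y 0 + 2 * (max x 0 * max y 0)"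
    by (simp add: algebra_simps)
  moreover have "max (x + y) 0 \<le> max x 0 + max y 0" "0 \<le> max x 0" "0 \<le> max y 0" "0 \<le> max x 0 * max y 0" by auto
  ultimately show ?thesis by linarith
qed

text \<open>Common ground for the Levy measure of X and that of its quadratic variation, so that one
  expansion treats both payoffs.\<close>

locale levy_density = levy_data v b N for v b and N :: "real measure" +
  fixes p :: "real \<Rightarrow> real"
  assumes dens: "N = density lborel (\<lambda>x. ennreal (p x))" and p_measurable[measurable]: "p \<in> borel_measurable borel"
    and p_bounded: "\<And>\<epsilon>. \<epsilon> > 0 \<Longrightarrow> \<exists>B\<ge>0. \<forall>x. \<epsilon> < \<bar>x\<bar> \<longrightarrow> p x \<le> B"
    and p_mass: "\<And>\<epsilon>. 0 < \<epsilon> \<Longrightarrow> measure N {x. \<bar>x\<bar> > \<epsilon>} > 0"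
begin

text \<open>The weight \<open>1 + x\<^sup>2\<close> is integrable over the large jumps exactly when
  the payoff is, since those jumps have finite mass. The kinks sit at \<open>\<plusminus>k\<close>
  with k the square root of K, and \<open>e\<close> is at most a quarter of their distance from
  0.\<close>

lemma eq_up_to_O_t_square_call:
  assumes \<mu>: "\<And>t. t > 0 \<Longrightarrow> real_distribution (\<mu> t)"
      "\<And>t u. t > 0 \<Longrightarrow> char (\<mu> t) u = exp (of_real t * levy_exponent v b N u)"
    and K: "K > 0"
  shows "eq_up_to_O_t (\<lambda>t. ennreal (1 / t) * (\<integral>\<^sup>+x. ennreal (max (x\<^sup>2 - K) 0) \<partial>\<mu> t))
    (\<lambda>t. \<integral>\<^sup>+x. ennreal (max (x\<^sup>2 - K) 0) \<partial>N)"
proof -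
  define k where "k = sqrt K"
  have k: "k > 0" "K = k\<^sup>2" using K by (simp_all add: k_def)
  define e where "e = min 1 (k / 4)"
  interpret levy_split v b N e
    by unfold_locales (use k p_mass[of e] in \<open>auto simp: e_def\<close>)
  obtain B where B: "B \<ge> 0" "\<And>x. e < \<bar>x\<bar> \<Longrightarrow> p x \<le> B" using p_bounded[OF \<epsilon>(1)] by blast
  \<comment> \<open>The derivative of the payoff away from its kinks: 2 x beyond the level
    \<open>k\<close>, and 0 in between.\<close>
  define g' where "g' x = 2 * max (x - k) 0 - 2 * max (- x - k) 0 + 2 * k * (indicator {0<..} (x - k) - indicator {0<..} (- x - k))" for x
  have g'm: "g' \<in> borel_measurable borel" unfolding g'_def[abs_def] by measurable
  have xx: "\<bar>x\<bar> \<le> 1 + x\<^sup>2" for x :: real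
  proof -
    have "0 \<le> (\<bar>x\<bar> - 1)\<^sup>2" by simp
    then have "2 * \<bar>x\<bar> \<le> 1 + x\<^sup>2" by (simp add: power2_eq_square algebra_simps)
    then show ?thesis using abs_ge_zero[of x] by linarith
  qed
  have g'_bd: "\<bar>g' x\<bar> \<le> 2 * (1 + x\<^sup>2)" for x
  proof -
    have "\<bar>g' x\<bar> \<le> 2 * \<bar>x\<bar>"
      using k(1) by (auto simp: g'_def max_def indicator_def abs_if split: if_splits)
    also have "\<dots> \<le> 2 * (1 + x\<^sup>2)" by (intro mult_left_mono xx) simp
    finally show ?thesis .
  qed
  show ?thesis
  proof (rule eq_up_to_O_t_jump_integral[OF \<mu>, where a=k and W="\<lambda>x. 1 + x\<^sup>2" and c=1 and c'="1 + K"])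
    show "max (x\<^sup>2 - K) 0 = 0" if "\<bar>x\<bar> \<le> k" for x
      using that abs_le_square_iff[of x k] k by simp
    show "4 * e \<le> k" by (simp add: e_def)
    show "1 + x\<^sup>2 \<le> 2 * exp \<bar>x\<bar>" for x :: real by (rule one_plus_square_le_exp)
    show "1 + (x + y)\<^sup>2 \<le> 2 * (1 + x\<^sup>2) * (1 + y\<^sup>2)" for x y :: real by (rule one_plus_square_submult)
    show gW: "max (x\<^sup>2 - K) 0 \<le> 1 * (1 + x\<^sup>2)" for x using K by (simp add: max_def)
    show "1 + x\<^sup>2 \<le> (1 + K) * (1 + max (x\<^sup>2 - K) 0)" for x
    proof -
      have "0 \<le> K * max (x\<^sup>2 - K) 0" using K by simp
      then show ?thesis by (simp add: algebra_simps)
    qed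
    assume fin: "(\<integral>\<^sup>+x. ennreal (1 + x\<^sup>2) * indicator {x. e < \<bar>x\<bar>} x \<partial>N) < \<infinity>"
    show "\<exists>k C. \<forall>z. \<bar>enn2real (one_jump (\<lambda>x. max (x\<^sup>2 - K) 0) z) - enn2real (one_jump (\<lambda>x. max (x\<^sup>2 - K) 0) 0) - k * z\<bar> \<le> C * z\<^sup>2"
    proof (rule one_jump_quadratic[OF dens p_measurable B(2) B(1) _ _ _ fin _ g'm _ gW, where d=2 and ?c1.0=2 and ?c2.0="2 * k" and ?k1.0=k and ?k2.0="- k"])
      show "\<bar>max ((z + x)\<^sup>2 - K) 0 - max (x\<^sup>2 - K) 0 - z * g' x\<bar>
          \<le> 2 * z\<^sup>2 + 2 * k * \<bar>z\<bar> * (indicator {k - \<bar>z\<bar>..k + \<bar>z\<bar>} x + indicator {- k - \<bar>z\<bar>..- k + \<bar>z\<bar>} x)" for x z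
        unfolding g'_def k(2) by (rule kinked_square_expansion[OF k(1)])
      show "1 + (x + y)\<^sup>2 \<le> 2 * (1 + x\<^sup>2) * (1 + y\<^sup>2)" for x y :: real by (rule one_plus_square_submult)
    qed (use k g'_bd in auto)
  qed (use K in auto)
qed

text \<open>The weight \<open>1 + max x 0\<close> is one-sided because the payoff does not control negative jumps.\<close>

lemma eq_up_to_O_t_call:
  assumes \<mu>: "\<And>t. t > 0 \<Longrightarrow> real_distribution (\<mu> t)"
      "\<And>t u. t > 0 \<Longrightarrow> char (\<mu> t) u = exp (of_real t * levy_exponent v b N u)"
    and K: "K > 0"
  shows "eq_up_to_O_t (\<lambda>t. ennreal (1 / t) * (\<integral>\<^sup>+y. ennreal (max (y - K) 0) \<partial>\<mu> t))
    (\<lambda>t. \<integral>\<^sup>+y. ennreal (max (y - K) 0) \<partial>N)"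
proof -
  define e where "e = min 1 (K / 4)"
  interpret levy_split v b N e
    by unfold_locales (use K p_mass[of e] in \<open>auto simp: e_def\<close>)
  obtain B where B: "B \<ge> 0" "\<And>x. e < \<bar>x\<bar> \<Longrightarrow> p x \<le> B" using p_bounded[OF \<epsilon>(1)] by blast
  define g' where "g' x = indicat_real {0<..} (x - K)" for x
  have g'm: "g' \<in> borel_measurable borel" unfolding g'_def[abs_def] by measurable
  show ?thesis
  proof (rule eq_up_to_O_t_jump_integral[OF \<mu>, where a=K and W="\<lambda>x. 1 + max x 0" and c=1 and c'="1 + K"])
    show "max (x - K) 0 = 0" if "\<bar>x\<bar> \<le> K" for x using that by simp
    show "4 * e \<le> K" by (simp add: e_def)
    show "1 + max x 0 \<le> 2 * exp \<bar>x\<bar>" for x :: real by (rule one_plus_pos_part_le_exp)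
    show "1 + max (x + y) 0 \<le> 2 * (1 + max x 0) * (1 + max y 0)" for x y :: real by (rule one_plus_pos_part_submult)
    show gW: "max (x - K) 0 \<le> 1 * (1 + max x 0)" for x using K by (simp add: max_def)
    show "1 + max x 0 \<le> (1 + K) * (1 + max (x - K) 0)" for x
    proof -
      have "0 \<le> K * max (x - K) 0" using K by simp
      moreover have "1 + max x 0 \<le> 1 + K + max (x - K) 0" using K by (simp add: max_def)
      ultimately show ?thesis by (simp only: distrib_left distrib_right mult_1_left mult_1_right)
    qed
    assume fin: "(\<integral>\<^sup>+x. ennreal (1 + max x 0) * indicator {x. e < \<bar>x\<bar>} x \<partial>N) < \<infinity>"
    show "\<exists>k C. \<forall>z. \<bar>enn2real (one_jump (\<lambda>x. max (x - K) 0) z) - enn2real (one_jump (\<lambda>x. max (x - K) 0) 0) - k * z\<bar> \<le> C * z\<^sup>2"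
    \<comment> \<open>The payoff is piecewise linear, hence \<open>c1 = 0\<close>; its single kink
      is entered twice to fit the bound with two kinks.\<close>
    proof (rule one_jump_quadratic[OF dens p_measurable B(2) B(1) _ _ _ fin _ g'm _ gW, where d=1 and ?c1.0=0 and ?c2.0=1 and ?k1.0=K and ?k2.0=K])
      show "\<bar>max (z + x - K) 0 - max (x - K) 0 - z * g' x\<bar>
          \<le> 0 * z\<^sup>2 + 1 * \<bar>z\<bar> * (indicator {K - \<bar>z\<bar>..K + \<bar>z\<bar>} x + indicator {K - \<bar>z\<bar>..K + \<bar>z\<bar>} x)" for x z
      proof -
        have "\<bar>max ((x - K) + z) 0 - max (x - K) 0 - z * g' x\<bar> \<le> \<bar>z\<bar> * indicator {-\<bar>z\<bar>..\<bar>z\<bar>} (x - K)"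
          unfolding g'_def by (rule pos_part_expansion)
        also have "\<dots> \<le> 0 * z\<^sup>2 + 1 * \<bar>z\<bar> * (indicator {K - \<bar>z\<bar>..K + \<bar>z\<bar>} x + indicator {K - \<bar>z\<bar>..K + \<bar>z\<bar>} x)"
          by (auto simp: indicator_def)
        finally show ?thesis by (simp add: algebra_simps)
      qed
      show "1 + max (x + y) 0 \<le> 2 * (1 + max x 0) * (1 + max y 0)" for x y :: real by (rule one_plus_pos_part_submult)
      show "\<bar>g' x\<bar> \<le> 1 * (1 + max x 0)" for x by (auto simp: g'_def indicator_def)
    qed auto
  qed (use K in auto)
qed

end


theorem mainTheorem8:
  fixes M :: "'a measure"
    and X S :: "real \<Rightarrow> 'a \<Rightarrow> real"
    and \<nu> :: "real \<Rightarrow> real"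
    and \<sigma> b S0 K :: real
  assumes levy: "levy_process M X"
    and triplet: "has_levy_triplet M X (\<sigma>\<^sup>2) b (density lborel (\<lambda>x. ennreal (\<nu> x)))"
    and standing: "standing_assumptions \<sigma> b \<nu>"
    and S0: "S0 > 0"
    and S: "\<And>t \<omega>. t \<ge> 0 \<Longrightarrow> \<omega> \<in> space M \<Longrightarrow> S t \<omega> = S0 * exp (X t \<omega>)"
    and K: "K > 0"
  shows
    "(\<exists>Y. indistinguishable M (quad_var \<sigma> X) Y \<and> subordinator M Y \<and>
         has_levy_density M Y (qv_density \<nu>)) \<and>
     eq_up_to_O_t
       (\<lambda>t. ennreal (1 / t) * (\<integral>\<^sup>+\<omega>. ennreal (max (quad_var \<sigma> X t \<omega> - K) 0) \<partial>M))
       (\<lambda>t. \<integral>\<^sup>+y\<in>{0<..}. ennreal (max (y - K) 0 * qv_density \<nu> y) \<partial>lborel) \<and>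
     eq_up_to_O_t
       (\<lambda>t. ennreal (1 / t) * (\<integral>\<^sup>+\<omega>. ennreal (max (quad_var \<sigma> X t \<omega> - K) 0) \<partial>M))
       (\<lambda>t. \<integral>\<^sup>+x. ennreal (max (x\<^sup>2 - K) 0 * \<nu> x) \<partial>lborel) \<and>
     eq_up_to_O_t
       (\<lambda>t. ennreal (1 / t) * (\<integral>\<^sup>+\<omega>. ennreal (max (quad_var \<sigma> X t \<omega> - K) 0) \<partial>M))
       (\<lambda>t. ennreal (1 / t) * (\<integral>\<^sup>+\<omega>. ennreal (max ((X t \<omega>)\<^sup>2 - K) 0) \<partial>M)) \<and>
     eq_up_to_O_t
       (\<lambda>t. ennreal (1 / t) * (\<integral>\<^sup>+\<omega>. ennreal (max (quad_var \<sigma> X t \<omega> - K) 0) \<partial>M))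
       (\<lambda>t. ennreal (1 / t) * (\<integral>\<^sup>+\<omega>. ennreal (max ((ln (S t \<omega> / S0))\<^sup>2 - K) 0) \<partial>M))"
proof -

  \<comment> \<open>The Levy measure of X and good sets of paths\<close>
  define N where "N = density lborel (\<lambda>x. ennreal (\<nu> x))"
  define N' where "N' = density lborel (\<lambda>y. ennreal (qv_density \<nu> y))"
  have pos: "\<nu> x > 0" if "x \<noteq> 0" for x
    using standing that by (simp add: standing_assumptions_def Let_def)
  have "continuous_on (- {0}) \<nu>"
    using standing by (auto simp: standing_assumptions_def Let_def intro: C1_differentiable_imp_continuous_on)
  then have \<nu>m[measurable]: "\<nu> \<in> borel_measurable borel"
    by (intro borel_measurable_continuous_countable_exceptions[of "{0}"]) auto
  have qm[measurable]: "qv_density \<nu> \<in> borel_measurable borel" unfolding qv_density_def[abs_def] by measurable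
  have \<nu>_bdd: "\<exists>B\<ge>0. \<forall>x. \<epsilon> < \<bar>x\<bar> \<longrightarrow> \<nu> x \<le> B" if "\<epsilon> > 0" for \<epsilon>
  proof -
    have "bdd_above (\<nu> ` {x. \<bar>x\<bar> > \<epsilon>})" using standing that by (simp add: standing_assumptions_def Let_def)
    then obtain B where B: "\<And>x. \<epsilon> < \<bar>x\<bar> \<Longrightarrow> \<nu> x \<le> B" by (auto simp: bdd_above_def)
    have "0 < \<nu> (\<epsilon> + 1)" "\<nu> (\<epsilon> + 1) \<le> B" using that by (auto intro!: pos B)
    then have "0 \<le> B" by linarith
    then show ?thesis using B by (intro exI[of _ B]) auto
  qed
  have N'_distr: "N' = distr N borel (\<lambda>x. x\<^sup>2)"
    unfolding N_def N'_def by (rule density_qv_density[OF \<nu>m pos])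
  have triplet: "levy_measure N" "\<And>t u. t \<ge> 0 \<Longrightarrow> char (distr M borel (X t)) u = exp (of_real t * levy_exponent (\<sigma>\<^sup>2) b N u)"
    using triplet by (simp_all add: has_levy_triplet_def N_def)
  interpret N: levy_data "\<sigma>\<^sup>2" b N by unfold_locales (use triplet in auto)
  have mass: "measure N {x. \<bar>x\<bar> > \<epsilon>} > 0" if \<epsilon>: "\<epsilon> > 0" for \<epsilon>
  proof -
    have A: "{x::real. \<bar>x\<bar> > \<epsilon>} \<in> sets borel" by measurable
    have fin: "emeasure N {x. \<bar>x\<bar> > \<epsilon>} < \<infinity>" using N.emeasure_big[OF A order_refl \<epsilon>] .
    have "emeasure N {x. \<bar>x\<bar> > \<epsilon>} \<noteq> 0"
    proof
      assume "emeasure N {x. \<bar>x\<bar> > \<epsilon>} = 0"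
      then have "(\<integral>\<^sup>+x. ennreal (\<nu> x) * indicator {x. \<bar>x\<bar> > \<epsilon>} x \<partial>lborel) = 0"
        unfolding N_def by (subst (asm) emeasure_density) auto
      then have "AE x in lborel. ennreal (\<nu> x) * indicator {x. \<bar>x\<bar> > \<epsilon>} x = 0"
        by (subst (asm) nn_integral_0_iff_AE) auto
      then have "AE x in lborel. x \<notin> {\<epsilon><..\<epsilon>+1}"
      proof eventually_elim
        case (elim x)
        show ?case
        proof
          assume "x \<in> {\<epsilon><..\<epsilon>+1}"
          then show False using elim \<epsilon> pos[of x] by auto
        qed
      qed
      then have "{\<epsilon><..\<epsilon>+1} \<in> null_sets lborel"
        by (subst AE_iff_null_sets) auto
      then have "emeasure lborel {\<epsilon><..\<epsilon>+1} = 0" by (rule null_setsD1)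
      then show False by simp
    qed
    then show ?thesis using fin by (simp add: measure_def enn2real_positive_iff zero_less_iff_neq_zero)
  qed
  have "AE \<omega> in M. cadlag (\<lambda>t. X t \<omega>)" and prob: "prob_space M"
    using levy by (auto simp: levy_process_def)
  from AE_E3[OF this(1)] obtain N0 where N0: "\<And>\<omega>. \<omega> \<in> space M - N0 \<Longrightarrow> cadlag (\<lambda>t. X t \<omega>)" "N0 \<in> null_sets M"
    by blast
  have good: "space M - A \<in> sets M" "AE \<omega> in M. \<omega> \<in> space M - A" if "A \<in> null_sets M" for A
  proof -
    show "space M - A \<in> sets M" using that by auto
    show "AE \<omega> in M. \<omega> \<in> space M - A"
      using AE_not_in[OF that] AE_space by eventually_elim simp
  qed
  \<comment> \<open>This interpretation, on the paths that are cadlag, serves to derive summability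
    of the squared jumps; a second one follows on the smaller set where that holds as well.\<close>
  interpret L: levy_path M "\<sigma>\<^sup>2" b N X "space M - N0"
    by (rule levy_path.intro[OF prob N.levy_data_axioms
        levy_path_axioms.intro[OF levy triplet(2) mass good[OF N0(2)] N0(1)]])
  obtain N1 where N1: "N1 \<in> null_sets M"
    "\<And>\<omega>. \<omega> \<in> space M - N1 \<Longrightarrow> \<omega> \<in> space M - N0 \<and> (\<forall>t\<ge>0. (\<lambda>s. (jump (\<lambda>r. X r \<omega>) s)\<^sup>2) summable_on {0<..t})"
    by (rule AE_E3[OF L.AE_summable_squared_jumps]) (rule that)
  have cadlag1: "cadlag (\<lambda>t. X t \<omega>)" if "\<omega> \<in> space M - N1" for \<omega>
    by (rule N0(1)[OF conjunct1[OF N1(2)[OF that]]])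
  have summable1: "(\<lambda>s. (jump (\<lambda>r. X r \<omega>) s)\<^sup>2) summable_on {0<..t}" if "\<omega> \<in> space M - N1" "t \<ge> 0" for \<omega> t
    by (rule conjunct2[OF N1(2)[OF that(1)], rule_format, OF that(2)])
  interpret Q: levy_path_summable M "\<sigma>\<^sup>2" b N X "space M - N1"
    by (rule levy_path_summable.intro[OF levy_path.intro[OF prob N.levy_data_axioms
        levy_path_axioms.intro[OF levy triplet(2) mass good[OF N1(1)] cadlag1]]
        levy_path_summable_axioms.intro[OF summable1]])
  let ?Y = "Q.qv_process"
  have qv: "quad_var \<sigma> X t \<omega> = ?Y t \<omega>" if "\<omega> \<in> space M - N1" for t \<omega>
    using that by (simp add: quad_var_def Q.qv_process_def Q.jumps_def jump_sum_def)
  have AE_qv: "AE \<omega> in M. \<forall>t. quad_var \<sigma> X t \<omega> = ?Y t \<omega>"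
    using Q.AE_\<Omega> by eventually_elim (simp add: qv)
  then have indist: "indistinguishable M (quad_var \<sigma> X) ?Y"
    unfolding indistinguishable_def by eventually_elim simp

  \<comment> \<open>The triplet of the quadratic variation\<close>
  have i_sq: "integrable N (\<lambda>x. x\<^sup>2 * indicator {-1..1} (x\<^sup>2))"
    by (rule Bochner_Integration.integrable_bound[OF N.integrable_min]) (auto simp: indicator_def)
  \<comment> \<open>The quadratic variation has no Gaussian part: \<open>\<sigma>\<^sup>2\<close>
    turns into drift. The integral restores the compensator of jumps up to 1 that the triplet
    convention subtracts although squared jumps are summable.\<close>
  define b' where "b' = \<sigma>\<^sup>2 + (LINT x|N. x\<^sup>2 * indicator {-1..1} (x\<^sup>2))"
  have levy_N': "levy_measure N'"
    unfolding levy_measure_def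
  proof (intro conjI)
    show "sets N' = sets borel" by (simp add: N'_def)
    show "emeasure N' {0} = 0"
      unfolding N'_def by (subst emeasure_density) (auto simp: qv_density_def indicator_def intro!: nn_integral_zero')
    have "(\<integral>\<^sup>+y. ennreal (min 1 (y\<^sup>2)) \<partial>N') = (\<integral>\<^sup>+x. ennreal (min 1 ((x\<^sup>2)\<^sup>2)) \<partial>N)"
      unfolding N'_distr by (rule nn_integral_distr) auto
    also have "\<dots> \<le> (\<integral>\<^sup>+x. ennreal (min 1 (x\<^sup>2)) \<partial>N)"
    proof (intro nn_integral_mono ennreal_leI)
      fix x :: real
      have min_le: "min 1 (y\<^sup>2) \<le> min 1 y" if "0 \<le> y" for y :: real
      proof (cases "y \<le> 1")
        case True
        then have "y\<^sup>2 \<le> y" using that by (simp add: power2_eq_square mult_left_le)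
        then show ?thesis by (intro min.mono) simp_all
      qed simp
      show "min 1 ((x\<^sup>2)\<^sup>2) \<le> min 1 (x\<^sup>2)" by (rule min_le) simp
    qed
    also have "\<dots> < \<infinity>" using triplet(1) by (simp add: levy_measure_def)
    finally show "(\<integral>\<^sup>+y. ennreal (min 1 (y\<^sup>2)) \<partial>N') < \<infinity>" .
  qed
  have exponent: "levy_exponent 0 b' N' u = \<i> * of_real (u * \<sigma>\<^sup>2) + (CLINT x|N. iexp (u * x\<^sup>2) - 1)" for u
  proof -
    have i1: "complex_integrable N (\<lambda>x. iexp (u * x\<^sup>2) - 1)"
    proof (rule Bochner_Integration.integrable_bound[OF integrable_mult_right[OF Q.integrable_min_scaled[of "\<bar>u\<bar>"], of 2]])
      show "AE x in N. norm (iexp (u * x\<^sup>2) - 1) \<le> norm (2 * min 1 (\<bar>u\<bar> * x\<^sup>2))"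
      proof (rule AE_I2)
        fix x
        have min2: "y \<le> norm (2 * min 1 q)" if "0 \<le> q" "y \<le> q" "y \<le> 2" for y q :: real
          using that by (simp add: min_def)
        have "norm (iexp (u * x\<^sup>2) - 1) \<le> \<bar>u\<bar> * x\<^sup>2"
          using iexp_remainder_1[of "u * x\<^sup>2"] by (simp add: abs_mult)
        moreover have "norm (iexp (u * x\<^sup>2) - 1) \<le> 2"
          using norm_triangle_ineq4[of "iexp (u * x\<^sup>2)" 1] by simp
        ultimately show "norm (iexp (u * x\<^sup>2) - 1) \<le> norm (2 * min 1 (\<bar>u\<bar> * x\<^sup>2))"
          by (intro min2) simp_all
      qed
    qed auto
    define w where "w x = x\<^sup>2 * indicat_real {-1..1} (x\<^sup>2)" for x :: real
    have i2: "complex_integrable N (\<lambda>x. \<i> * of_real u * of_real (w x))"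
      unfolding w_def by (intro integrable_mult_right integrable_of_real i_sq)
    have "(CLINT y|N'. exp (\<i> * of_real (u * y)) - 1 - \<i> * of_real (u * y * indicator {-1..1} y))
      = (CLINT x|N. exp (\<i> * of_real (u * x\<^sup>2)) - 1 - \<i> * of_real (u * x\<^sup>2 * indicator {-1..1} (x\<^sup>2)))"
      unfolding N'_distr by (rule integral_distr) auto
    also have "\<dots> = (CLINT x|N. (iexp (u * x\<^sup>2) - 1) - \<i> * of_real u * of_real (w x))"
      by (simp add: w_def mult_ac)
    also have "\<dots> = (CLINT x|N. iexp (u * x\<^sup>2) - 1) - (CLINT x|N. \<i> * of_real u * of_real (w x))"
      by (rule Bochner_Integration.integral_diff[OF i1 i2])
    also have "(CLINT x|N. \<i> * of_real u * of_real (w x)) = \<i> * of_real u * of_real (LINT x|N. w x)"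
      by (simp only: integral_mult_right_zero integral_complex_of_real)
    finally have eq: "(CLINT y|N'. exp (\<i> * of_real (u * y)) - 1 - \<i> * of_real (u * y * indicator {-1..1} y))
        = (CLINT x|N. iexp (u * x\<^sup>2) - 1) - \<i> * of_real u * of_real (LINT x|N. w x)" .
    have b'w: "b' = \<sigma>\<^sup>2 + (LINT x|N. w x)" by (simp add: b'_def w_def)
    show ?thesis
      unfolding levy_exponent_def eq b'w by (simp add: algebra_simps)
  qed
  have char_Y: "char (distr M borel (?Y t)) u = exp (of_real t * levy_exponent 0 b' N' u)" if "t \<ge> 0" for t u
    unfolding exponent by (rule Q.char_qv_process[OF that])
  have triplet_Y: "has_levy_triplet M ?Y 0 b' N'"
    unfolding has_levy_triplet_def
  proof (intro conjI allI impI)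
    show "levy_measure N'" by (rule levy_N')
    show "char (distr M borel (?Y t)) u = exp (of_real t * levy_exponent 0 b' N' u)" if "0 \<le> t" for t u
      by (rule char_Y[OF that])
  qed simp
  have has_density: "has_levy_density M ?Y (qv_density \<nu>)"
    unfolding has_levy_density_def N'_def[symmetric] by (rule exI, rule exI, rule triplet_Y)

  \<comment> \<open>Both Levy measures as instances of the density setting\<close>
  have mass': "measure N' {y. \<bar>y\<bar> > \<epsilon>} > 0" if "\<epsilon> > 0" for \<epsilon>
  proof -
    have "(\<lambda>x. x\<^sup>2) -` {y. \<bar>y\<bar> > \<epsilon>} = {x. \<bar>x\<bar> > sqrt \<epsilon>}"
    proof -
      have "\<epsilon> < x\<^sup>2 \<longleftrightarrow> sqrt \<epsilon> < \<bar>x\<bar>" for x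
        using real_sqrt_less_iff[of \<epsilon> "x\<^sup>2"] by simp
      then show ?thesis by auto
    qed
    then have "measure N' {y. \<bar>y\<bar> > \<epsilon>} = measure N {x. \<bar>x\<bar> > sqrt \<epsilon>}"
      unfolding N'_distr by (subst measure_distr) auto
    then show ?thesis using mass[of "sqrt \<epsilon>"] that by simp
  qed
  interpret DN: levy_density "\<sigma>\<^sup>2" b N \<nu>
    by unfold_locales (use \<nu>_bdd mass in \<open>auto simp: N_def\<close>)
  interpret DN': levy_density 0 b' N' "qv_density \<nu>"
  proof unfold_locales
    show "\<exists>B\<ge>0. \<forall>y. \<epsilon> < \<bar>y\<bar> \<longrightarrow> qv_density \<nu> y \<le> B" if \<epsilon>: "\<epsilon> > 0" for \<epsilon>
    proof -
      have s: "sqrt \<epsilon> > 0" using \<epsilon> by simp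
      obtain B where B: "B \<ge> 0" "\<And>x. sqrt \<epsilon> < \<bar>x\<bar> \<Longrightarrow> \<nu> x \<le> B" using \<nu>_bdd[OF s] by blast
      have "qv_density \<nu> y \<le> B / sqrt \<epsilon>" if y: "\<epsilon> < \<bar>y\<bar>" for y
      proof (cases "y > 0")
        case True
        then have sy: "sqrt \<epsilon> < sqrt y" using y by simp
        have \<nu>B: "\<nu> (sqrt y) \<le> B" "\<nu> (- sqrt y) \<le> B" using sy s by (auto intro!: B(2))
        have "qv_density \<nu> y = \<nu> (sqrt y) / (2 * sqrt y) + \<nu> (- sqrt y) / (2 * sqrt y)"
          using True by (simp add: qv_density_def)
        also have "\<dots> \<le> B / (2 * sqrt y) + B / (2 * sqrt y)"
          by (intro add_mono divide_right_mono \<nu>B) (use True in simp_all)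
        also have "\<dots> = B / sqrt y" by simp
        also have "\<dots> \<le> B / sqrt \<epsilon>" using sy s B(1) by (intro divide_left_mono) auto
        finally show ?thesis .
      next
        case False
        then show ?thesis using B(1) \<epsilon> by (simp add: qv_density_def)
      qed
      then show ?thesis using B(1) s by (intro exI[of _ "B / sqrt \<epsilon>"]) auto
    qed
  qed (use levy_N' mass' in \<open>auto simp: N'_def\<close>)

  \<comment> \<open>Reduction of all payoffs to one integral\<close>
  let ?E = "\<lambda>t. ennreal (1 / t) * (\<integral>\<^sup>+\<omega>. ennreal (max (quad_var \<sigma> X t \<omega> - K) 0) \<partial>M)"
  let ?EX = "\<lambda>t. ennreal (1 / t) * (\<integral>\<^sup>+\<omega>. ennreal (max ((X t \<omega>)\<^sup>2 - K) 0) \<partial>M)"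
  let ?I = "\<integral>\<^sup>+x. ennreal (max (x\<^sup>2 - K) 0) \<partial>N"
  \<comment> \<open>The factor \<open>c\<close> may have any sign, since the value of \<nu> at 0 is
    unconstrained; the nonnegative payoff alone justifies splitting the product.\<close>
  have pay_mult: "ennreal (max a 0 * c) = ennreal c * ennreal (max a 0)" for a c :: real
    by (subst ennreal_mult') (simp_all only: max.cobounded2 mult.commute)
  have I_nu: "(\<integral>\<^sup>+x. ennreal (max (x\<^sup>2 - K) 0 * \<nu> x) \<partial>lborel) = ?I"
    unfolding N_def pay_mult by (rule nn_integral_density[symmetric]) measurable
  have I_N': "(\<integral>\<^sup>+y. ennreal (max (y - K) 0) \<partial>N') = ?I"
    unfolding N'_distr by (rule nn_integral_distr) auto
  have "(\<integral>\<^sup>+y\<in>{0<..}. ennreal (max (y - K) 0 * qv_density \<nu> y) \<partial>lborel) = (\<integral>\<^sup>+y. ennreal (qv_density \<nu> y) * ennreal (max (y - K) 0) \<partial>lborel)"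
    unfolding pay_mult by (intro nn_integral_cong) (simp add: qv_density_def indicator_def)
  also have "\<dots> = (\<integral>\<^sup>+y. ennreal (max (y - K) 0) \<partial>N')"
    unfolding N'_def by (rule nn_integral_density[symmetric]) measurable
  finally have I_q: "(\<integral>\<^sup>+y\<in>{0<..}. ennreal (max (y - K) 0 * qv_density \<nu> y) \<partial>lborel) = ?I"
    unfolding I_N' .
  have E: "eq_up_to_O_t ?E (\<lambda>t. ?I)"
  proof (rule eq_up_to_O_t_cong)
    fix t :: real assume t: "t > 0"
    have [measurable]: "?Y t \<in> borel_measurable M" using t by (intro Q.qv_process_measurable) simp
    have "(\<integral>\<^sup>+\<omega>. ennreal (max (quad_var \<sigma> X t \<omega> - K) 0) \<partial>M) = (\<integral>\<^sup>+\<omega>. ennreal (max (?Y t \<omega> - K) 0) \<partial>M)"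
      by (rule nn_integral_cong_AE) (use AE_qv in eventually_elim, simp)
    also have "\<dots> = (\<integral>\<^sup>+y. ennreal (max (y - K) 0) \<partial>distr M borel (?Y t))"
      by (rule nn_integral_distr[symmetric]) auto
    finally show "?E t = ennreal (1 / t) * (\<integral>\<^sup>+y. ennreal (max (y - K) 0) \<partial>distr M borel (?Y t))" by simp
  next
    show "eq_up_to_O_t (\<lambda>t. ennreal (1 / t) * (\<integral>\<^sup>+y. ennreal (max (y - K) 0) \<partial>distr M borel (?Y t))) (\<lambda>t. ?I)"
      unfolding I_N'[symmetric]
      by (rule DN'.eq_up_to_O_t_call[OF _ _ K])
         (auto simp: char_Y intro!: prob_space.real_distribution_distr[OF prob] Q.qv_process_measurable)
  qed
  have EX: "eq_up_to_O_t ?EX (\<lambda>t. ?I)"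
  proof (rule eq_up_to_O_t_cong)
    fix t :: real assume t: "t > 0"
    have [measurable]: "X t \<in> borel_measurable M" using t by (intro Q.X_measurable) simp
    show "?EX t = ennreal (1 / t) * (\<integral>\<^sup>+x. ennreal (max (x\<^sup>2 - K) 0) \<partial>distr M borel (X t))"
      by (subst nn_integral_distr) auto
  next
    show "eq_up_to_O_t (\<lambda>t. ennreal (1 / t) * (\<integral>\<^sup>+x. ennreal (max (x\<^sup>2 - K) 0) \<partial>distr M borel (X t))) (\<lambda>t. ?I)"
      by (rule DN.eq_up_to_O_t_square_call[OF _ _ K])
         (auto simp: triplet(2) intro!: Q.real_distribution_X)
  qed
  have ES: "eq_up_to_O_t (\<lambda>t. ennreal (1 / t) * (\<integral>\<^sup>+\<omega>. ennreal (max ((ln (S t \<omega> / S0))\<^sup>2 - K) 0) \<partial>M)) (\<lambda>t. ?I)"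
  proof (rule eq_up_to_O_t_cong[OF _ EX])
    fix t :: real assume "t > 0"
    then have "(\<integral>\<^sup>+\<omega>. ennreal (max ((ln (S t \<omega> / S0))\<^sup>2 - K) 0) \<partial>M) = (\<integral>\<^sup>+\<omega>. ennreal (max ((X t \<omega>)\<^sup>2 - K) 0) \<partial>M)"
      using S S0 by (intro nn_integral_cong) simp
    then show "ennreal (1 / t) * (\<integral>\<^sup>+\<omega>. ennreal (max ((ln (S t \<omega> / S0))\<^sup>2 - K) 0) \<partial>M) = ?EX t" by simp
  qed
  show ?thesis
    unfolding I_nu I_q
    using indist Q.subordinator_qv_process has_density E
      eq_up_to_O_t_trans[OF E eq_up_to_O_t_sym[OF EX]] eq_up_to_O_t_trans[OF E eq_up_to_O_t_sym[OF ES]]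
    by blast
qed

end
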